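(* Suppose the initial state satisfies $\underline\omega\in\widetilde\Omega$. Then there are finite constants $A^{\underline\omega}$ and $B^{\underline\omega}$, depending on the initial state $\underline\omega$, such that the limiting height process $(h_i(t))$ started from $\underline\omega$ satisfies $$\mathbf E^{\underline\omega}[h_i(t)]\le A^{\underline\omega}t+B^{\underline\omega}|i|\qquad\text{for all }0\le t<\infty\text{ and all }i\in\mathbb Z .$$
   Context: Rate function: $r:\mathbb Z\to(0,\infty)$ is fixed, strictly increasing, satisfies $r(z)\,r(1-z)=1$ for all $z\in\mathbb Z$, $\lim_{z\to\infty}r(z)=\infty$, and there is $\beta>0$ with $r(z)<e^{\beta z}$ for all $z>0$. Configurations: for $\underline\omega\in\Omega=\mathbb Z^{\mathbb Z}$, $\underline\omega^{(i,i+1)}$ is obtained by replacing $\omega_i$ by $\omega_i-1$ and $\omega_{i+1}$ by $\omega_{i+1}+1$. Heights $(h_i)$ are related to increments by $\omega_i=h_{i-1}-h_i$; initially $h_0(0)=0$. State space: $K_{\underline\omega}:=\max\{\limsup_{i\to-\infty}\frac1{|i|}\sum_{j=i+1}^0|\omega_j|,\ \limsup_{i\to\infty}\frac1i\sum_{j=1}^i|\omega_j|\}\in[0,\infty]$ and $\widetilde\Omega:=\{\underline\omega\in\Omega:K_{\underline\omega}<\infty\}$. Finite-volume processes: let $(N_i)_{i\in\mathbb Z}$ be i.i.d. rate-1 homogeneous Poisson point processes on $\mathbb R_+^2$. For integers $\ell<\mathfrak r$ the $[\ell,\mathfrak r]$-monotone process $\underline\omega^{[\ell,\mathfrak r]}(\cdot)$,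 with heights $h^{[\ell,\mathfrak r]}_i(\cdot)$, started from $\underline\omega$, is defined as follows: for $\ell\le i<\mathfrak r$, at each time $t$ such that $N_i$ has a point $(t,y)$ with $0<y<r(\omega_i(t-))+r(-\omega_{i+1}(t-))$, the jump $\underline\omega\to\underline\omega^{(i,i+1)}$, $h_i\to h_i+1$ takes place; no other changes occur. (This is a non-explosive Markov jump process in which the jump $\underline\omega\to\underline\omega^{(i,i+1)}$ has rate $r(\omega_i)+r(-\omega_{i+1})$ for $\ell\le i<\mathfrak r$.) All these processes use the same $(N_i)$ and the same initial state. Limiting process: almost surely $h_i^{[\ell,\mathfrak r]}(t)$ is nondecreasing as the interval $[\ell,\mathfrak r]$ grows, and $h_i(t):=\lim_{[\ell,\mathfrak r]\nearrow\mathbb Z}h_i^{[\ell,\mathfrak r]}(t)\in(-\infty,\infty]$. $\mathbf E^{\underline\omega}$ denotes expectation for the processes started from $\underline\omega$. *)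

theory Defs
  imports "HOL-Probability.Probability"
begin

section \<open>Rate function and state space\<close>

definition rate_function :: "(int \<Rightarrow> real) \<Rightarrow> bool" where
  "rate_function r \<longleftrightarrow>
     (\<forall>z. 0 < r z) \<and>
     strict_mono r \<and>
     (\<forall>z. r z * r (1 - z) = 1) \<and>
     filterlim r at_top at_top \<and>
     (\<exists>\<beta>>0. \<forall>z>0. r z < exp (\<beta> * real_of_int z))"

definition K_bound :: "(int \<Rightarrow> int) \<Rightarrow> ereal" where
  "K_bound \<omega> =
     max (Limsup at_bot (\<lambda>i::int. ereal (1 / \<bar>real_of_int i\<bar> * (\<Sum>j=i+1..0. \<bar>real_of_int (\<omega> j)\<bar>))))
         (Limsup at_top (\<lambda>i::int. ereal (1 / real_of_int i * (\<Sum>j=1..i. \<bar>real_of_int (\<omega> j)\<bar>))))"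

definition Omega_tilde :: "(int \<Rightarrow> int) set" where
  "Omega_tilde = {\<omega>. K_bound \<omega> < \<infinity>}"

section \<open>Poisson point processes\<close>

text \<open>A point process is represented by its random set of points, so it is simple by construction.
  Counts take values in \<^typ>\<open>ennreal\<close>, so that an infinite set of points has count \<open>\<infinity>\<close>.
  The Poisson weights are written out, since \<^const>\<open>poisson_pmf\<close> is unspecified at rate \<open>0\<close> and
  null sets have to be covered.\<close>

definition point_count :: "('w \<Rightarrow> 'p set) \<Rightarrow> 'p set \<Rightarrow> 'w \<Rightarrow> ennreal" where
  "point_count X A w = emeasure (count_space UNIV) (X w \<inter> A)"

definition poisson_point_process :: "'w measure \<Rightarrow> 'p measure \<Rightarrow> ('w \<Rightarrow> 'p set) \<Rightarrow> bool" where
  "poisson_point_process M \<mu> X \<longleftrightarrow>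
     (\<forall>w\<in>space M. X w \<subseteq> space \<mu>) \<and>
     (\<forall>A\<in>sets \<mu>. point_count X A \<in> borel_measurable M) \<and>
     (\<forall>A\<in>sets \<mu>. emeasure \<mu> A < \<infinity> \<longrightarrow>
        (\<forall>k::nat. measure M {w \<in> space M. point_count X A w = of_nat k}
                  = measure \<mu> A ^ k / fact k * exp (- measure \<mu> A))) \<and>
     (\<forall>(I::nat set) A. finite I \<and> A ` I \<subseteq> sets \<mu> \<and> disjoint_family_on A I \<longrightarrow>
        prob_space.indep_vars M (\<lambda>_. borel) (\<lambda>k. point_count X (A k)) I)"

definition quadrant :: "(real \<times> real) measure" where
  "quadrant = restrict_space lborel ({0..} \<times> {0..})"

text \<open>Independence of the processes \<open>N i\<close> is independence of the families of all their counts.\<close>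

definition driving_noise :: "'w measure \<Rightarrow> (int \<Rightarrow> 'w \<Rightarrow> (real \<times> real) set) \<Rightarrow> bool" where
  "driving_noise M N \<longleftrightarrow>
     prob_space M \<and>
     (\<forall>i. poisson_point_process M quadrant (N i)) \<and>
     prob_space.indep_vars M (\<lambda>_. PiM (sets quadrant) (\<lambda>_. borel))
       (\<lambda>i w. \<lambda>A\<in>sets quadrant. point_count (N i) A w) UNIV"

section \<open>The finite-volume processes\<close>

text \<open>The evolution is described through the heights; the configuration at any time consists of
  the increments of the heights.\<close>

definition increments :: "(int \<Rightarrow> int) \<Rightarrow> int \<Rightarrow> int" where
  "increments h i = h (i - 1) - h i"

lemma increments_jump:
  "increments (h(i := h i + 1)) =
     (increments h)(i := increments h i - 1, i + 1 := increments h (i + 1) + 1)"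
  by (auto simp: increments_def fun_eq_iff)

text \<open>\<open>P i\<close> is a realization of the point set of the \<open>i\<close>-th Poisson process, and \<open>g\<close> is the height
  function just before time \<open>t\<close>. Limits are coordinatewise, in the discrete space of integers, and
  only the finitely many coordinates in \<open>{l..<u}\<close> ever move. In particular, existence of the left
  limits excludes accumulation of jumps.\<close>

definition monotone_path ::
  "(int \<Rightarrow> real) \<Rightarrow> (int \<Rightarrow> (real \<times> real) set) \<Rightarrow> int \<Rightarrow> int \<Rightarrow> (int \<Rightarrow> int) \<Rightarrow>
   (real \<Rightarrow> int \<Rightarrow> int) \<Rightarrow> bool" where
  "monotone_path r P l u \<omega> h \<longleftrightarrow>
     increments (h 0) = \<omega> \<and> h 0 0 = 0 \<and>
     (\<forall>t\<ge>0. \<forall>i. continuous (at_right t) (\<lambda>s. h s i)) \<and>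
     (\<forall>t>0. \<exists>g :: int \<Rightarrow> int.
        (\<forall>i. ((\<lambda>s. h s i) \<longlongrightarrow> g i) (at_left t)) \<and>
        (\<forall>i. h t i =
           (if l \<le> i \<and> i < u \<and>
               (\<exists>y. (t, y) \<in> P i \<and> 0 < y \<and> y < r (increments g i) + r (- increments g (i + 1)))
            then g i + 1 else g i)))"

definition monotone_process ::
  "'w measure \<Rightarrow> (int \<Rightarrow> real) \<Rightarrow> (int \<Rightarrow> 'w \<Rightarrow> (real \<times> real) set) \<Rightarrow> int \<Rightarrow> int \<Rightarrow>
   (int \<Rightarrow> int) \<Rightarrow> (real \<Rightarrow> int \<Rightarrow> 'w \<Rightarrow> int) \<Rightarrow> bool" where
  "monotone_process M r N l u \<omega> H \<longleftrightarrow>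
     (\<forall>t\<ge>0. \<forall>i. H t i \<in> measurable M (count_space UNIV)) \<and>
     (AE w in M. monotone_path r (\<lambda>i. N i w) l u \<omega> (\<lambda>t i. H t i w))"

section \<open>The limiting process\<close>

definition limiting_height ::
  "(int \<Rightarrow> int \<Rightarrow> real \<Rightarrow> int \<Rightarrow> 'w \<Rightarrow> int) \<Rightarrow> real \<Rightarrow> int \<Rightarrow> 'w \<Rightarrow> ereal" where
  "limiting_height H t i w =
     Lim (at_bot \<times>\<^sub>F at_top) (\<lambda>(l, u). ereal (real_of_int (H l u t i w)))"

text \<open>The limiting heights may be infinite. The function \<^const>\<open>e2ennreal\<close> truncates at \<open>0\<close>, so
  this is the difference of the integrals of the positive and the negative part. The latter is finite
  for the limiting heights, which are almost surely bounded below by their initial values.\<close>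

definition ereal_expectation :: "'w measure \<Rightarrow> ('w \<Rightarrow> ereal) \<Rightarrow> ereal" where
  "ereal_expectation M X =
     enn2ereal (\<integral>\<^sup>+ w. e2ennreal (X w) \<partial>M) - enn2ereal (\<integral>\<^sup>+ w. e2ennreal (- X w) \<partial>M)"

end

theory Submission
  imports Defs
begin

text \<open>
  Clamping \<open>r\<close> to \<open>[1 - m, m]\<close> keeps the identity \<open>r(z) r(1 - z) = 1\<close> and makes the rates bounded, so the
  product measures with weights \<open>exp (\<theta> z) / r(z)!\<close> are stationary for the finite system with
  reservoirs of parameter \<open>\<theta>\<close> at both ends. Start such a system, now with both reservoirs adding
  bricks at the large rate \<open>exp \<theta>\<close>, from a wedge: parameter \<open>\<theta>\<close> to the left and \<open>-\<theta>\<close> to the right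
  of the column \<open>c\<close>. In terms of increments it lies below the stationary system of parameter \<open>\<theta>\<close> and
  above the one of parameter \<open>-\<theta>\<close>, hence every column grows at mean rate at most \<open>2 exp \<theta>\<close>. If \<open>\<theta>\<close> is
  large, then with probability at least \<open>1/2\<close>, uniformly in the volume and in \<open>m\<close>, the wedge started
  at height \<open>K \<bar>c\<bar>\<close> dominates the given initial heights, which are at most \<open>K \<bar>j\<bar>\<close>. On this event
  attractiveness in the heights bounds the given process by the wedge process, which gives
  \<open>K \<bar>c\<bar> + 4 t exp \<theta>\<close> as a bound on the mean height.

  All comparisons are made for an Euler scheme of the Markov semigroup. The Poisson driven process is
  tied to it by cutting time into slabs so thin that, up to a probability of order \<open>1/n\<close>, no slab
  contains more than one relevant point.
\<close>

section \<open>Single-site measures\<close>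

no_notation Infinite_Sum.abs_summable_on (infixr "abs'_summable'_on" 46)

text \<open>No coupled process is ever constructed. An Euler step acts on real functions, and a
  coupling becomes the claim that \<open>f x \<le> g y\<close> for all ordered \<open>x\<close>,
  \<open>y\<close> survives one step, which is checked bond by bond. Two orders occur: that of
  increments, between the wedge and the stationary systems, where the rate of a bond has to be split
  into its increasing and its decreasing summand, and that of heights, between the given process and
  the wedge.

  The argument for one step needs its length times the total rate to be at most 1, so unbounded
  rates have to be clamped. The clamp is undone pathwise: heights only grow, so if no column has
  risen by more than \<open>m\<close> up to time \<open>T\<close>, all increments met on the way lie
  in a bounded window, and the clamp level is taken beyond it. Afterwards \<open>m\<close> tends to
  infinity by monotone convergence. This is legitimate because \<theta> is a function of the growth
  exponent \<beta> and the slope \<open>K\<close> alone: no constant in the bound sees the clamp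
  level, \<open>m\<close> or the volume.\<close>

locale bounded_rate =
  fixes \<rho> :: "int \<Rightarrow> real" and R :: real
  assumes pos: "0 < \<rho> z"
    and mono: "mono \<rho>"
    and reflect: "\<rho> z * \<rho> (1 - z) = 1"
    and le_R: "\<rho> z \<le> R"
begin

lemma R_pos: "0 < R"
  using pos[of 0] le_R[of 0] by linarith

lemma rho_mono: "x \<le> y \<Longrightarrow> \<rho> x \<le> \<rho> y"
  using mono by (simp add: mono_def)

text \<open>By \<open>reflect\<close> the generalized factorial of \<open>z\<close> depends on \<open>\<bar>z\<bar>\<close> only. The measure \<open>site \<theta>\<close> is
  unspecified if the weights are not summable.\<close>

definition weight :: "real \<Rightarrow> int \<Rightarrow> real" where
  "weight \<theta> z = exp (\<theta> * real_of_int z) / (\<Prod>k<nat \<bar>z\<bar>. \<rho> (int (Suc k)))"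

definition site :: "real \<Rightarrow> int pmf" where
  "site \<theta> = embed_pmf (\<lambda>z. weight \<theta> z / infsetsum (weight \<theta>) UNIV)"

lemma weight_pos: "0 < weight \<theta> z"
  by (simp add: weight_def prod_pos pos)

lemma weight_uminus: "weight (- \<theta>) z = weight \<theta> (- z)"
  by (simp add: weight_def)

text \<open>One-site detailed balance. The shift identities below rest on it and not on the value of
  the normalizing constant.\<close>

lemma weight_step: "weight \<theta> z * \<rho> z = exp \<theta> * weight \<theta> (z - 1)"
proof (cases "1 \<le> z")
  case True
  define n where "n = nat (z - 1)"
  have z: "z = int (Suc n)"
    using True by (simp add: n_def)
  show ?thesis
    using pos[of "int (Suc n)"] by (simp add: weight_def z nat_add_distrib exp_add[symmetric] algebra_simps)
next
  case False
  define n where "n = nat (- z)"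
  have z: "z = - int n" "1 - z = int (Suc n)"
    using False by (simp_all add: n_def)
  \<comment> \<open>For \<open>z \<le> 0\<close> the lower point \<open>z - 1\<close> has the longer
    factorial; its extra factor is \<open>\<rho> (1 - z)\<close>, the inverse of
    \<open>\<rho> z\<close>.\<close>
  have *: "nat \<bar>z - 1\<bar> = Suc n" "nat \<bar>z\<bar> = n"
    using z by auto
  have "\<rho> z * \<rho> (int (Suc n)) = 1"
    using reflect[of z] by (simp only: z(2))
  then have "\<rho> z = 1 / \<rho> (int (Suc n))"
    using pos[of "int (Suc n)"] by (metis less_irrefl nonzero_eq_divide_eq)
  then show ?thesis
    by (simp add: weight_def * exp_add[symmetric] algebra_simps)
qed

text \<open>Ratio test: beyond \<open>y\<close> the ratio of consecutive weights is at most
  \<open>exp \<theta> / \<rho> y < 1\<close>. The negative half line is the positive one for the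
  parameter \<open>- \<theta>\<close>, hence the absolute value in the assumption.\<close>

lemma weight_summable:
  assumes "exp \<bar>\<theta>\<bar> < \<rho> y"
  shows "weight \<theta> abs_summable_on UNIV"
proof -
  have nat: "summable (\<lambda>n. weight \<eta> (int n))" if "exp \<eta> < \<rho> y" for \<eta>
  proof (rule summable_ratio_test[where c = "exp \<eta> / \<rho> y" and N = "nat y"])
    show "exp \<eta> / \<rho> y < 1"
      using that pos[of y] by simp
    fix n assume "nat y \<le> n"
    then have "\<rho> y \<le> \<rho> (int (Suc n))"
      by (intro rho_mono) auto
    moreover have "weight \<eta> (int (Suc n)) = exp \<eta> / \<rho> (int (Suc n)) * weight \<eta> (int n)"
      using weight_step[of \<eta> "int (Suc n)"] pos[of "int (Suc n)"] by (simp add: field_simps)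
    moreover have "exp \<eta> / \<rho> (int (Suc n)) \<le> exp \<eta> / \<rho> y"
      using calculation pos[of y] by (intro divide_left_mono mult_pos_pos) (auto simp: pos)
    ultimately show "norm (weight \<eta> (int (Suc n))) \<le> exp \<eta> / \<rho> y * norm (weight \<eta> (int n))"
      using weight_pos[of \<eta> "int n"] weight_pos[of \<eta> "int (Suc n)"] mult_right_mono
      by (metis abs_of_pos less_imp_le real_norm_def)
  qed
  have "exp \<theta> < \<rho> y" "exp (- \<theta>) < \<rho> y"
    by (rule le_less_trans[OF _ assms], simp)+
  then have "(\<lambda>n. weight \<theta> (int n)) abs_summable_on UNIV"
    "(\<lambda>n. weight \<theta> (- int n)) abs_summable_on UNIV"
    using nat[of \<theta>] nat[of "- \<theta>"] weight_pos[THEN less_imp_le]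
    by (simp_all add: abs_summable_on_nat_iff' weight_uminus)
  then have "weight \<theta> abs_summable_on (range int \<union> range (\<lambda>n. - int n))"
    by (intro abs_summable_on_union abs_summable_on_reindex) auto
  moreover have "(range int \<union> range (\<lambda>n. - int n)) = UNIV"
    by (auto, metis int_cases2 rangeI)
  ultimately show ?thesis
    by simp
qed

context
  fixes \<theta> y
  assumes normalizable: "exp \<bar>\<theta>\<bar> < \<rho> y"
begin

lemma partition_pos: "0 < infsetsum (weight \<theta>) UNIV"
proof -
  have "0 < infsetsum (weight \<theta>) {0}"
    by (simp add: weight_pos)
  also have "\<dots> \<le> infsetsum (weight \<theta>) UNIV"
    using weight_summable[OF normalizable] weight_pos[THEN less_imp_le]
    by (intro infsetsum_mono_neutral_left) (auto simp: abs_summable_on_finite)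
  finally show ?thesis .
qed

lemma pmf_site: "pmf (site \<theta>) z = weight \<theta> z / infsetsum (weight \<theta>) UNIV"
  unfolding site_def
proof (rule pmf_embed_pmf)
  let ?Z = "infsetsum (weight \<theta>) UNIV"
  show "0 \<le> weight \<theta> x / ?Z" for x
    using weight_pos[of \<theta> x] partition_pos by simp
  then have "(\<integral>\<^sup>+ x. ennreal (weight \<theta> x / ?Z) \<partial>count_space UNIV) = ennreal (\<Sum>\<^sub>ax. weight \<theta> x / ?Z)"
    using weight_summable[OF normalizable] abs_summable_on_cmult_left[where c = "inverse ?Z" and f = "weight \<theta>" and A = UNIV]
    by (intro nn_integral_conv_infsetsum) (auto simp: divide_inverse mult.commute)
  also have "(\<Sum>\<^sub>ax. weight \<theta> x / ?Z) = 1"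
    using partition_pos infsetsum_cdiv[where f = "weight \<theta>" and A = UNIV and c = ?Z] weight_summable[OF normalizable] by simp
  finally show "(\<integral>\<^sup>+ x. ennreal (weight \<theta> x / ?Z) \<partial>count_space UNIV) = 1"
    by simp
qed

lemma pmf_site_step: "pmf (site \<theta>) z * \<rho> z = exp \<theta> * pmf (site \<theta>) (z - 1)"
  using weight_step[of \<theta> z] by (simp add: pmf_site field_simps)

lemma site_shift_down:
  fixes \<phi> :: "int \<Rightarrow> real"
  shows "measure_pmf.expectation (site \<theta>) (\<lambda>z. \<rho> z * \<phi> (z - 1)) = exp \<theta> * measure_pmf.expectation (site \<theta>) \<phi>"
proof -
  have "bij (\<lambda>z::int. z - 1)"
    by (rule bij_betw_byWitness[where f' = "\<lambda>z. z + 1"]) auto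
  from infsetsum_reindex_bij_betw[OF this, of "\<lambda>z. pmf (site \<theta>) z * (exp \<theta> * \<phi> z)"]
  have "measure_pmf.expectation (site \<theta>) (\<lambda>z. \<rho> z * \<phi> (z - 1)) = measure_pmf.expectation (site \<theta>) (\<lambda>z. exp \<theta> * \<phi> z)"
    unfolding pmf_expectation_eq_infsetsum
    by (simp add: mult.assoc[symmetric] pmf_site_step mult.commute[of _ "exp \<theta>"])
  then show ?thesis
    by simp
qed

text \<open>\<open>site_shift_down\<close> applied to \<open>\<rho> (- z) * \<phi> (z + 1)\<close>:
  the shift produces the product \<open>\<rho> z * \<rho> (1 - z) = 1\<close>.\<close>

lemma site_shift_up:
  fixes \<phi> :: "int \<Rightarrow> real"
  shows "measure_pmf.expectation (site \<theta>) (\<lambda>z. \<rho> (- z) * \<phi> (z + 1)) = exp (- \<theta>) * measure_pmf.expectation (site \<theta>) \<phi>"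
proof -
  have "exp \<theta> * measure_pmf.expectation (site \<theta>) (\<lambda>z. \<rho> (- z) * \<phi> (z + 1))
     = measure_pmf.expectation (site \<theta>) (\<lambda>z. \<rho> z * (\<rho> (- (z - 1)) * \<phi> (z - 1 + 1)))"
    using site_shift_down[of "\<lambda>z. \<rho> (- z) * \<phi> (z + 1)"] by simp
  also have "(\<lambda>z. \<rho> z * (\<rho> (- (z - 1)) * \<phi> (z - 1 + 1))) = \<phi>"
    using reflect by (simp add: mult.assoc[symmetric])
  finally show ?thesis
    by (simp add: exp_minus field_simps)
qed

end

lemma site_uminus:
  fixes \<phi> :: "int \<Rightarrow> real"
  assumes "exp \<bar>\<theta>\<bar> < \<rho> y"
  shows "measure_pmf.expectation (site (- \<theta>)) \<phi> = measure_pmf.expectation (site \<theta>) (\<lambda>z. \<phi> (- z))"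
proof -
  have Z: "infsetsum (weight (- \<theta>)) UNIV = infsetsum (weight \<theta>) UNIV"
    unfolding weight_uminus by (rule infsetsum_reindex_bij_betw[OF bij_uminus])
  have "pmf (site (- \<theta>)) z = pmf (site \<theta>) (- z)" for z
    using pmf_site[of "- \<theta>" y z] pmf_site[of \<theta> y "- z"] assms by (simp add: Z weight_uminus[of \<theta> z])
  then show ?thesis
    using infsetsum_reindex_bij_betw[OF bij_uminus, of "\<lambda>z. pmf (site \<theta>) z * \<phi> (-z)"]
    by (simp add: pmf_expectation_eq_infsetsum)
qed

text \<open>The density of \<open>site \<theta>'\<close> with respect to \<open>site \<theta>\<close> is an increasing exponential, so it crosses
  the value 1 once.\<close>

lemma site_mono:
  fixes \<phi> :: "int \<Rightarrow> real"
  assumes \<theta>: "exp \<bar>\<theta>\<bar> < \<rho> y" "exp \<bar>\<theta>'\<bar> < \<rho> y" and le: "\<theta> \<le> \<theta>'"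
    and \<phi>: "mono \<phi>" and bounded: "\<And>z. \<bar>\<phi> z\<bar> \<le> B"
  shows "measure_pmf.expectation (site \<theta>) \<phi> \<le> measure_pmf.expectation (site \<theta>') \<phi>"
proof (cases "\<theta> = \<theta>'")
  case False
  then have lt: "\<theta> < \<theta>'"
    using le by simp
  define q where "q z = pmf (site \<theta>') z - pmf (site \<theta>) z" for z
  define C where "C = ln (infsetsum (weight \<theta>) UNIV / infsetsum (weight \<theta>') UNIV)"
  have ratio: "pmf (site \<theta>') z = pmf (site \<theta>) z * exp ((\<theta>' - \<theta>) * z + C)" for z
  proof -
    have "weight \<theta>' z = weight \<theta> z * exp ((\<theta>' - \<theta>) * z)"
      by (simp add: weight_def exp_add[symmetric] algebra_simps)
    then show ?thesis
      using partition_pos[OF \<theta>(1)] partition_pos[OF \<theta>(2)]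
      by (simp add: pmf_site[OF \<theta>(1)] pmf_site[OF \<theta>(2)] C_def exp_add)
  qed
  define z0 where "z0 = \<lceil>- C / (\<theta>' - \<theta>)\<rceil>"
  have sign: "0 \<le> q z" if "z0 \<le> z" for z
  proof -
    have "- C / (\<theta>' - \<theta>) \<le> z"
      using that by (simp add: z0_def ceiling_le_iff)
    then have "0 \<le> (\<theta>' - \<theta>) * z + C"
      using lt by (simp add: field_simps)
    then have "1 \<le> exp ((\<theta>' - \<theta>) * z + C)"
      by simp
    then show ?thesis
      unfolding q_def ratio by (simp add: mult_left_le[of 1, simplified] mult_le_cancel_left1)
  qed
  have sign': "q z \<le> 0" if "z < z0" for z
  proof -
    have "z \<le> - C / (\<theta>' - \<theta>)"
      using that unfolding z0_def by linarith
    then have "(\<theta>' - \<theta>) * z + C \<le> 0"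
      using lt by (simp add: field_simps)
    then have "exp ((\<theta>' - \<theta>) * z + C) \<le> 1"
      by simp
    then show ?thesis
      unfolding q_def ratio by (simp add: mult_left_le)
  qed
  have summ: "(\<lambda>z. pmf p z * \<phi> z) abs_summable_on UNIV" "pmf p abs_summable_on UNIV" for p
  proof -
    show "pmf p abs_summable_on UNIV"
      by (rule pmf_abs_summable)
    then show "(\<lambda>z. pmf p z * \<phi> z) abs_summable_on UNIV"
    proof (rule abs_summable_on_comparison_test'[OF abs_summable_on_cmult_left[where c = B]])
      show "norm (pmf p z * \<phi> z) \<le> pmf p z * B" for z
        using bounded[of z] by (simp add: abs_mult mult_left_mono)
    qed
  qed
  \<comment> \<open>Both measures have mass 1, so the constant \<open>\<phi> z0\<close> can be
    subtracted for free; then \<open>q\<close> and \<open>\<phi> - \<phi> z0\<close> never have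
    opposite signs.\<close>
  have "0 = \<phi> z0 * (infsetsum (pmf (site \<theta>')) UNIV - infsetsum (pmf (site \<theta>)) UNIV)"
    by (simp add: infsetsum_pmf_eq_1)
  also have "\<dots> = (\<Sum>\<^sub>az. q z * \<phi> z0)"
    unfolding q_def infsetsum_diff[OF summ(2) summ(2), symmetric]
    using abs_summable_on_diff[OF summ(2) summ(2)] by (subst infsetsum_cmult_left) (simp_all add: mult.commute)
  also have "\<dots> \<le> (\<Sum>\<^sub>az. q z * \<phi> z)"
  proof (rule infsetsum_mono)
    show "(\<lambda>z. q z * \<phi> z0) abs_summable_on UNIV"
      unfolding q_def by (intro abs_summable_on_cmult_left abs_summable_on_diff summ)
    show "(\<lambda>z. q z * \<phi> z) abs_summable_on UNIV"
      unfolding q_def left_diff_distrib by (intro abs_summable_on_diff summ)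
    show "q z * \<phi> z0 \<le> q z * \<phi> z" for z
      using sign[of z] sign'[of z] monoD[OF \<phi>, of z0 z] monoD[OF \<phi>, of z z0]
      by (cases "z0 \<le> z") (auto intro: mult_left_mono mult_left_mono_neg)
  qed
  also have "\<dots> = measure_pmf.expectation (site \<theta>') \<phi> - measure_pmf.expectation (site \<theta>) \<phi>"
    using summ(1) by (simp add: q_def left_diff_distrib infsetsum_diff pmf_expectation_eq_infsetsum)
  finally show ?thesis
    by simp
qed simp

section \<open>Exponential moments of one site\<close>

lemma site_exp_integrable:
  assumes \<theta>: "exp \<bar>\<theta>\<bar> < \<rho> y" "exp \<bar>\<theta> + \<beta>\<bar> < \<rho> y"
  shows "integrable (site \<theta>) (\<lambda>z. exp (\<beta> * real_of_int z))"
proof -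
  have "(\<lambda>z. weight (\<theta> + \<beta>) z / infsetsum (weight \<theta>) UNIV) abs_summable_on UNIV"
    using abs_summable_on_cmult_left[where c = "inverse (infsetsum (weight \<theta>) UNIV)", OF weight_summable[OF \<theta>(2)]]
    by (simp add: divide_inverse)
  also have "(\<lambda>z. weight (\<theta> + \<beta>) z / infsetsum (weight \<theta>) UNIV) = (\<lambda>z. pmf (site \<theta>) z *\<^sub>R exp (\<beta> * real_of_int z))"
    by (simp add: pmf_site[OF \<theta>(1)] weight_def exp_add algebra_simps fun_eq_iff)
  finally show ?thesis
    unfolding measure_pmf_eq_density abs_summable_on_def
    by (subst integrable_density) auto
qed

text \<open>Let \<open>E\<close> be the exponential moment. A shift by one unit turns
  \<open>exp (\<theta> - \<beta>) * E\<close> into the mean of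
  \<open>\<rho> (- z) * exp (\<beta> * z)\<close>, and the growth condition bounds this by
  \<open>1 + E\<close>: for \<open>z < 0\<close> the exponentials cancel, for
  \<open>z \<ge> 0\<close> the rate is at most 1. The resulting inequality for \<open>E\<close>
  involves only \<beta> and \<theta>, so it is uniform in the clamp level.\<close>

lemma site_exp_moment:
  assumes \<theta>: "exp \<theta> < \<rho> y" and \<beta>: "0 < \<beta>" "\<beta> \<le> \<theta>"
    and growth: "\<And>z. 0 < z \<Longrightarrow> \<rho> z \<le> exp (\<beta> * real_of_int z)"
    and \<epsilon>: "exp (\<beta> - \<theta>) \<le> \<epsilon>"
  shows "(1 - \<epsilon>) * measure_pmf.expectation (site (- \<theta>)) (\<lambda>z. exp (\<beta> * real_of_int z)) \<le> \<epsilon>"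
proof -
  have \<theta>0: "exp \<bar>\<theta>\<bar> < \<rho> y" "exp \<bar>- \<theta>\<bar> < \<rho> y"
    using \<theta> \<beta> by auto
  have "exp \<bar>- \<theta> + \<beta>\<bar> < \<rho> y"
    by (rule le_less_trans[OF _ \<theta>]) (use \<beta> in simp)
  note int = site_exp_integrable[OF \<theta>0(2) this]
  let ?E = "measure_pmf.expectation (site (- \<theta>))"
  let ?e = "\<lambda>z. exp (\<beta> * real_of_int z)"
  have bound: "\<rho> (- z) * ?e z \<le> 1 + ?e z" for z
  proof (cases "z < 0")
    case True
    then have "\<rho> (- z) * ?e z \<le> exp (\<beta> * real_of_int (- z)) * ?e z"
      using growth[of "- z"] by (intro mult_right_mono) auto
    then show ?thesis
      by (simp add: exp_minus add_increasing2)
  next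
    case False
    \<comment> \<open>Otherwise \<open>\<rho> 0\<close> and \<open>\<rho> 1\<close> would both
      exceed 1, but their product is 1.\<close>
    have "\<rho> 0 \<le> 1"
      using less_1_mult[of "\<rho> 0" "\<rho> 1"] reflect[of 0] rho_mono[of 0 1] by force
    then have "\<rho> (- z) \<le> 1"
      using rho_mono[of "- z" 0] False by linarith
    then show ?thesis
      using mult_right_mono[of "\<rho> (- z)" 1 "?e z"] by (simp add: add_increasing)
  qed
  have int': "integrable (site (- \<theta>)) (\<lambda>z. \<rho> (- z) * ?e z)"
    using bound int pos[THEN less_imp_le]
    by (intro Bochner_Integration.integrable_bound[OF Bochner_Integration.integrable_add[OF measure_pmf.integrable_const int, of 1]])
       (auto intro!: AE_pmfI add_nonneg_nonneg simp: abs_mult abs_of_nonneg)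
  have "exp (- \<beta>) * exp \<theta> * ?E ?e = exp (- \<beta>) * ?E (\<lambda>z. \<rho> (- z) * ?e (z + 1))"
    using site_shift_up[OF \<theta>0(2), of ?e] by simp
  also have "\<dots> = ?E (\<lambda>z. \<rho> (- z) * ?e z)"
    by (subst Bochner_Integration.integral_mult_right_zero[symmetric]) (simp add: algebra_simps exp_add exp_minus)
  also have "\<dots> \<le> ?E (\<lambda>z. 1 + ?e z)"
    using int int' bound by (intro integral_mono) auto
  also have "\<dots> = 1 + ?E ?e"
    using int by simp
  finally have *: "exp (\<theta> - \<beta>) * ?E ?e \<le> 1 + ?E ?e"
    by (simp add: exp_add[symmetric])
  have nonneg: "0 \<le> ?E ?e"
    by (intro Bochner_Integration.integral_nonneg) auto
  have "?E ?e = exp (\<beta> - \<theta>) * (exp (\<theta> - \<beta>) * ?E ?e)"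
    by (simp add: mult.assoc[symmetric] exp_add[symmetric])
  also have "\<dots> \<le> exp (\<beta> - \<theta>) * (1 + ?E ?e)"
    using * by (intro mult_left_mono) auto
  also have "\<dots> \<le> \<epsilon> * (1 + ?E ?e)"
    using \<epsilon> nonneg by (intro mult_right_mono) auto
  finally show ?thesis
    by (simp add: algebra_simps)
qed

end

section \<open>Stationarity and comparison of increments\<close>

lemma expectation_bind_pmf:
  fixes f :: "'a \<Rightarrow> real"
  assumes "\<And>x. \<bar>f x\<bar> \<le> B"
  shows "measure_pmf.expectation (bind_pmf p q) f
    = measure_pmf.expectation p (\<lambda>x. measure_pmf.expectation (q x) f)"
  unfolding measure_pmf_bind using assms
  by (intro integral_bind[where K = "count_space UNIV" and B = B and B' = 1])
     (auto simp: measure_pmf.finite_measure_axioms space_subprob_algebra subprob_space_measure_pmf)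

lemma expectation_Pi_pmf_insert:
  fixes F :: "('a \<Rightarrow> 'b) \<Rightarrow> real"
  assumes "finite A" "i \<notin> A" and bounded: "\<And>g. \<bar>F g\<bar> \<le> B"
  shows "measure_pmf.expectation (Pi_pmf (insert i A) dflt p) F
    = measure_pmf.expectation (Pi_pmf A dflt p) (\<lambda>g. measure_pmf.expectation (p i) (\<lambda>y. F (g(i := y))))"
proof -
  have "Pi_pmf (insert i A) dflt p
    = do {g \<leftarrow> Pi_pmf A dflt p; y \<leftarrow> p i; return_pmf (g(i := y))}"
    unfolding Pi_pmf_insert'[OF assms(1,2)] by (rule bind_commute_pmf)
  then show ?thesis
    using bounded by (simp add: expectation_bind_pmf[where B = B] map_pmf_def[symmetric])
qed

lemma integrable_pmf_bounded:
  fixes f :: "'a \<Rightarrow> real"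
  assumes "\<And>x. \<bar>f x\<bar> \<le> B"
  shows "integrable (measure_pmf p) f"
  using assms by (intro measure_pmf.integrable_const_bound[where B = B]) auto

lemma expectation_pmf_bounded:
  fixes f :: "'a \<Rightarrow> real"
  assumes "\<And>x. \<bar>f x\<bar> \<le> B"
  shows "\<bar>measure_pmf.expectation p f\<bar> \<le> B"
proof -
  have "\<bar>measure_pmf.expectation p f\<bar> \<le> measure_pmf.expectation p (\<lambda>x. \<bar>f x\<bar>)"
    by (rule integral_abs_bound)
  also have "\<dots> \<le> B"
    using assms by (intro measure_pmf.integral_le_const AE_pmfI integrable_pmf_bounded[where B = B]) auto
  finally show ?thesis .
qed

text \<open>The marginals are exchanged one at a time: integrating out one site leaves a function of
  the others that is again increasing and has the same bound, so the induction hypothesis applies to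
  it.\<close>

lemma expectation_Pi_pmf_mono:
  fixes p q :: "'a \<Rightarrow> 'b::order pmf" and F :: "('a \<Rightarrow> 'b) \<Rightarrow> real"
  assumes "finite A"
    and site: "\<And>i \<phi>. mono \<phi> \<Longrightarrow> (\<And>z. \<bar>\<phi> z\<bar> \<le> B) \<Longrightarrow>
        measure_pmf.expectation (p i) \<phi> \<le> measure_pmf.expectation (q i) (\<phi> :: 'b \<Rightarrow> real)"
    and F: "mono F" "\<And>g. \<bar>F g\<bar> \<le> B"
  shows "measure_pmf.expectation (Pi_pmf A dflt p) F \<le> measure_pmf.expectation (Pi_pmf A dflt q) F"
  using assms(1) F
proof (induction A arbitrary: F rule: finite_induct)
  case (insert i A)
  let ?G = "\<lambda>r g. measure_pmf.expectation (r i) (\<lambda>y. F (g(i := y)))"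
  have G: "\<bar>?G r g\<bar> \<le> B" for r g
    by (rule expectation_pmf_bounded) (rule insert.prems)
  have mono_G: "mono (?G r)" for r
    using insert.prems
    by (intro monoI integral_mono integrable_pmf_bounded[where B = B])
       (auto intro!: monoD[OF insert.prems(1)] simp: le_fun_def)
  have "measure_pmf.expectation (Pi_pmf (insert i A) dflt p) F = measure_pmf.expectation (Pi_pmf A dflt p) (?G p)"
    by (rule expectation_Pi_pmf_insert) (use insert in auto)
  also have "\<dots> \<le> measure_pmf.expectation (Pi_pmf A dflt p) (?G q)"
    using insert.prems
    by (intro integral_mono integrable_pmf_bounded[where B = B] G site)
       (auto intro!: monoI monoD[OF insert.prems(1)] simp: le_fun_def)
  also have "\<dots> \<le> measure_pmf.expectation (Pi_pmf A dflt q) (?G q)"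
    by (intro insert.IH mono_G G)
  also have "\<dots> = measure_pmf.expectation (Pi_pmf (insert i A) dflt q) F"
    by (rule expectation_Pi_pmf_insert[symmetric]) (use insert in auto)
  finally show ?case .
qed simp

section \<open>Order-preserving Euler steps\<close>

definition euler_step ::
  "real \<Rightarrow> 'i set \<Rightarrow> ('i \<Rightarrow> 'x \<Rightarrow> real) \<Rightarrow> ('i \<Rightarrow> 'x \<Rightarrow> 'x) \<Rightarrow> ('x \<Rightarrow> real) \<Rightarrow> 'x \<Rightarrow> real" where
  "euler_step d J c up f x = f x + d * (\<Sum>i\<in>J. c i x * (f (up i x) - f x))"

text \<open>Uniformization. Every bond receives the same total rate \<open>C\<close>, filled up by
  idle moves; the mass \<open>1 - d * C * card J\<close> of no move at all is nonnegative for small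
  \<open>d\<close>, and what remains is one inequality per bond. State spaces, moves and rates may
  differ, which is how two systems are coupled.\<close>

lemma euler_step_coupling:
  fixes f :: "'x \<Rightarrow> real" and g :: "'y \<Rightarrow> real" and d C :: real and c :: "'i \<Rightarrow> 'x \<Rightarrow> real"
  assumes "0 \<le> d" "d * (C * card J) \<le> 1" and le: "f x \<le> g y"
    and loc: "\<And>i. i \<in> J \<Longrightarrow> c i x * (f (up i x) - f x) + C * f x \<le> c' i y * (g (up' i y) - g y) + C * g y"
  shows "euler_step d J c up f x \<le> euler_step d J c' up' g y"
proof -
  have split: "euler_step d J c up f x
      = (1 - d * (C * card J)) * f x + d * (\<Sum>i\<in>J. c i x * (f (up i x) - f x) + C * f x)"
    for c :: "'i \<Rightarrow> 'z \<Rightarrow> real" and up f x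
    unfolding euler_step_def sum.distrib sum_constant by (simp add: distrib_left left_diff_distrib)
  show ?thesis
    unfolding split using assms(1,2)
    by (intro add_mono[OF mult_left_mono[OF le] mult_left_mono[OF sum_mono[OF loc]]]) auto
qed

lemma euler_step_mono:
  fixes f g :: "'x \<Rightarrow> real" and d C :: real and c :: "'i \<Rightarrow> 'x \<Rightarrow> real"
  assumes "0 \<le> d" "d * (C * card J) \<le> 1" and c: "\<And>i x. i \<in> J \<Longrightarrow> 0 \<le> c i x \<and> c i x \<le> C"
    and le: "\<And>x. f x \<le> g x"
  shows "euler_step d J c up f x \<le> euler_step d J c up g x"
proof (rule euler_step_coupling[of d C J f x g x, OF assms(1,2) le])
  fix i assume "i \<in> J"
  then have "c i x * f (up i x) + (C - c i x) * f x \<le> c i x * g (up i x) + (C - c i x) * g x"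
    using c le by (intro add_mono mult_left_mono) auto
  then show "c i x * (f (up i x) - f x) + C * f x \<le> c i x * (g (up i x) - g x) + C * g x"
    by (simp add: algebra_simps)
qed

lemma euler_iterate_bounded:
  fixes f :: "'x \<Rightarrow> real" and d C :: real and c :: "'i \<Rightarrow> 'x \<Rightarrow> real"
  assumes "0 \<le> d" "d * (C * card J) \<le> 1" and c: "\<And>i x. i \<in> J \<Longrightarrow> 0 \<le> c i x \<and> c i x \<le> C"
    and B: "\<And>x. \<bar>f x\<bar> \<le> B"
  shows "\<bar>(euler_step d J c up ^^ n) f x\<bar> \<le> B"
proof (induction n arbitrary: x)
  case (Suc n)
  note mono = euler_step_mono[OF assms(1-3)]
  let ?g = "(euler_step d J c up ^^ n) f"
  have g: "- B \<le> ?g x" "?g x \<le> B" for x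
    using Suc.IH[of x] by auto
  have "euler_step d J c up (\<lambda>_. - B) x \<le> euler_step d J c up ?g x"
    "euler_step d J c up ?g x \<le> euler_step d J c up (\<lambda>_. B) x"
    by (rule mono; use g in simp)+
  moreover have "euler_step d J c up (\<lambda>_. K) x = K" for K
    by (simp add: euler_step_def)
  ultimately show ?case
    by auto
qed (use B in simp)

definition brick :: "int \<Rightarrow> (int \<Rightarrow> int) \<Rightarrow> int \<Rightarrow> int" where
  "brick i x = x(i := x i - 1, i + 1 := x (i + 1) + 1)"

lemma brick_alt: "brick i x = (x(i + 1 := x (i + 1) + 1))(i := x i - 1)"
  by (auto simp: brick_def)

text \<open>Basic coupling of one bond with rates \<open>\<alpha>\<close> and
  \<open>\<beta>\<close>: both systems jump together at the smaller rate, the faster one alone at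
  the excess rate, and neither for the rest of \<open>R\<close>. Hence the crossed inequalities are
  asked for only when a lone jump can happen.\<close>

lemma coupled_move:
  fixes \<alpha> \<beta> R x x' y y' :: real
  assumes "0 \<le> \<alpha>" "0 \<le> \<beta>" "\<alpha> \<le> R" "\<beta> \<le> R" "x \<le> y" "x' \<le> y'"
    and "\<alpha> < \<beta> \<Longrightarrow> x \<le> y'" and "\<beta> < \<alpha> \<Longrightarrow> x' \<le> y"
  shows "\<alpha> * (x' - x) + R * x \<le> \<beta> * (y' - y) + R * y"
proof (cases \<alpha> \<beta> rule: linorder_cases)
  case less
  then have "\<alpha> * x' + (\<beta> - \<alpha>) * x + (R - \<beta>) * x \<le> \<alpha> * y' + (\<beta> - \<alpha>) * y' + (R - \<beta>) * y"
    using assms by (intro add_mono mult_left_mono) auto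
  then show ?thesis by (simp add: algebra_simps)
next
  case equal
  then have "\<alpha> * x' + (R - \<beta>) * x \<le> \<alpha> * y' + (R - \<beta>) * y"
    using assms by (intro add_mono mult_left_mono) auto
  with equal show ?thesis by (simp add: algebra_simps)
next
  case greater
  then have "\<beta> * x' + (\<alpha> - \<beta>) * x' + (R - \<alpha>) * x \<le> \<beta> * y' + (\<alpha> - \<beta>) * y + (R - \<alpha>) * y"
    using assms by (intro add_mono mult_left_mono) auto
  then show ?thesis by (simp add: algebra_simps)
qed

section \<open>Increments in a finite box with reservoirs\<close>

locale brick_chain = bounded_rate +
  fixes l u :: int and d :: real
  assumes l_le_u: "l \<le> u"
    and d_nonneg: "0 \<le> d"
    and d_small: "d * (2 * R * card {l - 1..u}) \<le> 1"
begin

text \<open>The two summands of the rate of a bond; outside of \<open>{l..u}\<close> a reservoir of constant rate takes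
  the place of the site.\<close>

definition fwd :: "real \<Rightarrow> int \<Rightarrow> (int \<Rightarrow> int) \<Rightarrow> real" where
  "fwd a i \<eta> = (if i \<in> {l..u} then \<rho> (\<eta> i) else a)"

definition bwd :: "real \<Rightarrow> int \<Rightarrow> (int \<Rightarrow> int) \<Rightarrow> real" where
  "bwd b i \<eta> = (if i \<in> {l..u} then \<rho> (- \<eta> i) else b)"

definition config_step :: "real \<Rightarrow> real \<Rightarrow> ((int \<Rightarrow> int) \<Rightarrow> real) \<Rightarrow> (int \<Rightarrow> int) \<Rightarrow> real" where
  "config_step a b = euler_step d {l - 1..u} (\<lambda>i \<eta>. fwd a i \<eta> + bwd b (i + 1) \<eta>) brick"

lemma exp_le_R:
  assumes "exp \<bar>\<theta>\<bar> < \<rho> y"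
  shows "exp \<theta> \<le> R" "exp (- \<theta>) \<le> R"
proof -
  have "exp \<bar>\<theta>\<bar> \<le> R"
    using assms le_R[of y] by simp
  then show "exp \<theta> \<le> R" "exp (- \<theta>) \<le> R"
    by (rule order.trans[rotated], simp)+
qed

lemma config_rates:
  assumes "0 \<le> a" "a \<le> R" "0 \<le> b" "b \<le> R"
  shows "0 \<le> fwd a i \<eta>" "fwd a i \<eta> \<le> R" "0 \<le> bwd b i \<eta>" "bwd b i \<eta> \<le> R"
  using assms by (auto simp: fwd_def bwd_def le_R pos less_imp_le)

text \<open>The boundary bonds also alter the coordinates \<open>l - 1\<close> and
  \<open>u + 1\<close>, which no rate reads; they are left out of the order.\<close>

definition le_sites :: "(int \<Rightarrow> int) \<Rightarrow> (int \<Rightarrow> int) \<Rightarrow> bool" where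
  "le_sites x y \<longleftrightarrow> (\<forall>j\<in>{l..u}. x j \<le> y j)"

text \<open>The two summands of a rate are coupled separately, each with allowance \<open>R\<close>:
  \<open>fwd\<close> increases and \<open>bwd\<close> decreases with the increments, while their sum
  is not monotone. A lone jump at a site of the box needs a strictly ordered increment so as not to
  overshoot; it has one because different rates there force different integers.\<close>

lemma config_step_coupling:
  assumes a: "0 \<le> a" "a \<le> a'" "a' \<le> R" and b: "0 \<le> b'" "b' \<le> b" "b \<le> R"
    and fg: "\<And>x y. le_sites x y \<Longrightarrow> f x \<le> g y" and xy: "le_sites x y"
  shows "config_step a b f x \<le> config_step a' b' g y"
  unfolding config_step_def
proof (rule euler_step_coupling[where C = "2 * R"])
  fix i assume i: "i \<in> {l - 1..u}"
  have "brick i x j \<le> brick i y j" if "x j \<le> y j" for j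
    using that by (auto simp: brick_def)
  then have brick: "le_sites (brick i x) (brick i y)"
    using xy by (simp add: le_sites_def)
  have "fwd a i x * (f (brick i x) - f x) + R * f x \<le> fwd a' i y * (g (brick i y) - g y) + R * g y"
  proof (rule coupled_move)
    have le: "fwd a i x \<le> fwd a' i y"
      using a xy by (auto simp: fwd_def le_sites_def intro!: rho_mono)
    show "f (brick i x) \<le> g (brick i y)"
      by (rule fg[OF brick])
    show "f x \<le> g (brick i y)" if "fwd a i x < fwd a' i y"
    proof (rule fg)
      have "i \<in> {l..u} \<Longrightarrow> x i < y i"
        using xy that by (cases "x i = y i") (auto simp: le_sites_def fwd_def order_less_le)
      then have "x j \<le> brick i y j" if "j \<in> {l..u}" "x j \<le> y j" for j
        using that by (fastforce simp: brick_def)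
      then show "le_sites x (brick i y)"
        using xy by (auto simp: le_sites_def)
    qed
    show "f (brick i x) \<le> g y" if "fwd a' i y < fwd a i x"
      using le that by simp
  qed (use a b xy fg config_rates in auto)
  moreover have "bwd b (i+1) x * (f (brick i x) - f x) + R * f x \<le> bwd b' (i+1) y * (g (brick i y) - g y) + R * g y"
  proof (rule coupled_move)
    have le: "bwd b' (i+1) y \<le> bwd b (i+1) x"
      using b xy by (auto simp: bwd_def le_sites_def intro!: rho_mono)
    show "f (brick i x) \<le> g (brick i y)"
      by (rule fg[OF brick])
    show "f (brick i x) \<le> g y" if "bwd b' (i+1) y < bwd b (i+1) x"
    proof (rule fg)
      have "i + 1 \<in> {l..u} \<Longrightarrow> x (i+1) < y (i+1)"
        using xy that by (auto simp: le_sites_def bwd_def order_less_le)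
      then have "brick i x j \<le> y j" if "j \<in> {l..u}" "x j \<le> y j" for j
        using that by (fastforce simp: brick_def)
      then show "le_sites (brick i x) y"
        using xy by (auto simp: le_sites_def)
    qed
    show "f x \<le> g (brick i y)" if "bwd b (i+1) x < bwd b' (i+1) y"
      using le that by simp
  qed (use a b xy fg config_rates in auto)
  ultimately show "(fwd a i x + bwd b (i+1) x) * (f (brick i x) - f x) + 2 * R * f x
      \<le> (fwd a' i y + bwd b' (i+1) y) * (g (brick i y) - g y) + 2 * R * g y"
    by (simp add: algebra_simps)
qed (use d_nonneg d_small xy fg in auto)

lemma config_iterate_coupling:
  assumes a: "0 \<le> a" "a \<le> a'" "a' \<le> R" and b: "0 \<le> b'" "b' \<le> b" "b \<le> R"
    and f: "\<And>x y. le_sites x y \<Longrightarrow> f x \<le> f y" and xy: "le_sites x y"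
  shows "(config_step a b ^^ n) f x \<le> (config_step a' b' ^^ n) f y"
  using xy
proof (induction n arbitrary: x y)
  case (Suc n)
  then show ?case
    by (simp add: config_step_coupling[OF a b])
qed (use f in simp)

lemma config_iterate_bounded:
  assumes "0 \<le> a" "a \<le> R" "0 \<le> b" "b \<le> R" and "\<And>x. \<bar>f x\<bar> \<le> B"
  shows "\<bar>(config_step a b ^^ n) f x\<bar> \<le> B"
  unfolding config_step_def
proof (rule euler_iterate_bounded[where C = "2 * R"])
  show "0 \<le> fwd a i x + bwd b (i + 1) x \<and> fwd a i x + bwd b (i + 1) x \<le> 2 * R" for i x
    using config_rates[OF assms(1-4), of i x] config_rates[OF assms(1-4), of "i+1" x] by linarith
qed (use assms d_nonneg d_small in auto)

definition product :: "(int \<Rightarrow> real) \<Rightarrow> (int \<Rightarrow> int) pmf" where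
  "product \<theta> = Pi_pmf {l..u} 0 (\<lambda>j. site (\<theta> j))"

lemma product_shift:
  fixes F :: "(int \<Rightarrow> int) \<Rightarrow> real"
  assumes i: "i \<in> {l..u}" and \<theta>: "exp \<bar>\<theta> i\<bar> < \<rho> y" and F: "\<And>\<eta>. \<bar>F \<eta>\<bar> \<le> B"
  shows "measure_pmf.expectation (product \<theta>) (\<lambda>\<eta>. \<rho> (\<eta> i) * F (\<eta>(i := \<eta> i - 1)))
      = exp (\<theta> i) * measure_pmf.expectation (product \<theta>) F"
    and "measure_pmf.expectation (product \<theta>) (\<lambda>\<eta>. \<rho> (- \<eta> i) * F (\<eta>(i := \<eta> i + 1)))
      = exp (- \<theta> i) * measure_pmf.expectation (product \<theta>) F"
proof -
  have ins: "{l..u} = insert i ({l..u} - {i})"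
    using i by auto
  have bd: "\<bar>\<rho> z * F w\<bar> \<le> R * B" for z w
    using F[of w] le_R[of z] pos[of z] by (auto simp: abs_mult intro!: mult_mono)
  note eq = expectation_Pi_pmf_insert[of "{l..u} - {i}" i, folded ins]
  show "measure_pmf.expectation (product \<theta>) (\<lambda>\<eta>. \<rho> (\<eta> i) * F (\<eta>(i := \<eta> i - 1)))
      = exp (\<theta> i) * measure_pmf.expectation (product \<theta>) F"
    unfolding product_def
    using site_shift_down[OF \<theta>, of "\<lambda>y. F (_(i := y))"] by (subst (1 2) eq) (use F bd in simp_all)
  show "measure_pmf.expectation (product \<theta>) (\<lambda>\<eta>. \<rho> (- \<eta> i) * F (\<eta>(i := \<eta> i + 1)))
      = exp (- \<theta> i) * measure_pmf.expectation (product \<theta>) F"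
    unfolding product_def
    using site_shift_up[OF \<theta>, of "\<lambda>y. F (_(i := y))"] by (subst (1 2) eq) (use F bd in simp_all)
qed

lemma product_mono:
  fixes F :: "(int \<Rightarrow> int) \<Rightarrow> real"
  assumes "\<And>j. exp \<bar>\<theta> j\<bar> < \<rho> y" "\<And>j. exp \<bar>\<theta>' j\<bar> < \<rho> y" "\<And>j. \<theta> j \<le> \<theta>' j"
    and F: "\<And>x y. le_sites x y \<Longrightarrow> F x \<le> F y" "\<And>\<eta>. \<bar>F \<eta>\<bar> \<le> B"
  shows "measure_pmf.expectation (product \<theta>) F \<le> measure_pmf.expectation (product \<theta>') F"
  unfolding product_def
proof (rule expectation_Pi_pmf_mono[where B = B])
  show "mono F"
    by (rule monoI, rule F(1)) (auto simp: le_sites_def le_fun_def)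
qed (use site_mono[OF assms(1-3)] F(2) in auto)

text \<open>With reservoirs of the same parameter the gain terms of all bonds telescope against the loss
  terms.\<close>

lemma product_stationary_step:
  fixes f :: "(int \<Rightarrow> int) \<Rightarrow> real"
  assumes \<theta>: "exp \<bar>\<theta>\<bar> < \<rho> y" and B: "\<And>\<eta>. \<bar>f \<eta>\<bar> \<le> B"
    and sites: "\<And>x y. (\<And>j. j \<in> {l..u} \<Longrightarrow> x j = y j) \<Longrightarrow> f x = f y"
  shows "measure_pmf.expectation (product (\<lambda>_. \<theta>)) (config_step (exp \<theta>) (exp (- \<theta>)) f)
      = measure_pmf.expectation (product (\<lambda>_. \<theta>)) f"
proof -
  let ?E = "measure_pmf.expectation (product (\<lambda>_. \<theta>))"
  let ?F = "fwd (exp \<theta>)" and ?G = "bwd (exp (- \<theta>))"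
  have "exp \<theta> \<le> R" "exp (- \<theta>) \<le> R"
    using exp_le_R[OF \<theta>] by auto
  then have rates: "\<bar>?F i x\<bar> \<le> R" "\<bar>?G i x\<bar> \<le> R" for i x
    using config_rates[of "exp \<theta>" "exp (- \<theta>)"] by (simp_all add: abs_of_nonneg)
  have int: "integrable (product (\<lambda>_. \<theta>)) (\<lambda>\<eta>. ?F i \<eta> * f (h \<eta>))"
    "integrable (product (\<lambda>_. \<theta>)) (\<lambda>\<eta>. ?G i \<eta> * f (h \<eta>))" for i h
    using mult_mono[OF rates(1) B _ abs_ge_zero] mult_mono[OF rates(2) B _ abs_ge_zero] R_pos
    by (auto intro!: integrable_pmf_bounded[where B = "R * B"] simp: abs_mult)
  \<comment> \<open>Outside the box the reservoir rate \<open>exp \<theta>\<close> is constant and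
    \<open>F\<close> does not see the coordinate, so the identity for a site persists.\<close>
  have down: "?E (\<lambda>\<eta>. ?F i \<eta> * F (\<eta>(i := \<eta> i - 1))) = exp \<theta> * ?E F"
    if "\<And>\<eta>. \<bar>F \<eta>\<bar> \<le> B" "\<And>x y. (\<And>j. j \<in> {l..u} \<Longrightarrow> x j = y j) \<Longrightarrow> F x = F y" for F i
  proof (cases "i \<in> {l..u}")
    case True
    then show ?thesis
      using product_shift(1)[of i "\<lambda>_. \<theta>", OF True \<theta>, of F B] that(1) by (simp add: fwd_def)
  next
    case False
    then have "F (\<eta>(i := \<eta> i - 1)) = F \<eta>" for \<eta>
      by (intro that(2)) auto
    moreover have "fwd a i \<eta> = a" for a \<eta>
      using False by (auto simp: fwd_def)
    ultimately show ?thesis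
      by simp
  qed
  have up: "?E (\<lambda>\<eta>. ?G i \<eta> * F (\<eta>(i := \<eta> i + 1))) = exp (- \<theta>) * ?E F"
    if "\<And>\<eta>. \<bar>F \<eta>\<bar> \<le> B" "\<And>x y. (\<And>j. j \<in> {l..u} \<Longrightarrow> x j = y j) \<Longrightarrow> F x = F y" for F i
  proof (cases "i \<in> {l..u}")
    case True
    then show ?thesis
      using product_shift(2)[of i "\<lambda>_. \<theta>", OF True \<theta>, of F B] that(1) by (simp add: bwd_def)
  next
    case False
    then have "F (\<eta>(i := \<eta> i + 1)) = F \<eta>" for \<eta>
      by (intro that(2)) auto
    moreover have "bwd a i \<eta> = a" for a \<eta>
      using False by (auto simp: bwd_def)
    ultimately show ?thesis
      by simp
  qed
  \<comment> \<open>Both sides equal \<open>exp \<theta>\<close> times the mean of \<open>f\<close>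
    with one unit added at \<open>i + 1\<close>: the left one by a shift at \<open>i\<close>, the
    right one by a shift at \<open>i + 1\<close>. So the forward gain of bond \<open>i\<close> is
    the forward loss of bond \<open>i + 1\<close>.\<close>
  have gain1: "?E (\<lambda>\<eta>. ?F i \<eta> * f (brick i \<eta>)) = ?E (\<lambda>\<eta>. ?F (i + 1) \<eta> * f \<eta>)" for i
  proof -
    let ?h = "\<lambda>\<eta>. f (\<eta>(i + 1 := \<eta> (i + 1) + 1))"
    have h: "?h x = ?h y" if "\<And>j. j \<in> {l..u} \<Longrightarrow> x j = y j" for x y
      by (rule sites) (use that in auto)
    have "?E (\<lambda>\<eta>. ?F i \<eta> * f (brick i \<eta>)) = exp \<theta> * ?E ?h"
      using down[of ?h i, OF B h] by (simp add: brick_def)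
    also have "\<dots> = ?E (\<lambda>\<eta>. ?F (i + 1) \<eta> * f \<eta>)"
      using down[of ?h "i + 1", OF B h] by simp
    finally show ?thesis .
  qed
  have gain2: "?E (\<lambda>\<eta>. ?G (i + 1) \<eta> * f (brick i \<eta>)) = ?E (\<lambda>\<eta>. ?G i \<eta> * f \<eta>)" for i
  proof -
    let ?h = "\<lambda>\<eta>. f (\<eta>(i := \<eta> i - 1))"
    have h: "?h x = ?h y" if "\<And>j. j \<in> {l..u} \<Longrightarrow> x j = y j" for x y
      by (rule sites) (use that in auto)
    have "?E (\<lambda>\<eta>. ?G (i + 1) \<eta> * f (brick i \<eta>)) = exp (- \<theta>) * ?E ?h"
      using up[of ?h "i + 1", OF B h] by (simp add: brick_alt)
    also have "\<dots> = ?E (\<lambda>\<eta>. ?G i \<eta> * f \<eta>)"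
      using up[of ?h i, OF B h] by simp
    finally show ?thesis .
  qed
  let ?t = "\<lambda>i. ?E (\<lambda>\<eta>. ?F i \<eta> * f \<eta>) - ?E (\<lambda>\<eta>. ?G i \<eta> * f \<eta>)"
  have "?E (config_step (exp \<theta>) (exp (- \<theta>)) f) - ?E f
      = d * (\<Sum>i\<in>{l - 1..u}. ?E (\<lambda>\<eta>. (?F i \<eta> + ?G (i + 1) \<eta>) * (f (brick i \<eta>) - f \<eta>)))"
  proof -
    have "integrable (product (\<lambda>_. \<theta>)) (\<lambda>\<eta>. (?F i \<eta> + ?G (i + 1) \<eta>) * (f (brick i \<eta>) - f \<eta>))" for i
      using int[of i "brick i"] int[of i "\<lambda>x. x"] int[of "i+1" "brick i"] int[of "i+1" "\<lambda>x. x"]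
      by (simp add: algebra_simps)
    then show ?thesis
      using integrable_pmf_bounded[of f B, OF B] by (simp add: config_step_def euler_step_def[abs_def])
  qed
  also have "(\<Sum>i\<in>{l - 1..u}. ?E (\<lambda>\<eta>. (?F i \<eta> + ?G (i + 1) \<eta>) * (f (brick i \<eta>) - f \<eta>)))
      = (\<Sum>i\<in>{l - 1..u}. ?t (i + 1) - ?t i)"
  proof (rule sum.cong[OF refl])
    fix i
    show "?E (\<lambda>\<eta>. (?F i \<eta> + ?G (i + 1) \<eta>) * (f (brick i \<eta>) - f \<eta>)) = ?t (i + 1) - ?t i"
      using int[of i "brick i"] int[of i "\<lambda>x. x"] int[of "i+1" "brick i"] int[of "i+1" "\<lambda>x. x"]
      by (simp add: ring_distribs gain1 gain2)
  qed
  also have "\<dots> = ?t (u + 1) - ?t (l - 1)"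
  proof -
    have "(\<Sum>i\<in>{l - 1..v}. h (i + 1) - h i) = h (v + 1) - h (l - 1)" if "l - 1 \<le> v" for h :: "int \<Rightarrow> real" and v
      using that
    proof (induction rule: int_ge_induct)
      case (step v)
      then have "{l - 1..v + 1} = insert (v + 1) {l - 1..v}" by auto
      with step show ?case by simp
    qed simp
    from this[of u ?t] show ?thesis
      using l_le_u by simp
  qed
  \<comment> \<open>\<open>u + 1\<close> and \<open>l - 1\<close> are both reservoirs with the same
    two constant rates, so the end terms agree.\<close>
  also have "\<dots> = 0"
    by (simp add: fwd_def bwd_def)
  finally show ?thesis
    by simp
qed

lemma product_stationary:
  fixes f :: "(int \<Rightarrow> int) \<Rightarrow> real"
  assumes \<theta>: "exp \<bar>\<theta>\<bar> < \<rho> y" and B: "\<And>\<eta>. \<bar>f \<eta>\<bar> \<le> B"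
    and f: "\<And>x y. le_sites x y \<Longrightarrow> f x \<le> f y"
  shows "measure_pmf.expectation (product (\<lambda>_. \<theta>)) ((config_step (exp \<theta>) (exp (- \<theta>)) ^^ n) f)
      = measure_pmf.expectation (product (\<lambda>_. \<theta>)) f"
proof (induction n)
  case (Suc n)
  have R: "exp \<theta> \<le> R" "exp (- \<theta>) \<le> R"
    using exp_le_R[OF \<theta>] by auto
  let ?g = "(config_step (exp \<theta>) (exp (- \<theta>)) ^^ n) f"
  have "measure_pmf.expectation (product (\<lambda>_. \<theta>)) (config_step (exp \<theta>) (exp (- \<theta>)) ?g)
      = measure_pmf.expectation (product (\<lambda>_. \<theta>)) ?g"
  proof (rule product_stationary_step[OF \<theta>])
    show "\<bar>?g x\<bar> \<le> B" for x
      by (rule config_iterate_bounded) (simp_all add: R B)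
    have le: "?g x \<le> ?g y" if "le_sites x y" for x y
      by (rule config_iterate_coupling) (simp_all add: R f that)
    \<comment> \<open>Monotonicity in \<open>le_sites\<close>, used in both directions, already says
      that only the sites of the box matter.\<close>
    show "?g x = ?g y" if "\<And>j. j \<in> {l..u} \<Longrightarrow> x j = y j" for x y
      by (rule antisym; rule le) (simp_all add: le_sites_def that)
  qed
  then show ?case
    using Suc by simp
qed simp

text \<open>Lowering the rate of the right reservoir to \<open>exp (- \<theta>)\<close> and raising
  the initial parameters to \<theta> both push increasing functions up, and the upper system is
  stationary with mean rate \<open>exp \<theta>\<close>. The second claim is the mirror image, with
  \<open>- \<theta>\<close> and the left reservoir; its function is negated to be
  increasing.\<close>

lemma wedge_rate_bound:
  fixes c :: int
  assumes \<theta>: "exp \<theta> < \<rho> y" "0 \<le> \<theta>" and i: "i \<in> {l..u}"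
  defines "\<nu> \<equiv> product (\<lambda>j. if j \<le> c then \<theta> else - \<theta>)"
  shows "measure_pmf.expectation \<nu> ((config_step (exp \<theta>) (exp \<theta>) ^^ n) (\<lambda>\<eta>. \<rho> (\<eta> i))) \<le> exp \<theta>"
    and "measure_pmf.expectation \<nu> ((config_step (exp \<theta>) (exp \<theta>) ^^ n) (\<lambda>\<eta>. - \<rho> (- \<eta> i))) \<ge> - exp \<theta>"
proof -
  have R: "exp \<theta> \<le> R" "exp (- \<theta>) \<le> exp \<theta>"
    using \<theta> order.strict_trans2[OF \<theta>(1) le_R] by simp_all
  then have R': "exp (- \<theta>) \<le> R"
    by (rule order.trans[rotated])
  have \<theta>': "exp \<bar>\<theta>\<bar> < \<rho> y" "exp \<bar>- \<theta>\<bar> < \<rho> y"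
    using \<theta> by auto
  let ?P = "\<lambda>a b. (config_step (exp a) (exp b) ^^ n)"
  have bd: "\<bar>\<rho> z\<bar> \<le> R" for z
    using le_R[of z] pos[of z] by simp
  have int: "integrable p (?P a b f)" if "\<bar>a\<bar> \<le> \<theta>" "\<bar>b\<bar> \<le> \<theta>" "\<And>\<eta>. \<bar>f \<eta>\<bar> \<le> R" for p :: "(int \<Rightarrow> int) pmf" and a b f
    using that order.trans[OF exp_le_cancel_iff[THEN iffD2] R(1), of a] order.trans[OF exp_le_cancel_iff[THEN iffD2] R(1), of b]
    by (intro integrable_pmf_bounded[where B = R] config_iterate_bounded[where B = R]) auto
  define f where "f \<eta> = \<rho> (\<eta> i)" for \<eta> :: "int \<Rightarrow> int"
  define g where "g \<eta> = - \<rho> (- \<eta> i)" for \<eta> :: "int \<Rightarrow> int"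
  have f: "\<bar>f \<eta>\<bar> \<le> R" and g: "\<bar>g \<eta>\<bar> \<le> R" for \<eta>
    using bd by (simp_all add: f_def g_def)
  have f': "f x \<le> f y" and g': "g x \<le> g y" if "le_sites x y" for x y
    using rho_mono[of "x i" "y i"] rho_mono[of "- y i" "- x i"] i that
    by (auto simp: f_def g_def le_sites_def)
  have "measure_pmf.expectation \<nu> (?P \<theta> \<theta> f) \<le> measure_pmf.expectation \<nu> (?P \<theta> (- \<theta>) f)"
    using \<theta> f f' R R' by (intro integral_mono int config_iterate_coupling) (auto simp: le_sites_def)
  also have "\<dots> \<le> measure_pmf.expectation (product (\<lambda>_. \<theta>)) (?P \<theta> (- \<theta>) f)"
    unfolding \<nu>_def
  proof (rule product_mono)
    show "\<bar>?P \<theta> (- \<theta>) f \<eta>\<bar> \<le> R" for \<eta>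
      using f R R' by (intro config_iterate_bounded) auto
    show "?P \<theta> (- \<theta>) f x \<le> ?P \<theta> (- \<theta>) f y" if "le_sites x y" for x y
      using f' R R' that by (intro config_iterate_coupling) auto
  qed (use \<theta> in auto)
  also have "\<dots> = measure_pmf.expectation (product (\<lambda>_. \<theta>)) f"
    using f f' by (intro product_stationary[OF \<theta>'(1)]) auto
  also have "\<dots> = exp \<theta>"
    using product_shift(1)[of i "\<lambda>_. \<theta>" y "\<lambda>_. 1" 1] i \<theta>' by (simp add: f_def[abs_def])
  finally show "measure_pmf.expectation \<nu> (?P \<theta> \<theta> (\<lambda>\<eta>. \<rho> (\<eta> i))) \<le> exp \<theta>"
    by (simp add: f_def[abs_def])
  have "- exp \<theta> = measure_pmf.expectation (product (\<lambda>_. - \<theta>)) g"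
    using product_shift(2)[of i "\<lambda>_. - \<theta>" y "\<lambda>_. 1" 1] i \<theta>' by (simp add: g_def[abs_def])
  also have "\<dots> = measure_pmf.expectation (product (\<lambda>_. - \<theta>)) (?P (- \<theta>) \<theta> g)"
    using product_stationary[OF \<theta>'(2) g g', where n = n] by simp
  also have "\<dots> \<le> measure_pmf.expectation \<nu> (?P (- \<theta>) \<theta> g)"
    unfolding \<nu>_def
  proof (rule product_mono)
    show "\<bar>?P (- \<theta>) \<theta> g \<eta>\<bar> \<le> R" for \<eta>
      using g R R' by (intro config_iterate_bounded) auto
    show "?P (- \<theta>) \<theta> g x \<le> ?P (- \<theta>) \<theta> g y" if "le_sites x y" for x y
      using g' R R' that by (intro config_iterate_coupling) auto
  qed (use \<theta> in auto)
  also have "\<dots> \<le> measure_pmf.expectation \<nu> (?P \<theta> \<theta> g)"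
    using \<theta> g g' R R' by (intro integral_mono int config_iterate_coupling) (auto simp: le_sites_def)
  finally show "- exp \<theta> \<le> measure_pmf.expectation \<nu> (?P \<theta> \<theta> (\<lambda>\<eta>. - \<rho> (- \<eta> i)))"
    by (simp add: g_def[abs_def])
qed

end

section \<open>Comparison of heights with a random wedge\<close>

text \<open>The height function with increments \<open>x\<close> and height \<open>D\<close> at
  column \<open>c\<close>.\<close>

definition hgt :: "int \<Rightarrow> int \<Rightarrow> (int \<Rightarrow> int) \<Rightarrow> int \<Rightarrow> int" where
  "hgt c D x j = (if c \<le> j then D - (\<Sum>k\<in>{c + 1..j}. x k) else D + (\<Sum>k\<in>{j + 1..c}. x k))"

lemma hgt_centre [simp]: "hgt c D x c = D"
  by (simp add: hgt_def)

lemma increments_hgt [simp]: "increments (hgt c D x) = x"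
proof
  fix j
  consider "c < j" | "j = c" | "j < c"
    by linarith
  then show "increments (hgt c D x) j = x j"
  proof cases
    case 1
    then have "{c + 1..j} = insert j {c + 1..j - 1}" by auto
    with 1 show ?thesis by (simp add: increments_def hgt_def)
  next
    case 2
    then have "{c..c} = {c}" by auto
    with 2 show ?thesis by (simp add: increments_def hgt_def)
  next
    case 3
    then have "{j..c} = insert j {j + 1..c}" by auto
    with 3 show ?thesis by (simp add: increments_def hgt_def)
  qed
qed

lemma increments_inject:
  assumes "increments h = increments g" and "h c = g c"
  shows "h = g"
proof
  fix j
  have *: "h (j - 1) - h j = g (j - 1) - g j" for j
    using fun_cong[OF assms(1), of j] by (simp add: increments_def)
  show "h j = g j"
  proof (induction j rule: int_induct[where k = c])
    case (step1 i)
    then show ?case using *[of "i + 1"] by simp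
  next
    case (step2 i)
    then show ?case using *[of i] by simp
  qed (fact assms(2))
qed

definition lift :: "int \<Rightarrow> (int \<Rightarrow> int) \<Rightarrow> int \<Rightarrow> int" where
  "lift i h = h(i := h i + 1)"

lemma increments_lift: "increments (lift i h) = brick i (increments h)"
  by (simp add: lift_def brick_def increments_jump)

lemma euler_step_linear:
  "euler_step d J c up (\<lambda>x. f x + k * g x) = (\<lambda>x. euler_step d J c up f x + k * euler_step d J c up g x)"
proof
  fix x
  have "(\<Sum>i\<in>J. c i x * (f (up i x) + k * g (up i x) - (f x + k * g x)))
      = (\<Sum>i\<in>J. c i x * (f (up i x) - f x)) + k * (\<Sum>i\<in>J. c i x * (g (up i x) - g x))"
    by (simp add: sum_distrib_left sum.distrib[symmetric] algebra_simps)
  then show "euler_step d J c up (\<lambda>x. f x + k * g x) x = euler_step d J c up f x + k * euler_step d J c up g x"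
    by (simp add: euler_step_def algebra_simps)
qed

lemma euler_iterate_linear:
  "(euler_step d J c up ^^ n) (\<lambda>x. f x + k * g x)
    = (\<lambda>x. (euler_step d J c up ^^ n) f x + k * (euler_step d J c up ^^ n) g x)"
  by (induction n) (simp_all add: euler_step_linear)

section \<open>Heights in finite volume against the chain with reservoirs\<close>

definition volume_rate :: "(int \<Rightarrow> real) \<Rightarrow> int \<Rightarrow> (int \<Rightarrow> int) \<Rightarrow> real" where
  "volume_rate \<rho> i h = \<rho> (increments h i) + \<rho> (- increments h (i + 1))"

definition volume_step ::
  "(int \<Rightarrow> real) \<Rightarrow> real \<Rightarrow> int \<Rightarrow> int \<Rightarrow> ((int \<Rightarrow> int) \<Rightarrow> real) \<Rightarrow> (int \<Rightarrow> int) \<Rightarrow> real" where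
  "volume_step \<rho> d l u = euler_step d {l..<u} (volume_rate \<rho>) lift"

context brick_chain
begin

definition height_step :: "real \<Rightarrow> real \<Rightarrow> ((int \<Rightarrow> int) \<Rightarrow> real) \<Rightarrow> (int \<Rightarrow> int) \<Rightarrow> real" where
  "height_step a b = euler_step d {l - 1..u}
     (\<lambda>i h. fwd a i (increments h) + bwd b (i + 1) (increments h)) lift"

definition le_columns :: "(int \<Rightarrow> int) \<Rightarrow> (int \<Rightarrow> int) \<Rightarrow> bool" where
  "le_columns h g \<longleftrightarrow> (\<forall>j\<in>{l - 1..u}. h j \<le> g j)"

lemma volume_rate_bounds: "0 < volume_rate \<rho> i h" "volume_rate \<rho> i h \<le> 2 * R"
  using pos[of "increments h i"] pos[of "- increments h (i + 1)"]
    le_R[of "increments h i"] le_R[of "- increments h (i + 1)"]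
  by (simp_all add: volume_rate_def)

text \<open>Only a lone jump of the lower path at a column where both are level could spoil the
  order, and there the order of the neighbours orders the rates. The bonds \<open>l - 1\<close> and
  \<open>u\<close>, absent from the finite volume, are added to it with rate 0, so the reservoirs
  can only help.\<close>

lemma volume_le_height_step:
  assumes ab: "0 \<le> a" "a \<le> R" "0 \<le> b" "b \<le> R"
    and f: "\<And>h g. le_columns h g \<Longrightarrow> f h \<le> f' g" and hg: "le_columns h g"
  shows "volume_step \<rho> d l u f h \<le> height_step a b f' g"
proof -
  let ?c = "\<lambda>i h. if i \<in> {l..<u} then volume_rate \<rho> i h else 0"
  have "volume_step \<rho> d l u f h = euler_step d {l - 1..u} ?c lift f h"
    unfolding volume_step_def euler_step_def
    by (intro arg_cong[where f = "\<lambda>s. f h + d * s"] sum.mono_neutral_cong_left) auto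
  also have "\<dots> \<le> height_step a b f' g"
    unfolding height_step_def
  proof (rule euler_step_coupling[where C = "2 * R"])
    fix i assume i: "i \<in> {l - 1..u}"
    let ?c' = "\<lambda>i h. fwd a i (increments h) + bwd b (i + 1) (increments h)"
    show "?c i h * (f (lift i h) - f h) + 2 * R * f h \<le> ?c' i g * (f' (lift i g) - f' g) + 2 * R * f' g"
    proof (rule coupled_move)
      show "f (lift i h) \<le> f' (lift i g)"
        by (rule f) (use hg in \<open>auto simp: le_columns_def lift_def\<close>)
      have "le_columns h (lift i g)"
        using hg by (force simp: le_columns_def lift_def)
      then show "f h \<le> f' (lift i g)"
        by (rule f)
      show "f (lift i h) \<le> f' g" if "?c' i g < ?c i h"
      proof (rule f)
        have "h i \<noteq> g i"
        proof
          assume eq: "h i = g i"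
          have "?c i h \<le> ?c' i g"
          proof (cases "i \<in> {l..<u}")
            case True
            then have "h (i - 1) \<le> g (i - 1)" "h (i + 1) \<le> g (i + 1)"
              using hg by (auto simp: le_columns_def)
            then have "increments h i \<le> increments g i" "- increments h (i + 1) \<le> - increments g (i + 1)"
              using eq by (simp_all add: increments_def)
            then show ?thesis
              using True by (auto simp: volume_rate_def fwd_def bwd_def intro!: add_mono rho_mono)
          next
            case False
            then show ?thesis
              using config_rates[OF ab] by (auto intro!: add_nonneg_nonneg)
          qed
          with that show False
            by simp
        qed
        then show "le_columns (lift i h) g"
          using hg by (force simp: le_columns_def lift_def)
      qed
      have "0 \<le> volume_rate \<rho> i h" "volume_rate \<rho> i h \<le> 2 * R"
        using volume_rate_bounds by (auto intro: less_imp_le)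
      then show "0 \<le> ?c i h" "?c i h \<le> 2 * R"
        using R_pos by auto
      show "0 \<le> ?c' i g"
        using config_rates[OF ab] by simp
      show "?c' i g \<le> 2 * R"
        using config_rates(2)[OF ab, of i "increments g"] config_rates(4)[OF ab, of "i + 1" "increments g"]
        by linarith
    qed (use f hg in auto)
  qed (use d_nonneg d_small f hg in auto)
  finally show ?thesis .
qed

lemma volume_le_height_iterate:
  assumes ab: "0 \<le> a" "a \<le> R" "0 \<le> b" "b \<le> R"
    and f: "\<And>h g. le_columns h g \<Longrightarrow> f h \<le> f g" and hg: "le_columns h g"
  shows "(volume_step \<rho> d l u ^^ n) f h \<le> (height_step a b ^^ n) f g"
  using hg
proof (induction n arbitrary: h g)
  case (Suc n)
  then show ?case
    by (simp add: volume_le_height_step[OF ab])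
qed (use f in simp)

lemma height_iterate_increments:
  "(height_step a b ^^ n) (\<lambda>h. \<phi> (increments h)) = (\<lambda>h. (config_step a b ^^ n) \<phi> (increments h))"
  by (induction n) (auto simp: height_step_def config_step_def euler_step_def increments_lift fun_eq_iff)

text \<open>Dynkin's formula for one column. Its jump rate is a function of the increments, which
  form a chain of their own; \<open>c \<in> {l..<u}\<close> keeps both sites \<open>c\<close> and
  \<open>c + 1\<close> in the box, so that no reservoir rate appears.\<close>

lemma height_iterate_column:
  assumes "c \<in> {l..<u}"
  shows "(height_step a b ^^ n) (\<lambda>h. real_of_int (h c)) h
    = h c + d * (\<Sum>k<n. (config_step a b ^^ k) (\<lambda>\<eta>. \<rho> (\<eta> c)) (increments h)
                       - (config_step a b ^^ k) (\<lambda>\<eta>. - \<rho> (- \<eta> (c + 1))) (increments h))"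
proof (induction n arbitrary: h)
  case (Suc n)
  let ?f = "\<lambda>\<eta>. \<rho> (\<eta> c)" and ?g = "\<lambda>\<eta>. - \<rho> (- \<eta> (c + 1))" and ?\<pi> = "\<lambda>h. real_of_int (h c)"
  have step: "height_step a b ?\<pi> = (\<lambda>h. ?\<pi> h + d * (?f (increments h) + (- 1) * ?g (increments h)))"
  proof
    fix h
    let ?r = "\<lambda>i. fwd a i (increments h) + bwd b (i + 1) (increments h)"
    have "(\<Sum>i\<in>{l - 1..u}. ?r i * (?\<pi> (lift i h) - ?\<pi> h)) = (\<Sum>i\<in>{c}. ?r i * (?\<pi> (lift i h) - ?\<pi> h))"
      using assms by (intro sum.mono_neutral_right) (auto simp: lift_def)
    then show "height_step a b ?\<pi> h = ?\<pi> h + d * (?f (increments h) + (- 1) * ?g (increments h))"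
      using assms by (simp add: height_step_def euler_step_def lift_def fwd_def bwd_def)
  qed
  have "(height_step a b ^^ Suc n) ?\<pi> h = (height_step a b ^^ n) (height_step a b ?\<pi>) h"
    by (simp add: funpow_swap1)
  also have "\<dots> = (height_step a b ^^ n) ?\<pi> h + d * ((height_step a b ^^ n) (\<lambda>h. ?f (increments h)) h
      + (- 1) * (height_step a b ^^ n) (\<lambda>h. ?g (increments h)) h)"
    unfolding step unfolding height_step_def euler_iterate_linear ..
  also have "(height_step a b ^^ n) (\<lambda>h. ?f (increments h)) h = (config_step a b ^^ n) ?f (increments h)"
    by (simp add: height_iterate_increments[of _ _ _ ?f])
  also have "(height_step a b ^^ n) (\<lambda>h. ?g (increments h)) h = (config_step a b ^^ n) ?g (increments h)"
    by (simp add: height_iterate_increments[of _ _ _ ?g])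
  finally show ?case
    unfolding Suc.IH by (simp add: algebra_simps)
qed simp

lemma wedge_growth:
  fixes c D :: int and n :: nat
  assumes \<theta>: "exp \<theta> < \<rho> y" "0 \<le> \<theta>" and c: "c \<in> {l..<u}"
  defines "\<nu> \<equiv> product (\<lambda>j. if j \<le> c then \<theta> else - \<theta>)"
    and "W \<equiv> \<lambda>\<eta>. (height_step (exp \<theta>) (exp \<theta>) ^^ n) (\<lambda>h. real_of_int (h c)) (hgt c D \<eta>)"
  shows "real_of_int D \<le> W \<eta>" and "integrable (measure_pmf \<nu>) W"
    and "measure_pmf.expectation \<nu> W \<le> D + 2 * n * d * exp \<theta>"
proof -
  let ?f = "\<lambda>\<eta>. \<rho> (\<eta> c)" and ?g = "\<lambda>\<eta>. - \<rho> (- \<eta> (c + 1))"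
  let ?P = "\<lambda>k. config_step (exp \<theta>) (exp \<theta>) ^^ k"
  have R: "exp \<theta> \<le> R"
    using order.strict_trans2[OF \<theta>(1) le_R] by simp
  have W: "W = (\<lambda>\<eta>. D + d * (\<Sum>k<n. ?P k ?f \<eta> - ?P k ?g \<eta>))"
    unfolding W_def height_iterate_column[OF c] by simp
  have bound: "\<bar>?P k ?f \<eta>\<bar> \<le> R" "\<bar>?P k ?g \<eta>\<bar> \<le> R" for k \<eta>
    by (rule config_iterate_bounded; simp add: R abs_of_pos pos le_R)+
  note int = integrable_pmf_bounded[of _ R \<nu>, OF bound(1)] integrable_pmf_bounded[of _ R \<nu>, OF bound(2)]
  show "integrable (measure_pmf \<nu>) W"
    unfolding W using int by (intro Bochner_Integration.integrable_add integrable_mult_right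
      Bochner_Integration.integrable_sum Bochner_Integration.integrable_diff) auto
  have "0 \<le> ?P k ?f \<eta> - ?P k ?g \<eta>" for k
  proof -
    \<comment> \<open>\<open>config_iterate_bounded\<close> controls absolute values only; centring
      \<open>\<phi>\<close> at \<open>R / 2\<close> turns it into a lower bound.\<close>
    have nonneg: "0 \<le> ?P k \<phi> \<eta>" if "\<And>\<eta>. 0 \<le> \<phi> \<eta> \<and> \<phi> \<eta> \<le> R" for \<phi> k \<eta>
    proof -
      have "\<bar>?P k (\<lambda>\<eta>. \<phi> \<eta> + (- R / 2) * 1) \<eta>\<bar> \<le> R / 2"
      proof (rule config_iterate_bounded)
        show "\<bar>\<phi> x + (- R / 2) * 1\<bar> \<le> R / 2" for x
          using that[of x] by (auto simp: abs_if field_simps)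
      qed (use R in auto)
      from abs_le_D2[OF this] have "- (?P k \<phi> \<eta> + (- R / 2) * ?P k (\<lambda>_. 1) \<eta>) \<le> R / 2"
        unfolding config_step_def euler_iterate_linear .
      moreover have "?P k (\<lambda>_. 1) \<eta> = 1"
        by (induction k arbitrary: \<eta>) (simp_all add: config_step_def euler_step_def)
      ultimately show ?thesis
        by simp
    qed
    have "?P k ?g \<eta> = - ?P k (\<lambda>\<eta>. \<rho> (- \<eta> (c + 1))) \<eta>"
    proof -
      have "?P k (\<lambda>\<eta>. 0 + (- 1) * \<rho> (- \<eta> (c + 1))) \<eta> = ?P k (\<lambda>_. 0) \<eta> - ?P k (\<lambda>\<eta>. \<rho> (- \<eta> (c + 1))) \<eta>"
        unfolding config_step_def euler_iterate_linear by simp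
      moreover have "?P k (\<lambda>_. 0) \<eta> = 0"
        by (induction k arbitrary: \<eta>) (simp_all add: config_step_def euler_step_def)
      ultimately show ?thesis
        by simp
    qed
    then show ?thesis
      using nonneg[of ?f k \<eta>] nonneg[of "\<lambda>\<eta>. \<rho> (- \<eta> (c + 1))" k \<eta>] le_R less_imp_le[OF pos]
      by simp
  qed
  then show "real_of_int D \<le> W \<eta>"
    unfolding W using d_nonneg by (simp add: sum_nonneg)
  have "measure_pmf.expectation \<nu> W
      = D + d * (\<Sum>k<n. measure_pmf.expectation \<nu> (?P k ?f) - measure_pmf.expectation \<nu> (?P k ?g))"
    unfolding W using int by simp
  also have "\<dots> \<le> D + d * (\<Sum>k<n. exp \<theta> + exp \<theta>)"
  proof -
    have "measure_pmf.expectation \<nu> (?P k ?f) - measure_pmf.expectation \<nu> (?P k ?g) \<le> exp \<theta> + exp \<theta>" for k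
      using wedge_rate_bound(1)[OF \<theta>, of c c k] wedge_rate_bound(2)[OF \<theta>, of "c + 1" c k] c
      by (simp add: \<nu>_def)
    then show ?thesis
      using d_nonneg by (intro add_left_mono mult_left_mono sum_mono) auto
  qed
  finally show "measure_pmf.expectation \<nu> W \<le> D + 2 * n * d * exp \<theta>"
    by (simp add: algebra_simps)
qed

section \<open>Tail bounds: the wedge above a linear profile\<close>

lemma product_chernoff:
  fixes \<psi> :: "int \<Rightarrow> real"
  assumes S: "S \<subseteq> {l..u}"
    and int: "\<And>k. k \<in> S \<Longrightarrow> integrable (site (\<theta> k)) (\<lambda>z. exp (\<psi> z))"
    and \<kappa>: "\<And>k. k \<in> S \<Longrightarrow> measure_pmf.expectation (site (\<theta> k)) (\<lambda>z. exp (\<psi> z)) \<le> \<kappa>"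
  shows "measure_pmf.prob (product \<theta>) {\<eta>. 0 < (\<Sum>k\<in>S. \<psi> (\<eta> k))} \<le> \<kappa> ^ card S"
proof -
  let ?F = "\<lambda>\<eta>. \<Prod>k\<in>{l..u}. if k \<in> S then exp (\<psi> (\<eta> k)) else 1"
  have finS: "finite S"
    using S by (rule finite_subset) simp
  have F: "?F \<eta> = exp (\<Sum>k\<in>S. \<psi> (\<eta> k))" for \<eta>
    using S finS by (simp add: prod.If_cases Int_absorb1 exp_sum)
  have int': "k \<in> {l..u} \<Longrightarrow> integrable (site (\<theta> k)) (\<lambda>z. if k \<in> S then exp (\<psi> z) else 1)" for k
    using int by (cases "k \<in> S") auto
  have "measure_pmf.prob (product \<theta>) {\<eta>. 0 < (\<Sum>k\<in>S. \<psi> (\<eta> k))}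
      = measure_pmf.expectation (product \<theta>) (indicator {\<eta>. 0 < (\<Sum>k\<in>S. \<psi> (\<eta> k))})"
    by simp
  also have "\<dots> \<le> measure_pmf.expectation (product \<theta>) ?F"
  proof (rule integral_mono)
    show "integrable (product \<theta>) ?F"
      unfolding product_def by (rule integrable_prod_Pi_pmf) (use int' in auto)
    show "integrable (product \<theta>) (indicator {\<eta>. 0 < (\<Sum>k\<in>S. \<psi> (\<eta> k))} :: _ \<Rightarrow> real)"
      by (rule integrable_pmf_bounded[where B = 1]) (simp add: indicator_def)
    show "indicator {\<eta>. 0 < (\<Sum>k\<in>S. \<psi> (\<eta> k))} \<eta> \<le> ?F \<eta>" for \<eta>
      unfolding F by (simp add: indicator_def)
  qed
  also have "\<dots> = (\<Prod>k\<in>{l..u}. measure_pmf.expectation (site (\<theta> k)) (\<lambda>z. if k \<in> S then exp (\<psi> z) else 1))"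
    unfolding product_def
    by (rule expectation_prod_Pi_pmf) (use int' in auto)
  also have "\<dots> = (\<Prod>k\<in>{l..u}. if k \<in> S then measure_pmf.expectation (site (\<theta> k)) (\<lambda>z. exp (\<psi> z)) else 1)"
    by (rule prod.cong) auto
  also have "\<dots> = (\<Prod>k\<in>S. measure_pmf.expectation (site (\<theta> k)) (\<lambda>z. exp (\<psi> z)))"
    using S finS by (simp add: prod.If_cases Int_absorb1)
  also have "\<dots> \<le> (\<Prod>k\<in>S. \<kappa>)"
    using \<kappa> by (intro prod_mono conjI Bochner_Integration.integral_nonneg) auto
  finally show ?thesis
    by simp
qed

text \<open>A union bound: the partial sums up to distance \<open>n\<close> fail with probability at most \<open>5 ^ (- n)\<close>.\<close>

lemma wedge_dominates:
  fixes c D :: int and K :: nat and \<beta> \<theta> :: real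
  assumes \<beta>: "0 < \<beta>" and growth: "\<And>z. 0 < z \<Longrightarrow> \<rho> z \<le> exp (\<beta> * real_of_int z)"
    and \<theta>: "\<theta> = \<beta> + \<beta> * K + ln 6" "exp \<theta> < \<rho> y" and c: "c \<in> {l..<u}"
  defines "\<nu> \<equiv> product (\<lambda>j. if j \<le> c then \<theta> else - \<theta>)"
  shows "1 / 2 \<le> measure_pmf.prob \<nu> {\<eta>. \<forall>j\<in>{l - 1..u}. D + int K * \<bar>j - c\<bar> \<le> hgt c D \<eta> j}"
proof -
  have \<theta>0: "0 \<le> \<theta>" "\<beta> \<le> \<theta>"
    using \<beta> \<theta>(1) by auto
  then have \<theta>': "exp \<bar>\<theta>\<bar> < \<rho> y" "exp \<bar>- \<theta>\<bar> < \<rho> y" "exp \<bar>- \<theta> + \<beta>\<bar> < \<rho> y"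
    using \<theta>(2) \<beta> by (auto intro: le_less_trans[rotated])
  let ?m = "measure_pmf.expectation (site (- \<theta>)) (\<lambda>z. exp (\<beta> * real_of_int z))"
  note int = site_exp_integrable[OF \<theta>'(2,3)]
  define \<epsilon> where "\<epsilon> = exp (- \<beta> * K) / 6"
  \<comment> \<open>The choice of \<theta> amounts to
    \<open>exp (\<beta> - \<theta>) = exp (- \<beta> * K) / 6\<close>. Then the moment is at most
    \<open>6 / 5 * \<epsilon>\<close>, the factor \<open>exp (\<beta> * K)\<close> coming from the
    slope brings it to \<open>1 / 5\<close>, and each side of \<open>c\<close> contributes at most
    the geometric sum \<open>1 / 4\<close>.\<close>
  have \<epsilon>: "exp (\<beta> - \<theta>) = \<epsilon>" "\<epsilon> \<le> 1 / 6" "0 < \<epsilon>"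
    using \<beta> by (auto simp: \<theta>(1) \<epsilon>_def exp_diff exp_add exp_minus field_simps)
  have m0: "0 \<le> ?m"
    by (rule Bochner_Integration.integral_nonneg) simp
  have "(1 - \<epsilon>) * ?m \<le> \<epsilon>"
    using site_exp_moment[OF \<theta>(2) \<beta> \<theta>0(2) growth] \<epsilon> by simp
  moreover have "(5 / 6) * ?m \<le> (1 - \<epsilon>) * ?m"
    using \<epsilon> m0 by (intro mult_right_mono) auto
  ultimately have m: "?m \<le> 6 / 5 * \<epsilon>"
    by simp
  let ?\<psi> = "\<lambda>z. \<beta> * real_of_int z + \<beta> * K"
  have \<psi>: "integrable (site (- \<theta>)) (\<lambda>z. exp (?\<psi> z))"
    "measure_pmf.expectation (site (- \<theta>)) (\<lambda>z. exp (?\<psi> z)) \<le> 1 / 5"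
  proof -
    show "integrable (site (- \<theta>)) (\<lambda>z. exp (?\<psi> z))"
      using int by (simp add: exp_add)
    have "measure_pmf.expectation (site (- \<theta>)) (\<lambda>z. exp (?\<psi> z)) = ?m * exp (\<beta> * K)"
      by (simp add: exp_add)
    also have "\<dots> \<le> 6 / 5 * \<epsilon> * exp (\<beta> * K)"
      using m by (rule mult_right_mono) simp
    finally show "measure_pmf.expectation (site (- \<theta>)) (\<lambda>z. exp (?\<psi> z)) \<le> 1 / 5"
      by (simp add: \<epsilon>_def exp_minus)
  qed
  have \<psi>': "integrable (site \<theta>) (\<lambda>z. exp (?\<psi> (- z)))"
    "measure_pmf.expectation (site \<theta>) (\<lambda>z. exp (?\<psi> (- z))) \<le> 1 / 5"
  proof -
    have "exp \<bar>\<theta> + - \<beta>\<bar> < \<rho> y"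
      using \<theta>'(3) by (simp add: abs_minus_commute)
    from integrable_mult_right[OF site_exp_integrable[OF \<theta>'(1) this], of "exp (\<beta> * K)"]
    show "integrable (site \<theta>) (\<lambda>z. exp (?\<psi> (- z)))"
      by (simp add: exp_add[symmetric])
    show "measure_pmf.expectation (site \<theta>) (\<lambda>z. exp (?\<psi> (- z))) \<le> 1 / 5"
      using \<psi>(2) unfolding site_uminus[OF \<theta>'(1)] .
  qed
  \<comment> \<open>To the right of \<open>c\<close> the wedge is too low at \<open>j\<close>
    exactly if the sum of \<open>\<eta> k + K\<close> over \<open>c < k \<le> j\<close> is positive;
    to the left it is the sum of \<open>K - \<eta> k\<close> over
    \<open>j < k \<le> c\<close>.\<close>
  define right where "right j = {\<eta> :: int \<Rightarrow> int. 0 < (\<Sum>k\<in>{c + 1..j}. ?\<psi> (\<eta> k))}" for j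
  define left where "left j = {\<eta> :: int \<Rightarrow> int. 0 < (\<Sum>k\<in>{j + 1..c}. ?\<psi> (- \<eta> k))}" for j
  have right: "measure_pmf.prob \<nu> (right j) \<le> (1 / 5) ^ nat (j - c)" if "j \<in> {c + 1..u}" for j
  proof -
    have "measure_pmf.prob \<nu> (right j) \<le> (1 / 5) ^ card {c + 1..j}"
      unfolding right_def \<nu>_def by (rule product_chernoff) (use that c \<psi> in auto)
    then show ?thesis
      using that by simp
  qed
  have left: "measure_pmf.prob \<nu> (left j) \<le> (1 / 5) ^ nat (c - j)" if "j \<in> {l - 1..c - 1}" for j
  proof -
    have "measure_pmf.prob \<nu> (left j) \<le> (1 / 5) ^ card {j + 1..c}"
      unfolding left_def \<nu>_def by (rule product_chernoff) (use that c \<psi>' in auto)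
    then show ?thesis
      using that by simp
  qed
  have geometric: "(\<Sum>m<n. (1 / 5 :: real) ^ Suc m) \<le> 1 / 4" for n
  proof -
    have "(\<Sum>m<n. (1 / 5 :: real) ^ Suc m) = 1 / 4 - (1 / 5) ^ n / 4"
      by (induction n) simp_all
    then show ?thesis
      by simp
  qed
  have Suc_nat: "Suc (nat (z - 1)) = nat z" if "0 < z" for z
    using that by simp
  let ?good = "{\<eta>. \<forall>j\<in>{l - 1..u}. D + int K * \<bar>j - c\<bar> \<le> hgt c D \<eta> j}"
  have "- ?good \<subseteq> (\<Union>j\<in>{c + 1..u}. right j) \<union> (\<Union>j\<in>{l - 1..c - 1}. left j)"
  proof
    fix \<eta> assume "\<eta> \<in> - ?good"
    then obtain j where j: "j \<in> {l - 1..u}" "hgt c D \<eta> j < D + int K * \<bar>j - c\<bar>"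
      by (auto simp: not_le)
    then consider "c < j" | "j < c"
      by (cases "j = c") force+
    then show "\<eta> \<in> (\<Union>j\<in>{c + 1..u}. right j) \<union> (\<Union>j\<in>{l - 1..c - 1}. left j)"
    proof cases
      case 1
      have "(\<Sum>k\<in>{c + 1..j}. ?\<psi> (\<eta> k)) = \<beta> * real_of_int ((\<Sum>k\<in>{c + 1..j}. \<eta> k) + int K * (j - c))"
        using 1 by (simp add: sum.distrib sum_distrib_left algebra_simps)
      also have "\<dots> > 0"
        using 1 j(2) \<beta> by (intro mult_pos_pos) (simp_all only: of_int_0_less_iff, simp add: hgt_def)
      finally show ?thesis
        using 1 j(1) by (auto simp: right_def)
    next
      case 2
      have "(\<Sum>k\<in>{j + 1..c}. ?\<psi> (- \<eta> k)) = \<beta> * real_of_int (int K * (c - j) - (\<Sum>k\<in>{j + 1..c}. \<eta> k))"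
        using 2 by (simp add: sum.distrib sum_negf sum_subtractf sum_distrib_left[symmetric] algebra_simps)
      also have "\<dots> > 0"
        using 2 j(2) \<beta> by (intro mult_pos_pos) (simp_all only: of_int_0_less_iff, simp add: hgt_def)
      finally show ?thesis
        using 2 j(1) by (auto simp: left_def)
    qed
  qed
  then have "measure_pmf.prob \<nu> (- ?good)
      \<le> measure_pmf.prob \<nu> ((\<Union>j\<in>{c + 1..u}. right j) \<union> (\<Union>j\<in>{l - 1..c - 1}. left j))"
    by (intro measure_pmf.finite_measure_mono) auto
  also have "\<dots> \<le> measure_pmf.prob \<nu> (\<Union>j\<in>{c + 1..u}. right j) + measure_pmf.prob \<nu> (\<Union>j\<in>{l - 1..c - 1}. left j)"
    by (rule measure_Un_le) auto
  also have "\<dots> \<le> (\<Sum>j\<in>{c + 1..u}. measure_pmf.prob \<nu> (right j)) + (\<Sum>j\<in>{l - 1..c - 1}. measure_pmf.prob \<nu> (left j))"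
    by (intro add_mono measure_UNION_le) auto
  also have "\<dots> \<le> (\<Sum>j\<in>{c + 1..u}. (1 / 5) ^ nat (j - c)) + (\<Sum>j\<in>{l - 1..c - 1}. (1 / 5) ^ nat (c - j))"
    using left right by (intro add_mono sum_mono) auto
  also have "(\<Sum>j\<in>{c + 1..u}. (1 / 5 :: real) ^ nat (j - c)) = (\<Sum>m<nat (u - c). (1 / 5) ^ Suc m)"
    by (rule sum.reindex_bij_witness[where i = "\<lambda>m. c + 1 + int m" and j = "\<lambda>j. nat (j - c - 1)"])
       (auto simp: Suc_nat simp del: power_Suc)
  also have "(\<Sum>j\<in>{l - 1..c - 1}. (1 / 5 :: real) ^ nat (c - j)) = (\<Sum>m<nat (c - l + 1). (1 / 5) ^ Suc m)"
    by (rule sum.reindex_bij_witness[where i = "\<lambda>m. c - 1 - int m" and j = "\<lambda>j. nat (c - j - 1)"])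
       (auto simp: Suc_nat simp del: power_Suc)
  also have "(\<Sum>m<nat (u - c). (1 / 5) ^ Suc m) + (\<Sum>m<nat (c - l + 1). (1 / 5) ^ Suc m) \<le> 1 / 4 + (1 / 4 :: real)"
    by (intro add_mono geometric)
  finally show ?thesis
    using measure_pmf.prob_compl[of ?good \<nu>] by (simp add: Compl_eq_Diff_UNIV)
qed

text \<open>\<open>?V\<close> is a number and \<open>?W\<close> is random. With probability at least
  1/2 the wedge starts above \<open>h\<close>, and then \<open>?V \<le> ?W\<close>; otherwise
  \<open>D \<le> ?W\<close> still holds, since heights never decrease. Hence half of
  \<open>?V - D\<close> is at most the mean of \<open>?W - D\<close>, which doubles the growth
  constant. The choice \<open>D = K * \<bar>c\<bar>\<close> for the tip lets a wedge of slope
  \<open>K\<close> dominate \<open>K * \<bar>j\<bar>\<close>, by the triangle inequality.\<close>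

lemma volume_growth:
  fixes c :: int and K :: nat and \<beta> \<theta> :: real
  assumes \<beta>: "0 < \<beta>" and growth: "\<And>z. 0 < z \<Longrightarrow> \<rho> z \<le> exp (\<beta> * real_of_int z)"
    and \<theta>: "\<theta> = \<beta> + \<beta> * K + ln 6" "exp \<theta> < \<rho> y" and c: "c \<in> {l..<u}"
    and h: "\<And>j. \<bar>h j\<bar> \<le> int K * \<bar>j\<bar>"
  shows "(volume_step \<rho> d l u ^^ n) (\<lambda>h. real_of_int (h c)) h \<le> K * \<bar>c\<bar> + 4 * n * d * exp \<theta>"
proof -
  define D where "D = int K * \<bar>c\<bar>"
  let ?\<nu> = "product (\<lambda>j. if j \<le> c then \<theta> else - \<theta>)"
  let ?V = "(volume_step \<rho> d l u ^^ n) (\<lambda>h. real_of_int (h c)) h"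
  let ?W = "\<lambda>\<eta>. (height_step (exp \<theta>) (exp \<theta>) ^^ n) (\<lambda>h. real_of_int (h c)) (hgt c D \<eta>)"
  let ?good = "{\<eta>. \<forall>j\<in>{l - 1..u}. D + int K * \<bar>j - c\<bar> \<le> hgt c D \<eta> j}"
  have "0 \<le> \<theta>"
    using \<beta> \<theta>(1) by simp
  note W = wedge_growth[OF \<theta>(2) this c, where D = D and n = n]
  have R: "exp \<theta> \<le> R"
    using order.strict_trans2[OF \<theta>(2) le_R] by simp
  have le: "?V \<le> ?W \<eta>" if "\<eta> \<in> ?good" for \<eta>
  proof (rule volume_le_height_iterate)
    show "le_columns h (hgt c D \<eta>)"
      unfolding le_columns_def
    proof
      fix j assume "j \<in> {l - 1..u}"
      then have "D + int K * \<bar>j - c\<bar> \<le> hgt c D \<eta> j"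
        using that by blast
      moreover have "int K * \<bar>j\<bar> \<le> int K * (\<bar>c\<bar> + \<bar>j - c\<bar>)"
        by (intro mult_left_mono) auto
      ultimately show "h j \<le> hgt c D \<eta> j"
        using h[of j] by (simp add: D_def algebra_simps)
    qed
  qed (use R c in \<open>auto simp: le_columns_def\<close>)
  have "?V - D \<le> 4 * n * d * exp \<theta>"
  proof (cases "?V \<le> D")
    case True
    moreover have "0 \<le> 4 * n * d * exp \<theta>"
      using d_nonneg by simp
    ultimately show ?thesis
      by linarith
  next
    case False
    have "(?V - D) * (1 / 2) \<le> (?V - D) * measure_pmf.prob ?\<nu> ?good"
      using wedge_dominates[OF \<beta> growth \<theta> c, of D] False by (intro mult_left_mono) auto
    also have "\<dots> = measure_pmf.expectation ?\<nu> (\<lambda>\<eta>. (?V - D) * indicator ?good \<eta>)"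
      by simp
    also have "\<dots> \<le> measure_pmf.expectation ?\<nu> (\<lambda>\<eta>. ?W \<eta> - D)"
    proof (rule integral_mono)
      show "integrable ?\<nu> (\<lambda>\<eta>. (?V - D) * indicator ?good \<eta>)"
        by (intro integrable_mult_right integrable_pmf_bounded[where B = 1]) (simp add: indicator_def)
      show "integrable ?\<nu> (\<lambda>\<eta>. ?W \<eta> - D)"
        using W(2) by simp
      show "(?V - D) * indicator ?good \<eta> \<le> ?W \<eta> - D" for \<eta>
        using le[of \<eta>] W(1)[of \<eta>] by (simp add: indicator_def)
    qed
    also have "\<dots> \<le> 2 * n * d * exp \<theta>"
      using W(2,3) by simp
    finally show ?thesis
      by simp
  qed
  then show ?thesis
    by (simp add: D_def)
qed

end

section \<open>Pathwise properties\<close>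

text \<open>Continuous induction, by the supremum of the initial segments on which \<open>P\<close>
  holds. The two steps correspond to right continuity and to left limits of the paths.\<close>

lemma real_interval_induct:
  fixes a b :: real
  assumes "a \<le> b" and start: "P a"
    and right: "\<And>s. a \<le> s \<Longrightarrow> s < b \<Longrightarrow> P s \<Longrightarrow> \<forall>\<^sub>F x in at_right s. P x"
    and left: "\<And>s. a < s \<Longrightarrow> s \<le> b \<Longrightarrow> (\<And>x. a \<le> x \<Longrightarrow> x < s \<Longrightarrow> P x) \<Longrightarrow> P s"
  shows "P b"
proof -
  define S where "S = {s \<in> {a..b}. \<forall>x\<in>{a..s}. P x}"
  have S: "a \<in> S" "bdd_above S"
    using assms(1) start by (auto simp: S_def intro!: bdd_aboveI[where M = b])
  define m where "m = Sup S"
  have m: "a \<le> m" "m \<le> b"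
    unfolding m_def using S by (auto intro!: cSup_upper cSup_least simp: S_def)
  have below: "P x" if x: "a \<le> x" "x < m" for x
  proof -
    obtain s where "s \<in> S" "x < s"
      using x S less_cSup_iff[of S x] unfolding m_def by blast
    then show ?thesis
      using x by (simp add: S_def)
  qed
  have "P m"
    using left[of m] m below start by (cases "a = m") simp_all
  then have mS: "\<And>x. a \<le> x \<Longrightarrow> x \<le> m \<Longrightarrow> P x"
    using below by (metis order_le_less)
  show ?thesis
  proof (cases "m = b")
    case False
    then have "m < b"
      using m by simp
    then obtain x where x: "m < x" "\<And>y. m < y \<Longrightarrow> y < x \<Longrightarrow> P y"
      using right[OF m(1) _ \<open>P m\<close>] by (auto simp: eventually_at_right)
    define z where "z = (m + min x b) / 2"
    have z: "m < z" "z < x" "z \<le> b"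
      using x(1) \<open>m < b\<close> by (simp_all add: z_def min_def)
    have "P y" if "a \<le> y" "y \<le> z" for y
      using mS[of y] x(2)[of y] that z by (cases "y \<le> m") simp_all
    then have "z \<in> S"
      using z m by (simp add: S_def)
    then have "z \<le> m"
      unfolding m_def using S by (intro cSup_upper)
    with z show ?thesis
      by simp
  qed (use \<open>P m\<close> in simp)
qed

lemma monotone_path_right:
  assumes "monotone_path r P l u \<omega> h" and "0 \<le> s"
  shows "\<forall>\<^sub>F x in at_right s. h x i = h s i"
proof -
  have "continuous (at_right s) (\<lambda>s. h s i)"
    using assms unfolding monotone_path_def by blast
  then show ?thesis
    by (simp add: continuous_within tendsto_discrete)
qed

lemma monotone_path_left:
  assumes "monotone_path r P l u \<omega> h" and "0 < s"
  obtains g where "\<And>i. \<forall>\<^sub>F x in at_left s. h x i = g i"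
    and "\<And>i. h s i = (if l \<le> i \<and> i < u \<and> (\<exists>y. (s, y) \<in> P i \<and> 0 < y \<and> y < volume_rate r i g)
                       then g i + 1 else g i)"
proof -
  obtain g where "(\<forall>i. ((\<lambda>s. h s i) \<longlongrightarrow> g i) (at_left s)) \<and> (\<forall>i. h s i =
           (if l \<le> i \<and> i < u \<and>
               (\<exists>y. (s, y) \<in> P i \<and> 0 < y \<and> y < r (increments g i) + r (- increments g (i + 1)))
            then g i + 1 else g i))"
    using assms unfolding monotone_path_def by blast
  then show thesis
    by (intro that[of g]) (simp_all add: tendsto_discrete volume_rate_def)
qed

lemma monotone_path_initial:
  assumes "monotone_path r P l u \<omega> h"
  shows "h 0 = hgt 0 0 \<omega>"
proof (rule increments_inject)
  show "increments (h 0) = increments (hgt 0 0 \<omega>)" "h 0 0 = hgt 0 0 \<omega> 0"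
    using assms unfolding monotone_path_def by simp_all
qed

lemma eventually_at_left_point:
  fixes a s :: real
  assumes "\<forall>\<^sub>F x in at_left s. Q x" and "a < s"
  obtains x where "a \<le> x" "x < s" "Q x"
proof -
  obtain b where b: "b < s" "\<And>x. b < x \<Longrightarrow> x < s \<Longrightarrow> Q x"
    using assms unfolding eventually_at_left[OF assms(2)] by blast
  show thesis
    using b assms(2) by (intro that[of "(max a b + s) / 2"]) (simp_all add: max_def)
qed

lemma monotone_path_mono:
  assumes mp: "monotone_path r P l u \<omega> h" and "0 \<le> a" "a \<le> b"
  shows "h a i \<le> h b i"
proof (rule real_interval_induct[OF \<open>a \<le> b\<close>, of "\<lambda>s. h a i \<le> h s i"])
  fix s assume "a \<le> s" "h a i \<le> h s i"
  then show "\<forall>\<^sub>F x in at_right s. h a i \<le> h x i"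
    using monotone_path_right[OF mp, of s i] \<open>0 \<le> a\<close> by (auto elim: eventually_mono)
next
  fix s assume s: "a < s" and le: "\<And>x. a \<le> x \<Longrightarrow> x < s \<Longrightarrow> h a i \<le> h x i"
  have "0 < s"
    using s \<open>0 \<le> a\<close> by simp
  then obtain g where g: "\<And>i. \<forall>\<^sub>F x in at_left s. h x i = g i"
    and step: "\<And>i. h s i = (if l \<le> i \<and> i < u \<and> (\<exists>y. (s, y) \<in> P i \<and> 0 < y \<and> y < volume_rate r i g)
                       then g i + 1 else g i)"
    by (rule monotone_path_left[OF mp]) (rule that)
  obtain x where "a \<le> x" "x < s" "h x i = g i"
    using eventually_at_left_point[OF g s] by blast
  then show "h a i \<le> h s i"
    using le[of x] by (simp add: step)
qed simp

lemma monotone_path_constant: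
  assumes mp: "monotone_path r P l u \<omega> h" and "0 \<le> a" "a \<le> b"
    and no_jump: "\<And>s g. a < s \<Longrightarrow> s \<le> b \<Longrightarrow> (\<And>j. \<forall>\<^sub>F x in at_left s. h x j = g j) \<Longrightarrow>
      l \<le> i \<Longrightarrow> i < u \<Longrightarrow> \<not> (\<exists>y. (s, y) \<in> P i \<and> 0 < y \<and> y < volume_rate r i g)"
  shows "h b i = h a i"
proof (rule real_interval_induct[OF \<open>a \<le> b\<close>, of "\<lambda>s. h s i = h a i"])
  fix s assume "a \<le> s" "h s i = h a i"
  then show "\<forall>\<^sub>F x in at_right s. h x i = h a i"
    using monotone_path_right[OF mp, of s i] \<open>0 \<le> a\<close> by simp
next
  fix s assume s: "a < s" "s \<le> b" and eq: "\<And>x. a \<le> x \<Longrightarrow> x < s \<Longrightarrow> h x i = h a i"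
  have "0 < s"
    using s \<open>0 \<le> a\<close> by simp
  then obtain g where g: "\<And>j. \<forall>\<^sub>F x in at_left s. h x j = g j"
    and step: "\<And>i. h s i = (if l \<le> i \<and> i < u \<and> (\<exists>y. (s, y) \<in> P i \<and> 0 < y \<and> y < volume_rate r i g)
                       then g i + 1 else g i)"
    by (rule monotone_path_left[OF mp]) (rule that)
  have "h s i = g i"
    using step[of i] no_jump[OF s g] by argo
  moreover obtain x where "a \<le> x" "x < s" "h x i = g i"
    using eventually_at_left_point[OF g s(1)] by blast
  ultimately show "h s i = h a i"
    using eq[of x] by simp
qed simp

lemma monotone_path_frozen:
  assumes "monotone_path r P l u \<omega> h" and "0 \<le> s" and "i \<notin> {l..<u}"
  shows "h s i = h 0 i"
  using assms(3) by (intro monotone_path_constant[OF assms(1) order.refl assms(2)]) simp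

text \<open>If two columns are level just before an attempted jump, then the path in the larger volume has
  the larger rate, so it jumps whenever the other one does.\<close>

lemma monotone_path_attractive:
  assumes h: "monotone_path r P l u \<omega> h" and k: "monotone_path r P l' u' \<omega> k"
    and "mono r" and sub: "l' \<le> l" "u \<le> u'" and "0 \<le> t"
  shows "\<forall>i. h t i \<le> k t i"
proof (rule real_interval_induct[OF \<open>0 \<le> t\<close>, of "\<lambda>s. \<forall>i. h s i \<le> k s i"])
  show "\<forall>i. h 0 i \<le> k 0 i"
    using monotone_path_initial[OF h] monotone_path_initial[OF k] by simp
next
  fix s :: real assume s: "0 \<le> s" and le: "\<forall>i. h s i \<le> k s i"
  \<comment> \<open>Eventualities combine over finitely many columns only. Outside
    \<open>{l..<u}\<close> the smaller path is frozen and the other one does not decrease.\<close>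
  have "\<forall>\<^sub>F x in at_right s. \<forall>i\<in>{l..<u}. h x i \<le> k x i"
  proof (rule eventually_ball_finite)
    show "\<forall>i\<in>{l..<u}. \<forall>\<^sub>F x in at_right s. h x i \<le> k x i"
    proof
      fix i
      show "\<forall>\<^sub>F x in at_right s. h x i \<le> k x i"
        using monotone_path_right[OF h s, of i] monotone_path_right[OF k s, of i]
        by eventually_elim (simp add: le)
    qed
  qed simp
  moreover have "\<forall>\<^sub>F x in at_right s. s < x"
    by (simp add: eventually_at_right_less)
  ultimately show "\<forall>\<^sub>F x in at_right s. \<forall>i. h x i \<le> k x i"
  proof eventually_elim
    case (elim x)
    show ?case
    proof
      fix i
      have "h x i \<le> k x i" if "i \<notin> {l..<u}"
        using monotone_path_frozen[OF h _ that, of x] monotone_path_mono[OF k, of 0 x i] elim(2) s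
          monotone_path_initial[OF h] monotone_path_initial[OF k] by simp
      then show "h x i \<le> k x i"
        using elim(1) by blast
    qed
  qed
next
  fix s :: real assume s: "0 < s" and le: "\<And>x. 0 \<le> x \<Longrightarrow> x < s \<Longrightarrow> \<forall>i. h x i \<le> k x i"
  obtain g where g: "\<And>i. \<forall>\<^sub>F x in at_left s. h x i = g i"
    and hs: "\<And>i. h s i = (if l \<le> i \<and> i < u \<and> (\<exists>y. (s, y) \<in> P i \<and> 0 < y \<and> y < volume_rate r i g)
                       then g i + 1 else g i)"
    by (rule monotone_path_left[OF h s]) (rule that)
  obtain g' where g': "\<And>i. \<forall>\<^sub>F x in at_left s. k x i = g' i"
    and ks: "\<And>i. k s i = (if l' \<le> i \<and> i < u' \<and> (\<exists>y. (s, y) \<in> P i \<and> 0 < y \<and> y < volume_rate r i g')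
                       then g' i + 1 else g' i)"
    by (rule monotone_path_left[OF k s]) (rule that)
  have gg': "g i \<le> g' i" for i
  proof -
    have "\<forall>\<^sub>F x in at_left s. h x i = g i \<and> k x i = g' i"
      using g g' by (rule eventually_conj)
    from eventually_at_left_point[OF this s] obtain x where "0 \<le> x" "x < s" "h x i = g i" "k x i = g' i"
      by blast
    then show ?thesis
      using le[of x] by metis
  qed
  show "\<forall>i. h s i \<le> k s i"
  proof
    fix i
    show "h s i \<le> k s i"
    proof (cases "g i < g' i")
      case True
      then show ?thesis
        unfolding hs[of i] ks[of i] by simp
    next
      case False
      then have "g i = g' i"
        using gg'[of i] by simp
      then have "increments g i \<le> increments g' i" "- increments g (i + 1) \<le> - increments g' (i + 1)"
        using gg'[of "i - 1"] gg'[of "i + 1"] by (simp_all add: increments_def)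
      then have "volume_rate r i g \<le> volume_rate r i g'"
        unfolding volume_rate_def using \<open>mono r\<close> by (intro add_mono) (simp_all add: mono_def)
      then show ?thesis
        unfolding hs[of i] ks[of i] using \<open>g i = g' i\<close> sub by (auto dest: less_le_trans)
    qed
  qed
qed

text \<open>While heights are at most \<open>m\<close> above the start, the rates are those of
  \<open>\<rho>\<close> and at most \<open>C\<close>, so only points below level \<open>C\<close>
  matter. If the slab has at most one such point over all bonds, nothing moves before it: it meets
  the rates of time \<open>a\<close>, and it fires iff it lies below
  \<open>volume_rate \<rho> i (h a)\<close>.\<close>

lemma monotone_path_slab:
  assumes mp: "monotone_path r P l u \<omega> h" and ab: "0 \<le> a" "a \<le> b" "b \<le> T"
    and cap: "\<And>i. h T i \<le> h 0 i + int m"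
    and rate: "\<And>g i. (\<And>j. h 0 j \<le> g j \<and> g j \<le> h 0 j + int m) \<Longrightarrow> i \<in> {l..<u} \<Longrightarrow>
      volume_rate r i g = volume_rate \<rho> i g \<and> volume_rate \<rho> i g \<le> C"
    and unique: "\<And>i j s s' y y'. i \<in> {l..<u} \<Longrightarrow> j \<in> {l..<u} \<Longrightarrow>
      (s, y) \<in> P i \<inter> {a<..b} \<times> {0<..<C} \<Longrightarrow> (s', y') \<in> P j \<inter> {a<..b} \<times> {0<..<C} \<Longrightarrow>
      i = j \<and> s = s' \<and> y = y'"
  shows "\<And>i. i \<in> {l..<u} \<Longrightarrow> P i \<inter> {a<..b} \<times> {0<..<volume_rate \<rho> i (h a)} \<noteq> {} \<Longrightarrow> h b = lift i (h a)"
    and "(\<And>i. i \<in> {l..<u} \<Longrightarrow> P i \<inter> {a<..b} \<times> {0<..<volume_rate \<rho> i (h a)} = {}) \<Longrightarrow> h b = h a"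
proof -
  have range: "h 0 j \<le> h s j \<and> h s j \<le> h 0 j + int m" if "0 \<le> s" "s \<le> T" for s j
    using monotone_path_mono[OF mp order.refl that(1), of j] monotone_path_mono[OF mp that, of j] cap[of j]
    by simp
  \<comment> \<open>Left limits are values taken shortly before, so they obey the same cap.\<close>
  have range_left: "h 0 j \<le> g j \<and> g j \<le> h 0 j + int m"
    if s: "0 < s" "s \<le> T" and g: "\<And>j. \<forall>\<^sub>F x in at_left s. h x j = g j" for g s j
  proof -
    obtain x where "0 \<le> x" "x < s" "h x j = g j"
      using eventually_at_left_point[OF g s(1)] by blast
    then show ?thesis
      using range[of x j] s(2) by simp
  qed
  have rate_left: "volume_rate r i g = volume_rate \<rho> i g \<and> volume_rate \<rho> i g \<le> C"
    if "0 < s" "s \<le> T" "\<And>j. \<forall>\<^sub>F x in at_left s. h x j = g j" "i \<in> {l..<u}" for s g i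
    by (rule rate[OF range_left[OF that(1-3)] that(4)])
  have quiet: "h b' = h a'" if ab': "a \<le> a'" "a' \<le> b'" "b' \<le> b"
    and empty: "\<And>i. i \<in> {l..<u} \<Longrightarrow> P i \<inter> {a'<..b'} \<times> {0<..<C} = {}" for a' b'
  proof
    fix i
    show "h b' i = h a' i"
    proof (rule monotone_path_constant[OF mp])
      fix s g assume s: "a' < s" "s \<le> b'" and g: "\<And>j. \<forall>\<^sub>F x in at_left s. h x j = g j"
        and i: "l \<le> i" "i < u"
      have "volume_rate r i g \<le> C"
        using rate_left[OF _ _ g, of i] s i ab' ab by simp
      then show "\<not> (\<exists>y. (s, y) \<in> P i \<and> 0 < y \<and> y < volume_rate r i g)"
        using empty[of i] s i by (auto simp: disjoint_iff dest: less_le_trans)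
    qed (use ab' ab in simp_all)
  qed
  have rate_a: "volume_rate \<rho> i (h a) \<le> C" if "i \<in> {l..<u}" for i
    using rate[of "h a" i] range[of a] ab that by simp
  have single: "h b = (if y < volume_rate \<rho> i (h a) then lift i (h a) else h a)"
    if i: "i \<in> {l..<u}" and sy: "(s, y) \<in> P i \<inter> {a<..b} \<times> {0<..<C}" for i s y
  proof -
    have s: "a < s" "s \<le> b" "0 < s"
      using sy ab by auto
    obtain g where g: "\<And>i. \<forall>\<^sub>F x in at_left s. h x i = g i"
      and hs: "\<And>i. h s i = (if l \<le> i \<and> i < u \<and> (\<exists>y. (s, y) \<in> P i \<and> 0 < y \<and> y < volume_rate r i g)
                         then g i + 1 else g i)"
      by (rule monotone_path_left[OF mp s(3)]) (rule that)
    have "g j = h a j" for j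
    proof -
      obtain x where x: "a \<le> x" "x < s" "h x j = g j"
        using eventually_at_left_point[OF g s(1)] by blast
      have "h x = h a"
      proof (rule quiet)
        fix k assume k: "k \<in> {l..<u}"
        have False if "(s', y') \<in> P k \<inter> {a<..x} \<times> {0<..<C}" for s' y'
          using unique[OF i k sy, of s' y'] x s that by simp
        then show "P k \<inter> {a<..x} \<times> {0<..<C} = {}"
          by (metis ex_in_conv surj_pair)
      qed (use x s in simp_all)
      then show ?thesis
        using x by simp
    qed
    then have g_eq: "g = h a"
      by auto
    have rate_g: "volume_rate r j g = volume_rate \<rho> j (h a) \<and> volume_rate \<rho> j (h a) \<le> C" if "j \<in> {l..<u}" for j
      using rate_left[OF _ _ g that] s ab by (simp add: g_eq)
    have fires: "(\<exists>y. (s, y) \<in> P i \<and> 0 < y \<and> y < volume_rate r i g) \<longleftrightarrow> y < volume_rate \<rho> i (h a)"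
    proof
      assume "\<exists>y. (s, y) \<in> P i \<and> 0 < y \<and> y < volume_rate r i g"
      then obtain y' where y': "(s, y') \<in> P i" "0 < y'" "y' < volume_rate \<rho> i (h a)"
        using rate_g[OF i] by auto
      then have "y = y'"
        using unique[OF i i sy, of s y'] rate_g[OF i] s by simp
      with y' show "y < volume_rate \<rho> i (h a)"
        by simp
    next
      assume "y < volume_rate \<rho> i (h a)"
      then show "\<exists>y. (s, y) \<in> P i \<and> 0 < y \<and> y < volume_rate r i g"
        using sy rate_g[OF i] by auto
    qed
    have silent: "\<not> (\<exists>y. (s, y) \<in> P j \<and> 0 < y \<and> y < volume_rate r j g)" if j: "j \<in> {l..<u}" "j \<noteq> i" for j
    proof
      assume "\<exists>y. (s, y) \<in> P j \<and> 0 < y \<and> y < volume_rate r j g"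
      then obtain y' where "(s, y') \<in> P j" "0 < y'" "y' < volume_rate \<rho> j (h a)"
        using rate_g[OF j(1)] by auto
      then show False
        using unique[OF i j(1) sy, of s y'] rate_g[OF j(1)] s j(2) by simp
    qed
    have "h s j = (if y < volume_rate \<rho> i (h a) then lift i (h a) else h a) j" for j
    proof (cases "j = i")
      case True
      then show ?thesis
        using i hs[of i] by (simp add: fires) (simp add: g_eq lift_def)
    next
      case False
      then have "h s j = g j"
        using silent[of j] hs[of j] by auto
      then show ?thesis
        using False by (simp add: g_eq lift_def)
    qed
    moreover have "h b = h s"
    proof (rule quiet)
      fix k assume k: "k \<in> {l..<u}"
      have False if "(s', y') \<in> P k \<inter> {s<..b} \<times> {0<..<C}" for s' y'
        using unique[OF i k sy, of s' y'] s that by simp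
      then show "P k \<inter> {s<..b} \<times> {0<..<C} = {}"
        by (metis ex_in_conv surj_pair)
    qed (use s in simp_all)
    ultimately show ?thesis
      by auto
  qed
  show "h b = lift i (h a)" if i: "i \<in> {l..<u}" and ne: "P i \<inter> {a<..b} \<times> {0<..<volume_rate \<rho> i (h a)} \<noteq> {}" for i
  proof -
    obtain s y where "(s, y) \<in> P i" "a < s" "s \<le> b" "0 < y" "y < volume_rate \<rho> i (h a)"
      using ne by auto
    then show ?thesis
      using single[OF i, of s y] rate_a[OF i] by simp
  qed
  show "h b = h a" if none: "\<And>i. i \<in> {l..<u} \<Longrightarrow> P i \<inter> {a<..b} \<times> {0<..<volume_rate \<rho> i (h a)} = {}"
  proof (cases "\<exists>i\<in>{l..<u}. P i \<inter> {a<..b} \<times> {0<..<C} \<noteq> {}")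
    case True
    then obtain i s y where i: "i \<in> {l..<u}" and sy: "(s, y) \<in> P i \<inter> {a<..b} \<times> {0<..<C}"
      by (metis ex_in_conv surj_pair)
    then have "\<not> y < volume_rate \<rho> i (h a)"
      using none[OF i] by auto
    then show ?thesis
      using single[OF i sy] by simp
  next
    case False
    then show ?thesis
      by (intro quiet) (use ab in auto)
  qed
qed

section \<open>Itineraries: the moves recorded slab by slab\<close>

fun move :: "int option \<Rightarrow> (int \<Rightarrow> int) \<Rightarrow> int \<Rightarrow> int" where
  "move None h = h"
| "move (Some i) h = lift i h"

text \<open>For \<open>Some i\<close> nothing is said about the other bonds, so events of different
  moves overlap. That suffices: the paths have to be covered by events of controlled probability,
  not partitioned.\<close>

definition slab_event ::
  "(int \<Rightarrow> (real \<times> real) set) \<Rightarrow> (int \<Rightarrow> real) \<Rightarrow> int set \<Rightarrow> (int \<Rightarrow> int) \<Rightarrow> real set \<Rightarrow> int option \<Rightarrow> bool" where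
  "slab_event P \<rho> I h S s = (case s of
      None \<Rightarrow> \<forall>i\<in>I. P i \<inter> S \<times> {0<..<volume_rate \<rho> i h} = {}
    | Some i \<Rightarrow> P i \<inter> S \<times> {0<..<volume_rate \<rho> i h} \<noteq> {})"

text \<open>The heights in slab \<open>k\<close> are computed from the list and not from the path.
  For a fixed list all rectangles are therefore deterministic, and independence of Poisson counts
  applies without any conditioning.\<close>

definition itinerary_event ::
  "(int \<Rightarrow> (real \<times> real) set) \<Rightarrow> (int \<Rightarrow> real) \<Rightarrow> int set \<Rightarrow> (int \<Rightarrow> int) \<Rightarrow> real \<Rightarrow> int option list \<Rightarrow> bool" where
  "itinerary_event P \<rho> I h d \<sigma> \<longleftrightarrow>
     (\<forall>k<length \<sigma>. slab_event P \<rho> I (fold move (take k \<sigma>) h) {real k * d<..real (Suc k) * d} (\<sigma> ! k))"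

lemma monotone_path_itinerary:
  assumes mp: "monotone_path r P l u \<omega> h" and d: "0 \<le> d"
    and cap: "\<And>i. h (real n * d) i \<le> h 0 i + int m"
    and rate: "\<And>g i. (\<And>j. h 0 j \<le> g j \<and> g j \<le> h 0 j + int m) \<Longrightarrow> i \<in> {l..<u} \<Longrightarrow>
      volume_rate r i g = volume_rate \<rho> i g \<and> volume_rate \<rho> i g \<le> C"
    and unique: "\<And>k i j s s' y y'. k < n \<Longrightarrow> i \<in> {l..<u} \<Longrightarrow> j \<in> {l..<u} \<Longrightarrow>
      (s, y) \<in> P i \<inter> {real k * d<..real (Suc k) * d} \<times> {0<..<C} \<Longrightarrow>
      (s', y') \<in> P j \<inter> {real k * d<..real (Suc k) * d} \<times> {0<..<C} \<Longrightarrow>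
      i = j \<and> s = s' \<and> y = y'"
  shows "\<exists>\<sigma>. length \<sigma> = n \<and> set \<sigma> \<subseteq> insert None (Some ` {l..<u}) \<and>
    itinerary_event P \<rho> {l..<u} (h 0) d \<sigma> \<and> h (real n * d) = fold move \<sigma> (h 0)"
proof -
  have "\<exists>\<sigma>. length \<sigma> = k \<and> set \<sigma> \<subseteq> insert None (Some ` {l..<u}) \<and>
    itinerary_event P \<rho> {l..<u} (h 0) d \<sigma> \<and> h (real k * d) = fold move \<sigma> (h 0)" if "k \<le> n" for k
    using that
  proof (induction k)
    case 0
    then show ?case
      by (simp add: itinerary_event_def)
  next
    case (Suc k)
    then obtain \<sigma> where \<sigma>: "length \<sigma> = k" "set \<sigma> \<subseteq> insert None (Some ` {l..<u})"
      "itinerary_event P \<rho> {l..<u} (h 0) d \<sigma>" "h (real k * d) = fold move \<sigma> (h 0)"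
      by auto
    let ?S = "{real k * d<..real (Suc k) * d}"
    have kd: "0 \<le> real k * d" "real k * d \<le> real (Suc k) * d" "real (Suc k) * d \<le> real n * d"
      using d Suc.prems by (auto intro!: mult_right_mono simp del: of_nat_Suc)
    have k: "k < n"
      using Suc.prems by simp
    note slab = monotone_path_slab[OF mp kd cap rate unique[OF k]]
    obtain s where s: "s \<in> insert None (Some ` {l..<u})"
      "slab_event P \<rho> {l..<u} (h (real k * d)) ?S s"
      "h (real (Suc k) * d) = move s (h (real k * d))"
    proof (cases "\<exists>i\<in>{l..<u}. P i \<inter> ?S \<times> {0<..<volume_rate \<rho> i (h (real k * d))} \<noteq> {}")
      case True
      then obtain i where i: "i \<in> {l..<u}" "P i \<inter> ?S \<times> {0<..<volume_rate \<rho> i (h (real k * d))} \<noteq> {}"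
        by blast
      then have "h (real (Suc k) * d) = lift i (h (real k * d))"
        by (intro slab(1))
      then show ?thesis
        using i by (intro that[of "Some i"]) (simp_all add: slab_event_def)
    next
      case False
      then have "h (real (Suc k) * d) = h (real k * d)"
        by (intro slab(2)) simp_all
      then show ?thesis
        using False by (intro that[of None]) (simp_all add: slab_event_def)
    qed
    have "itinerary_event P \<rho> {l..<u} (h 0) d (\<sigma> @ [s])"
      unfolding itinerary_event_def
    proof (intro allI impI)
      fix j assume "j < length (\<sigma> @ [s])"
      then consider "j < k" | "j = k"
        using \<sigma>(1) by fastforce
      then show "slab_event P \<rho> {l..<u} (fold move (take j (\<sigma> @ [s])) (h 0)) {real j * d<..real (Suc j) * d} ((\<sigma> @ [s]) ! j)"
        by cases (use \<sigma> s(2) in \<open>simp_all add: itinerary_event_def nth_append\<close>)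
    qed
    then show ?case
      using \<sigma> s by (intro exI[of _ "\<sigma> @ [s]"]) simp
  qed
  then show ?thesis
    by blast
qed

section \<open>Itineraries of the Poisson driven process\<close>

lemma quadrant_strip:
  assumes "0 \<le> a" "a \<le> b" "0 \<le> c"
  shows "{a<..b} \<times> {0<..<c} \<in> sets quadrant"
    and "emeasure quadrant ({a<..b} \<times> {0<..<c}) = ennreal ((b - a) * c)"
    and "measure quadrant ({a<..b} \<times> {0<..<c}) = (b - a) * c"
proof -
  let ?Q = "{0..} \<times> {0..} :: (real \<times> real) set" and ?A = "{a<..b} \<times> {0<..<c}"
  have sets: "?Q \<in> sets lborel" "?A \<in> sets lborel"
    unfolding lborel_prod[symmetric] by (intro pair_measureI; simp)+
  have sub: "?A \<subseteq> ?Q"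
    using assms by auto
  show "?A \<in> sets quadrant"
    using sets sub by (simp add: quadrant_def sets_restrict_space_iff)
  have "emeasure quadrant ?A = emeasure lborel ?A"
    using sets sub by (simp add: quadrant_def emeasure_restrict_space)
  also have "\<dots> = emeasure lborel {a<..b} * emeasure lborel {0<..<c}"
    unfolding lborel_prod[symmetric] by (rule lborel.emeasure_pair_measure_Times) simp_all
  also have "\<dots> = ennreal ((b - a) * c)"
    using assms by (simp add: ennreal_mult)
  finally show *: "emeasure quadrant ?A = ennreal ((b - a) * c)" .
  show "measure quadrant ?A = (b - a) * c"
    using assms by (simp add: measure_def *)
qed

lemma point_count_eq_0_iff: "point_count X A w = 0 \<longleftrightarrow> X w \<inter> A = {}"
  by (simp add: point_count_def emeasure_count_space_eq_0)

lemma point_count_eq_1_unique: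
  assumes "point_count X A w = 1" "p \<in> X w \<inter> A" "q \<in> X w \<inter> A"
  shows "p = q"
proof (rule ccontr)
  assume "p \<noteq> q"
  then have "(2 :: ennreal) = emeasure (count_space UNIV) {p, q}"
    by simp
  also have "\<dots> \<le> emeasure (count_space UNIV) (X w \<inter> A)"
    using assms(2,3) by (intro emeasure_mono) auto
  finally show False
    using assms(1) by (simp add: point_count_def)
qed

locale driven =
  fixes M :: "'w measure" and N :: "int \<Rightarrow> 'w \<Rightarrow> (real \<times> real) set"
  assumes noise: "driving_noise M N"
begin

sublocale prob_space M
  using noise by (simp add: driving_noise_def)

lemma poisson: "poisson_point_process M quadrant (N i)"
  using noise by (simp add: driving_noise_def)

lemma count_measurable [measurable]:
  "A \<in> sets quadrant \<Longrightarrow> point_count (N i) A \<in> borel_measurable M"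
  using poisson[of i] unfolding poisson_point_process_def by blast

lemma count_prob:
  assumes "0 \<le> a" "a \<le> b" "0 \<le> c"
  defines "A \<equiv> {a<..b} \<times> {0<..<c}" and "x \<equiv> (b - a) * c"
  shows "prob {w \<in> space M. point_count (N i) A w = 0} = exp (- x)"
    and "prob {w \<in> space M. point_count (N i) A w \<noteq> 0} = 1 - exp (- x)"
    and "prob {w \<in> space M. point_count (N i) A w \<noteq> 0 \<and> point_count (N i) A w \<noteq> 1} \<le> x\<^sup>2"
proof -
  note strip = quadrant_strip[OF assms(1-3), folded A_def x_def]
  note [measurable] = strip(1)
  have pmf: "prob {w \<in> space M. point_count (N i) A w = of_nat k} = x ^ k / fact k * exp (- x)" for k
  proof -
    have "\<forall>A\<in>sets quadrant. emeasure quadrant A < \<infinity> \<longrightarrow>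
        (\<forall>k::nat. prob {w \<in> space M. point_count (N i) A w = of_nat k}
                  = measure quadrant A ^ k / fact k * exp (- measure quadrant A))"
      using poisson[of i] unfolding poisson_point_process_def by blast
    with strip show ?thesis
      by simp
  qed
  show zero: "prob {w \<in> space M. point_count (N i) A w = 0} = exp (- x)"
    using pmf[of 0] by simp
  have "prob {w \<in> space M. \<not> point_count (N i) A w = 0} = 1 - prob {w \<in> space M. point_count (N i) A w = 0}"
    by (rule prob_neg) measurable
  with zero show ne: "prob {w \<in> space M. point_count (N i) A w \<noteq> 0} = 1 - exp (- x)"
    by simp
  have "{w \<in> space M. point_count (N i) A w \<noteq> 0 \<and> point_count (N i) A w \<noteq> 1}
      = {w \<in> space M. point_count (N i) A w \<noteq> 0} - {w \<in> space M. point_count (N i) A w = 1}"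
    by auto
  also have "prob \<dots> = prob {w \<in> space M. point_count (N i) A w \<noteq> 0} - prob {w \<in> space M. point_count (N i) A w = 1}"
    by (rule finite_measure_Diff) auto
  also have "\<dots> = 1 - (1 + x) * exp (- x)"
    using pmf[of 1] by (simp add: ne algebra_simps)
  also have "\<dots> \<le> 1 - (1 + x) * (1 - x)"
    using exp_ge_add_one_self[of "- x"] assms(1-3) by (intro diff_left_mono mult_left_mono) (simp_all add: x_def)
  finally show "prob {w \<in> space M. point_count (N i) A w \<noteq> 0 \<and> point_count (N i) A w \<noteq> 1} \<le> x\<^sup>2"
    by (simp add: power2_eq_square algebra_simps)
qed

text \<open>Independence is used twice: across bonds for the whole families of counts, and within a
  bond for disjoint sets.\<close>

lemma count_independent:
  fixes A :: "int \<Rightarrow> nat \<Rightarrow> (real \<times> real) set" and B :: "int \<Rightarrow> nat \<Rightarrow> ennreal set"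
  assumes I: "finite I" "I \<noteq> {}" and n: "0 < n"
    and A: "\<And>i k. i \<in> I \<Longrightarrow> k < n \<Longrightarrow> A i k \<in> sets quadrant"
    and disj: "\<And>i. i \<in> I \<Longrightarrow> disjoint_family_on (A i) {..<n}"
    and B: "\<And>i k. B i k \<in> sets borel"
  shows "prob {w \<in> space M. \<forall>i\<in>I. \<forall>k<n. point_count (N i) (A i k) w \<in> B i k}
      = (\<Prod>i\<in>I. \<Prod>k<n. prob {w \<in> space M. point_count (N i) (A i k) w \<in> B i k})"
proof -
  let ?X = "\<lambda>i w. \<lambda>S\<in>sets quadrant. point_count (N i) S w"
  let ?P = "PiM (sets quadrant) (\<lambda>_. borel :: ennreal measure)"
  define E where "E i = {f \<in> space ?P. \<forall>k<n. f (A i k) \<in> B i k}" for i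
  have E: "E i \<in> sets ?P" if "i \<in> I" for i
  proof -
    have "E i = (\<Inter>k\<in>{..<n}. {f \<in> space ?P. f (A i k) \<in> B i k})"
      using n by (auto simp: E_def)
    also have "\<dots> \<in> sets ?P"
    proof (rule sets.finite_INT)
      fix k assume "k \<in> {..<n}"
      then have "(\<lambda>f. f (A i k)) \<in> ?P \<rightarrow>\<^sub>M borel"
        using A that by (intro measurable_component_singleton) auto
      from measurable_sets[OF this B[of i k]] show "{f \<in> space ?P. f (A i k) \<in> B i k} \<in> sets ?P"
        by (simp add: vimage_def Int_def conj_commute)
    qed (use n in auto)
    finally show ?thesis .
  qed
  have indep: "indep_vars (\<lambda>_. ?P) ?X UNIV"
    using noise by (simp add: driving_noise_def)
  have pre: "?X i -` E i \<inter> space M = {w \<in> space M. \<forall>k<n. point_count (N i) (A i k) w \<in> B i k}" if "i \<in> I" for i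
    using A[OF that] by (auto simp: E_def space_PiM)
  have "{w \<in> space M. \<forall>i\<in>I. \<forall>k<n. point_count (N i) (A i k) w \<in> B i k} = (\<Inter>i\<in>I. ?X i -` E i \<inter> space M)"
    using I pre by auto
  also have "prob \<dots> = (\<Prod>i\<in>I. prob (?X i -` E i \<inter> space M))"
    using I E by (intro indep_varsD[OF indep]) auto
  also have "\<dots> = (\<Prod>i\<in>I. \<Prod>k<n. prob {w \<in> space M. point_count (N i) (A i k) w \<in> B i k})"
  proof (rule prod.cong[OF refl])
    fix i assume i: "i \<in> I"
    have "\<forall>(J::nat set) A. finite J \<and> A ` J \<subseteq> sets quadrant \<and> disjoint_family_on A J \<longrightarrow>
        indep_vars (\<lambda>_. borel) (\<lambda>k. point_count (N i) (A k)) J"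
      using poisson[of i] unfolding poisson_point_process_def by blast
    then have "indep_vars (\<lambda>_. borel) (\<lambda>k. point_count (N i) (A i k)) {..<n}"
      using A[OF i] disj[OF i] by blast
    then have "prob (\<Inter>k\<in>{..<n}. point_count (N i) (A i k) -` B i k \<inter> space M)
        = (\<Prod>k<n. prob (point_count (N i) (A i k) -` B i k \<inter> space M))"
      using n B by (intro indep_varsD_finite) auto
    moreover have "?X i -` E i \<inter> space M = (\<Inter>k\<in>{..<n}. point_count (N i) (A i k) -` B i k \<inter> space M)"
      unfolding pre[OF i] using n by auto
    ultimately show "prob (?X i -` E i \<inter> space M) = (\<Prod>k<n. prob {w \<in> space M. point_count (N i) (A i k) w \<in> B i k})"
      by (simp add: vimage_def Int_def conj_commute)
  qed
  finally show ?thesis .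
qed

section \<open>Slabs with more than one point\<close>

definition crowded :: "int set \<Rightarrow> nat \<Rightarrow> real \<Rightarrow> real \<Rightarrow> 'w set" where
  "crowded I n d C = {w \<in> space M. \<exists>k<n. \<exists>i\<in>I. let A = {real k * d<..real (Suc k) * d} \<times> {0<..<C} in
     point_count (N i) A w \<noteq> 0 \<and> (point_count (N i) A w \<noteq> 1 \<or> (\<exists>j\<in>I - {i}. point_count (N j) A w \<noteq> 0))}"

text \<open>A union bound over slabs, bonds and pairs of bonds; each single event has probability at
  most \<open>(d * C)\<^sup>2\<close>, so for \<open>d = T / n\<close> the total is of order
  \<open>1 / n\<close>.\<close>

lemma crowded_prob:
  fixes d C :: real
  assumes I: "finite I" and d: "0 \<le> d" "0 \<le> C"
  shows "crowded I n d C \<in> sets M" "prob (crowded I n d C) \<le> n * ((card I + card I * card I) * (d * C)\<^sup>2)"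
proof -
  define A where "A k = {real k * d<..real (Suc k) * d} \<times> {0<..<C}" for k
  have kd: "0 \<le> real k * d" "real k * d \<le> real (Suc k) * d" "real (Suc k) * d - real k * d = d" for k
    using d by (auto simp: algebra_simps)
  have A [measurable]: "A k \<in> sets quadrant" for k
    unfolding A_def by (rule quadrant_strip) (use kd d in auto)
  define X where "X i k = {w \<in> space M. point_count (N i) (A k) w \<noteq> 0 \<and> point_count (N i) (A k) w \<noteq> 1}" for i k
  define Y where "Y i j k = {w \<in> space M. point_count (N i) (A k) w \<noteq> 0 \<and> point_count (N j) (A k) w \<noteq> 0}" for i j k
  have [measurable]: "X i k \<in> sets M" "Y i j k \<in> sets M" for i j k
    unfolding X_def Y_def by measurable
  have eq: "crowded I n d C = (\<Union>k\<in>{..<n}. (\<Union>i\<in>I. X i k) \<union> (\<Union>i\<in>I. \<Union>j\<in>I - {i}. Y i j k))"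
    by (auto simp: crowded_def Let_def X_def Y_def A_def)
  show "crowded I n d C \<in> sets M"
    unfolding eq using I by measurable
  have X: "prob (X i k) \<le> (d * C)\<^sup>2" for i k
    unfolding X_def A_def using count_prob(3)[OF kd(1,2) d(2), of i k] by (simp only: kd(3))
  have Y: "prob (Y i j k) \<le> (d * C)\<^sup>2" if "i \<noteq> j" for i j k
  proof -
    have "Y i j k = {w \<in> space M. \<forall>i\<in>{i, j}. \<forall>m<Suc 0. point_count (N i) (A k) w \<in> - {0}}"
      by (auto simp: Y_def)
    also have "prob \<dots> = (\<Prod>i\<in>{i, j}. \<Prod>m<Suc 0. prob {w \<in> space M. point_count (N i) (A k) w \<in> - {0}})"
      by (rule count_independent) (auto simp: disjoint_family_on_def)
    also have "\<dots> = (1 - exp (- (d * C))) * (1 - exp (- (d * C)))"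
      using that count_prob(2)[OF kd(1,2) d(2), of _ k] by (simp add: A_def kd(3) del: of_nat_Suc)
    also have "\<dots> \<le> (d * C) * (d * C)"
      using exp_ge_add_one_self[of "- (d * C)"] d by (intro mult_mono) auto
    finally show ?thesis
      by (simp add: power2_eq_square)
  qed
  have "prob (crowded I n d C) \<le> (\<Sum>k<n. prob ((\<Union>i\<in>I. X i k) \<union> (\<Union>i\<in>I. \<Union>j\<in>I - {i}. Y i j k)))"
    unfolding eq using I by (intro measure_UNION_le) auto
  also have "\<dots> \<le> (\<Sum>k<n. prob (\<Union>i\<in>I. X i k) + prob (\<Union>i\<in>I. \<Union>j\<in>I - {i}. Y i j k))"
    using I by (intro sum_mono measure_Un_le) auto
  also have "\<dots> \<le> (\<Sum>k<n. (\<Sum>i\<in>I. prob (X i k)) + (\<Sum>i\<in>I. prob (\<Union>j\<in>I - {i}. Y i j k)))"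
    using I by (intro sum_mono add_mono measure_UNION_le) auto
  also have "\<dots> \<le> (\<Sum>k<n. (\<Sum>i\<in>I. prob (X i k)) + (\<Sum>i\<in>I. \<Sum>j\<in>I - {i}. prob (Y i j k)))"
    using I by (intro sum_mono add_left_mono measure_UNION_le) auto
  also have "\<dots> \<le> (\<Sum>k<n. (\<Sum>i\<in>I. (d * C)\<^sup>2) + (\<Sum>i\<in>I. \<Sum>j\<in>I - {i}. (d * C)\<^sup>2))"
    using X Y by (intro sum_mono add_mono) auto
  also have "\<dots> \<le> (\<Sum>k<n. (\<Sum>i\<in>I. (d * C)\<^sup>2) + (\<Sum>i\<in>I. \<Sum>j\<in>I. (d * C)\<^sup>2))"
    using I by (intro sum_mono add_left_mono sum_mono2) auto
  finally show "prob (crowded I n d C) \<le> n * ((card I + card I * card I) * (d * C)\<^sup>2)"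
    by (simp add: algebra_simps)
qed

end

text \<open>\<open>None\<close> has its exact Poisson probability, while \<open>Some i\<close> gets
  the upper bound \<open>x\<close> for \<open>1 - exp (- x)\<close>. The weights add up to at least
  1; compared with \<open>volume_step\<close> only the idle weight differs, by a term of second
  order.\<close>

fun step_weight :: "(int \<Rightarrow> real) \<Rightarrow> int set \<Rightarrow> real \<Rightarrow> int option \<Rightarrow> (int \<Rightarrow> int) \<Rightarrow> real" where
  "step_weight \<rho> I d None h = exp (- (d * (\<Sum>i\<in>I. volume_rate \<rho> i h)))"
| "step_weight \<rho> I d (Some i) h = d * volume_rate \<rho> i h"

fun itinerary_weight :: "(int \<Rightarrow> real) \<Rightarrow> int set \<Rightarrow> real \<Rightarrow> int option list \<Rightarrow> (int \<Rightarrow> int) \<Rightarrow> real" where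
  "itinerary_weight \<rho> I d [] h = 1"
| "itinerary_weight \<rho> I d (s # \<sigma>) h = step_weight \<rho> I d s h * itinerary_weight \<rho> I d \<sigma> (move s h)"

lemma itinerary_weight_prod:
  "itinerary_weight \<rho> I d \<sigma> h = (\<Prod>k<length \<sigma>. step_weight \<rho> I d (\<sigma> ! k) (fold move (take k \<sigma>) h))"
  by (induction \<sigma> arbitrary: h) (simp_all add: prod.lessThan_Suc_shift del: prod.lessThan_Suc)

text \<open>The error takes the form of a factor, because it has to be pulled out of
  \<open>n\<close> successive steps. The bound \<open>a \<le> 1 / 2\<close> keeps
  \<open>1 - s\<close> away from 0.\<close>

lemma exp_minus_le_quadratic:
  fixes s :: real
  assumes "0 \<le> s" "s \<le> a" "a \<le> 1 / 2"
  shows "exp (- s) \<le> (1 + a\<^sup>2) * (1 - s)"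
proof -
  have pos: "0 < 1 + s + s\<^sup>2 / 2"
    using assms by (intro add_pos_nonneg) auto
  have "exp (- s) = 1 / exp s"
    by (simp add: exp_minus field_simps)
  also have "\<dots> \<le> 1 / (1 + s + s\<^sup>2 / 2)"
    using exp_lower_Taylor_quadratic[OF assms(1)] pos by (intro divide_left_mono mult_pos_pos) auto
  also have "\<dots> \<le> 1 - s + s\<^sup>2 / 2"
  proof -
    have "1 \<le> (1 - s + s\<^sup>2 / 2) * (1 + s + s\<^sup>2 / 2)"
      using zero_le_power[OF assms(1), of 4] by (simp add: power2_eq_square power4_eq_xxxx algebra_simps)
    with pos show ?thesis
      by (simp add: pos_divide_le_eq)
  qed
  also have "s\<^sup>2 / 2 \<le> a\<^sup>2 * (1 - s)"
  proof -
    have "s\<^sup>2 * (1 / 2) \<le> a\<^sup>2 * (1 - s)"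
      using assms by (intro mult_mono power_mono) auto
    then show ?thesis
      by simp
  qed
  finally show ?thesis
    by (simp add: algebra_simps)
qed

text \<open>The first move is split off and the sum over it compared with one Euler step, at the
  price of a factor \<open>1 + a\<^sup>2\<close>. Enlarging terms by this factor needs nonnegative
  values, which the invariant \<open>Q\<close> provides.\<close>

lemma itinerary_sum_le:
  fixes \<rho> :: "int \<Rightarrow> real"
  assumes rate: "\<And>i h. 0 \<le> volume_rate \<rho> i h \<and> volume_rate \<rho> i h \<le> C" and d: "0 \<le> d"
    and a: "d * (C * card {l..<u}) = a" "a \<le> 1 / 2"
    and inv: "\<And>h i. Q h \<Longrightarrow> Q (lift i h)" and f: "\<And>h. Q h \<Longrightarrow> 0 \<le> f h" and "Q h"
  shows "(\<Sum>\<sigma>\<in>{\<sigma>. set \<sigma> \<subseteq> insert None (Some ` {l..<u}) \<and> length \<sigma> = n}.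
      itinerary_weight \<rho> {l..<u} d \<sigma> h * f (fold move \<sigma> h))
    \<le> (1 + a\<^sup>2) ^ n * (volume_step \<rho> d l u ^^ n) f h"
proof -
  let ?S = "insert None (Some ` {l..<u})" and ?V = "volume_step \<rho> d l u"
  let ?L = "\<lambda>n. {\<sigma>. set \<sigma> \<subseteq> ?S \<and> length \<sigma> = n}"
  have total: "0 \<le> d * (\<Sum>i\<in>{l..<u}. volume_rate \<rho> i h)" "d * (\<Sum>i\<in>{l..<u}. volume_rate \<rho> i h) \<le> a" for h
  proof -
    show "0 \<le> d * (\<Sum>i\<in>{l..<u}. volume_rate \<rho> i h)"
      using rate d by (intro mult_nonneg_nonneg sum_nonneg) auto
    have "(\<Sum>i\<in>{l..<u}. volume_rate \<rho> i h) \<le> C * card {l..<u}"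
      using sum_bounded_above[of "{l..<u}" "\<lambda>i. volume_rate \<rho> i h" C] rate by (simp add: mult.commute)
    then show "d * (\<Sum>i\<in>{l..<u}. volume_rate \<rho> i h) \<le> a"
      unfolding a(1)[symmetric] using d by (rule mult_left_mono)
  qed
  have V: "?V g h = (1 - d * (\<Sum>i\<in>{l..<u}. volume_rate \<rho> i h)) * g h + (\<Sum>i\<in>{l..<u}. d * volume_rate \<rho> i h * g (lift i h))" for g h
    by (simp add: volume_step_def euler_step_def right_diff_distrib sum_subtractf sum_distrib_left sum_distrib_right algebra_simps)
  have nonneg: "0 \<le> (?V ^^ n) f h" if "Q h" for n h
    using that
  proof (induction n arbitrary: h)
    case (Suc n)
    then show ?case
      using rate d total[of h] a(2) inv
      by (auto simp: V intro!: add_nonneg_nonneg mult_nonneg_nonneg sum_nonneg)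
  qed (use f in simp)
  show ?thesis
    using \<open>Q h\<close>
  proof (induction n arbitrary: h)
    case 0
    have "?L 0 = {[]}"
      by auto
    then show ?case
      by simp
  next
    case (Suc n)
    let ?g = "(?V ^^ n) f"
    let ?w = "itinerary_weight \<rho> {l..<u} d" and ?q = "\<lambda>s. step_weight \<rho> {l..<u} d s h"
    have Q_move: "Q (move s h)" for s
      using Suc.prems inv by (cases s) auto
    have q: "0 \<le> ?q s" for s
      using rate d by (cases s) auto
    have "(\<Sum>s\<in>?S. ?q s * ?g (move s h)) = ?q None * ?g h + (\<Sum>i\<in>{l..<u}. d * volume_rate \<rho> i h * ?g (lift i h))"
      by (subst sum.insert) (auto simp: sum.reindex)
    also have "\<dots> \<le> (1 + a\<^sup>2) * (1 - d * (\<Sum>i\<in>{l..<u}. volume_rate \<rho> i h)) * ?g h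
        + (1 + a\<^sup>2) * (\<Sum>i\<in>{l..<u}. d * volume_rate \<rho> i h * ?g (lift i h))"
    proof (intro add_mono mult_right_mono)
      show "?q None \<le> (1 + a\<^sup>2) * (1 - d * (\<Sum>i\<in>{l..<u}. volume_rate \<rho> i h))"
        using exp_minus_le_quadratic[OF total a(2)] by simp
      have "0 \<le> (\<Sum>i\<in>{l..<u}. d * volume_rate \<rho> i h * ?g (lift i h))"
        using rate d nonneg inv[OF Suc.prems] by (intro sum_nonneg mult_nonneg_nonneg) auto
      then show "(\<Sum>i\<in>{l..<u}. d * volume_rate \<rho> i h * ?g (lift i h))
          \<le> (1 + a\<^sup>2) * (\<Sum>i\<in>{l..<u}. d * volume_rate \<rho> i h * ?g (lift i h))"
        by (simp add: mult_le_cancel_right1)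
    qed (use nonneg Suc.prems in auto)
    also have "\<dots> = (1 + a\<^sup>2) * ?V ?g h"
      by (simp add: V algebra_simps)
    finally have step: "(\<Sum>s\<in>?S. ?q s * ?g (move s h)) \<le> (1 + a\<^sup>2) * ?V ?g h" .
    have "(\<Sum>\<sigma>\<in>?L (Suc n). ?w \<sigma> h * f (fold move \<sigma> h))
        = (\<Sum>(\<sigma>, s)\<in>?L n \<times> ?S. ?w (s # \<sigma>) h * f (fold move (s # \<sigma>) h))"
      unfolding lists_length_Suc_eq by (subst sum.reindex) (auto simp: inj_on_def case_prod_unfold)
    also have "\<dots> = (\<Sum>\<sigma>\<in>?L n. \<Sum>s\<in>?S. ?q s * (?w \<sigma> (move s h) * f (fold move \<sigma> (move s h))))"
      unfolding sum.cartesian_product by (rule sum.cong) (auto simp: mult.assoc)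
    also have "\<dots> = (\<Sum>s\<in>?S. \<Sum>\<sigma>\<in>?L n. ?q s * (?w \<sigma> (move s h) * f (fold move \<sigma> (move s h))))"
      by (rule sum.swap)
    also have "\<dots> = (\<Sum>s\<in>?S. ?q s * (\<Sum>\<sigma>\<in>?L n. ?w \<sigma> (move s h) * f (fold move \<sigma> (move s h))))"
      by (simp add: sum_distrib_left)
    also have "\<dots> \<le> (\<Sum>s\<in>?S. ?q s * ((1 + a\<^sup>2) ^ n * ?g (move s h)))"
      using q Suc.IH[OF Q_move] by (intro sum_mono mult_left_mono) auto
    also have "\<dots> = (1 + a\<^sup>2) ^ n * (\<Sum>s\<in>?S. ?q s * ?g (move s h))"
      unfolding sum_distrib_left by (intro sum.cong refl mult.left_commute)
    also have "\<dots> \<le> (1 + a\<^sup>2) ^ n * ((1 + a\<^sup>2) * ?V ?g h)"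
      using step by (rule mult_left_mono) simp
    finally show ?case
      by (simp add: mult_ac)
  qed
qed

context driven
begin

text \<open>With the list fixed, the slabs give disjoint rectangles for each bond, so the
  probability factorizes over bonds and slabs; regrouped by slabs, each factor is at most its
  \<open>step_weight\<close>.\<close>

lemma itinerary_prob:
  fixes \<rho> :: "int \<Rightarrow> real"
  assumes rate: "\<And>i h. 0 \<le> volume_rate \<rho> i h" and d: "0 \<le> d" and I: "finite I" "I \<noteq> {}"
    and \<sigma>: "set \<sigma> \<subseteq> insert None (Some ` I)"
  shows "{w \<in> space M. itinerary_event (\<lambda>i. N i w) \<rho> I h d \<sigma>} \<in> sets M"
    and "prob {w \<in> space M. itinerary_event (\<lambda>i. N i w) \<rho> I h d \<sigma>} \<le> itinerary_weight \<rho> I d \<sigma> h"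
proof -
  define n where "n = length \<sigma>"
  define y where "y k = fold move (take k \<sigma>) h" for k
  define A where "A i k = {real k * d<..real (Suc k) * d} \<times> {0<..<volume_rate \<rho> i (y k)}" for i k
  define B :: "int \<Rightarrow> nat \<Rightarrow> ennreal set" where
    "B i k = (case \<sigma> ! k of None \<Rightarrow> {0} | Some j \<Rightarrow> if i = j then - {0} else UNIV)" for i k
  have kd: "0 \<le> real k * d" "real k * d \<le> real (Suc k) * d" "real (Suc k) * d - real k * d = d" for k
    using d by (auto simp: algebra_simps)
  have A: "A i k \<in> sets quadrant" for i k
    unfolding A_def by (rule quadrant_strip) (use kd rate in auto)
  have B: "B i k \<in> sets borel" for i k
    by (auto simp: B_def split: option.split)
  have in_I: "j \<in> I" if "\<sigma> ! k = Some j" "k < n" for j k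
    using \<sigma> nth_mem[of k \<sigma>] that by (auto simp: n_def)
  have slab: "slab_event (\<lambda>i. N i w) \<rho> I (y k) {real k * d<..real (Suc k) * d} (\<sigma> ! k)
      \<longleftrightarrow> (\<forall>i\<in>I. point_count (N i) (A i k) w \<in> B i k)" if "k < n" for w k
  proof (cases "\<sigma> ! k")
    case None
    then show ?thesis
      by (simp add: slab_event_def A_def B_def point_count_eq_0_iff)
  next
    case (Some j)
    then show ?thesis
      using in_I[OF Some that] by (auto simp: slab_event_def A_def B_def point_count_eq_0_iff)
  qed
  have eq: "{w \<in> space M. itinerary_event (\<lambda>i. N i w) \<rho> I h d \<sigma>}
      = {w \<in> space M. \<forall>i\<in>I. \<forall>k<n. point_count (N i) (A i k) w \<in> B i k}"
    using slab unfolding itinerary_event_def n_def[symmetric] y_def[symmetric] by auto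
  show "{w \<in> space M. itinerary_event (\<lambda>i. N i w) \<rho> I h d \<sigma>} \<in> sets M"
  proof -
    have "{w \<in> space M. point_count (N i) (A i k) w \<in> B i k} \<in> sets M" for i k
      using measurable_sets[OF count_measurable[OF A[of i k]] B[of i k], of i]
      by (simp add: vimage_def Int_def conj_commute)
    then show ?thesis
      unfolding eq using I by (intro sets.sets_Collect_finite_All sets.sets_Collect_countable_All) auto
  qed
  show "prob {w \<in> space M. itinerary_event (\<lambda>i. N i w) \<rho> I h d \<sigma>} \<le> itinerary_weight \<rho> I d \<sigma> h"
  proof (cases "n = 0")
    case True
    then show ?thesis
      by (simp add: n_def)
  next
    case False
    have "prob {w \<in> space M. itinerary_event (\<lambda>i. N i w) \<rho> I h d \<sigma>}
        = (\<Prod>i\<in>I. \<Prod>k<n. prob {w \<in> space M. point_count (N i) (A i k) w \<in> B i k})"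
      unfolding eq
    proof (rule count_independent)
      show "disjoint_family_on (A i) {..<n}" for i
        unfolding disjoint_family_on_def
      proof (intro ballI impI)
        have "A i k \<inter> A i m = {}" if "k < m" for k m
        proof -
          have "real (Suc k) * d \<le> real m * d"
            using that d by (intro mult_right_mono) auto
          then show ?thesis
            by (auto simp: A_def simp del: of_nat_Suc)
        qed
        then show "A i k \<inter> A i m = {}" if "k \<noteq> m" for k m
          using that by (metis Int_commute linorder_neqE_nat)
      qed
    qed (use I False A B in auto)
    also have "\<dots> = (\<Prod>k<n. \<Prod>i\<in>I. prob {w \<in> space M. point_count (N i) (A i k) w \<in> B i k})"
      by (rule prod.swap)
    also have "\<dots> \<le> (\<Prod>k<n. step_weight \<rho> I d (\<sigma> ! k) (y k))"
    proof (intro prod_mono conjI prod_nonneg)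
      fix k assume "k \<in> {..<n}"
      then have k: "k < n" by simp
      have count: "prob {w \<in> space M. point_count (N i) (A i k) w = 0} = exp (- (d * volume_rate \<rho> i (y k)))"
        "prob {w \<in> space M. point_count (N i) (A i k) w \<noteq> 0} = 1 - exp (- (d * volume_rate \<rho> i (y k)))" for i
        unfolding A_def using count_prob(1,2)[OF kd(1,2)[of k] rate, of i i "y k"] by (simp_all only: kd(3))
      show "(\<Prod>i\<in>I. prob {w \<in> space M. point_count (N i) (A i k) w \<in> B i k}) \<le> step_weight \<rho> I d (\<sigma> ! k) (y k)"
      proof (cases "\<sigma> ! k")
        case None
        then have "(\<Prod>i\<in>I. prob {w \<in> space M. point_count (N i) (A i k) w \<in> B i k})
            = (\<Prod>i\<in>I. exp (- (d * volume_rate \<rho> i (y k))))"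
          by (intro prod.cong) (simp_all add: B_def count)
        also have "\<dots> = step_weight \<rho> I d (\<sigma> ! k) (y k)"
          using I None by (simp add: exp_sum[symmetric] sum_negf sum_distrib_left)
        finally show ?thesis
          by simp
      next
        case (Some j)
        have "(\<Prod>i\<in>I. prob {w \<in> space M. point_count (N i) (A i k) w \<in> B i k})
            = (\<Prod>i\<in>I. if i = j then 1 - exp (- (d * volume_rate \<rho> i (y k))) else 1)"
          using Some by (intro prod.cong) (auto simp: B_def count prob_space)
        also have "\<dots> = 1 - exp (- (d * volume_rate \<rho> j (y k)))"
          using I in_I[OF Some k] by simp
        also have "\<dots> \<le> step_weight \<rho> I d (\<sigma> ! k) (y k)"
          using exp_ge_add_one_self[of "- (d * volume_rate \<rho> j (y k))"] Some by simp
        finally show ?thesis .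
      qed
    qed auto
    also have "\<dots> = itinerary_weight \<rho> I d \<sigma> h"
      by (simp add: itinerary_weight_prod n_def y_def)
    finally show ?thesis .
  qed
qed

end

section \<open>Removing the truncations\<close>

lemma fold_move_ge: "h c \<le> fold move \<sigma> h c"
proof (induction \<sigma> arbitrary: h)
  case (Cons s \<sigma>)
  have "h c \<le> move s h c"
    by (cases s) (simp_all add: lift_def)
  also have "\<dots> \<le> fold move (s # \<sigma>) h c"
    using Cons.IH[of "move s h"] by simp
  finally show ?case .
qed simp

lemma power_one_plus_square_le:
  fixes q :: real
  assumes "0 < n"
  shows "(1 + (q / real n)\<^sup>2) ^ n \<le> exp (q\<^sup>2 / real n)"
proof -
  have "(1 + (q / real n)\<^sup>2) ^ n \<le> exp ((q / real n)\<^sup>2) ^ n"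
    by (intro power_mono) auto
  also have "\<dots> = exp (real n * (q / real n)\<^sup>2)"
    by (rule exp_of_nat_mult[symmetric])
  also have "real n * (q / real n)\<^sup>2 = q\<^sup>2 / real n"
    using assms by (simp add: power2_eq_square)
  finally show ?thesis .
qed

context driven
begin

text \<open>Heights do not decrease, so a cap at time \<open>T\<close> is almost surely a cap on all
  of \<open>{0..T}\<close>.\<close>

definition capped :: "(real \<Rightarrow> int \<Rightarrow> 'w \<Rightarrow> int) \<Rightarrow> int \<Rightarrow> int \<Rightarrow> (int \<Rightarrow> int) \<Rightarrow> real \<Rightarrow> nat \<Rightarrow> 'w set" where
  "capped H l u h T m = {w \<in> space M. \<forall>i\<in>{l..<u}. H T i w \<le> h i + int m}"

lemma capped_sets:
  assumes "monotone_process M r N l u \<omega> H" and "0 \<le> T"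
  shows "capped H l u h T m \<in> sets M"
proof -
  have [measurable]: "H T i \<in> M \<rightarrow>\<^sub>M count_space UNIV" for i
    using assms by (simp add: monotone_process_def)
  have "{w \<in> space M. H T i w \<le> h i + int m} \<in> sets M" for i
    by measurable
  then show ?thesis
    unfolding capped_def by (intro sets.sets_Collect_finite_All) auto
qed

text \<open>On the uncrowded part of the probability space the path follows one of finitely many
  itineraries, whose probabilities are dominated by the transition weights of the Euler scheme.\<close>

lemma capped_growth_discrete:
  fixes \<rho> :: "int \<Rightarrow> real" and C D T :: real
  assumes proc: "monotone_process M r N l u \<omega> H" and T: "0 \<le> T" and c: "c \<in> {l..<u}" and n: "0 < n"
    and rate: "\<And>i h. 0 \<le> volume_rate \<rho> i h \<and> volume_rate \<rho> i h \<le> C"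
    and agree: "\<And>g i. (\<And>j. hgt 0 0 \<omega> j \<le> g j \<and> g j \<le> hgt 0 0 \<omega> j + int m) \<Longrightarrow> i \<in> {l..<u} \<Longrightarrow>
      volume_rate r i g = volume_rate \<rho> i g"
    and small: "T / n * (C * card {l..<u}) \<le> 1 / 2"
    and chain: "(volume_step \<rho> (T / n) l u ^^ n) (\<lambda>h. real_of_int (h c)) (hgt 0 0 \<omega>) \<le> D"
  shows "(\<integral>\<^sup>+w. ennreal (real_of_int (H T c w - hgt 0 0 \<omega> c)) * indicator (capped H l u (hgt 0 0 \<omega>) T m) w \<partial>M)
    \<le> ennreal (exp ((T * (C * card {l..<u}))\<^sup>2 / n) * max 0 (D - hgt 0 0 \<omega> c)
        + m * (n * ((card {l..<u} + card {l..<u} * card {l..<u}) * (T / n * C)\<^sup>2)))"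
proof -
  let ?I = "{l..<u}" and ?h = "hgt 0 0 \<omega>"
  define d where "d = T / n"
  have d: "0 \<le> d" "real n * d = T"
    using T n by (simp_all add: d_def)
  have C: "0 \<le> C"
    using rate[of 0 ?h] by linarith
  let ?L = "{\<sigma>. set \<sigma> \<subseteq> insert None (Some ` ?I) \<and> length \<sigma> = n}"
  let ?val = "\<lambda>\<sigma>. real_of_int (fold move \<sigma> ?h c - ?h c)"
  define E where "E \<sigma> = {w \<in> space M. itinerary_event (\<lambda>i. N i w) \<rho> ?I ?h d \<sigma>}" for \<sigma>
  have val: "0 \<le> ?val \<sigma>" for \<sigma>
    using fold_move_ge[of ?h c \<sigma>] by simp
  have fin: "finite ?L"
    by (rule finite_lists_length_eq) simp
  have E: "E \<sigma> \<in> sets M" "prob (E \<sigma>) \<le> itinerary_weight \<rho> ?I d \<sigma> ?h" if "\<sigma> \<in> ?L" for \<sigma>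
    using itinerary_prob[of \<rho> d ?I \<sigma> ?h] rate d c that by (auto simp: E_def)
  let ?Z = "crowded ?I n d C"
  note Z = crowded_prob[OF finite_atLeastLessThan_int[of l u] d(1) C, of n]
  \<comment> \<open>On the crowded event the cap bounds the rise by \<open>m\<close>; elsewhere the
    path follows one of the itineraries, and its summand alone bounds the left side.\<close>
  have "AE w in M. ennreal (real_of_int (H T c w - ?h c)) * indicator (capped H l u ?h T m) w
      \<le> (\<Sum>\<sigma>\<in>?L. ennreal (?val \<sigma>) * indicator (E \<sigma>) w) + ennreal m * indicator ?Z w"
    using conjunct2[OF proc[unfolded monotone_process_def]] AE_space
  proof eventually_elim
    case (elim w)
    let ?lhs = "ennreal (real_of_int (H T c w - ?h c)) * indicator (capped H l u ?h T m) w"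
    show ?case
    proof (cases "w \<in> capped H l u ?h T m")
      case w: True
      show ?thesis
      proof (cases "w \<in> ?Z")
        case True
        have "H T c w \<le> ?h c + int m"
          using w c unfolding capped_def by blast
        then have "?lhs \<le> ennreal m * indicator ?Z w"
          using True by (auto intro!: ennreal_leI simp: indicator_def)
        then show ?thesis
          by (rule order.trans) simp
      next
        case False
        have h0: "(\<lambda>i. H 0 i w) = ?h"
          by (rule monotone_path_initial[OF elim(1)])
        have "\<exists>\<sigma>. length \<sigma> = n \<and> set \<sigma> \<subseteq> insert None (Some ` ?I) \<and>
          itinerary_event (\<lambda>i. N i w) \<rho> ?I (\<lambda>i. H 0 i w) d \<sigma> \<and> (\<lambda>i. H (real n * d) i w) = fold move \<sigma> (\<lambda>i. H 0 i w)"
        proof (rule monotone_path_itinerary[OF elim(1) d(1)])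
          show "H (real n * d) i w \<le> H 0 i w + int m" for i
          proof (cases "i \<in> ?I")
            case True
            then show ?thesis
              using w fun_cong[OF h0, of i] by (simp add: capped_def d(2))
          next
            case False
            then show ?thesis
              using monotone_path_frozen[OF elim(1) T] by (simp add: d(2))
          qed
          show "volume_rate r i g = volume_rate \<rho> i g \<and> volume_rate \<rho> i g \<le> C"
            if "\<And>j. H 0 j w \<le> g j \<and> g j \<le> H 0 j w + int m" "i \<in> ?I" for g i
            using agree[of g i] that rate fun_cong[OF h0] by simp
          fix k i j s s' y y'
          let ?A = "{real k * d<..real (Suc k) * d} \<times> {0<..<C}"
          assume k: "k < n" and i: "i \<in> ?I" and j: "j \<in> ?I"
            and p: "(s, y) \<in> N i w \<inter> ?A" and q: "(s', y') \<in> N j w \<inter> ?A"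
          have ne: "point_count (N i) ?A w \<noteq> 0" "point_count (N j) ?A w \<noteq> 0"
            using p q unfolding point_count_eq_0_iff by blast+
          have uncrowded: "point_count (N i) ?A w = 1 \<and> (\<forall>j\<in>?I - {i}. point_count (N j) ?A w = 0)"
            using False elim(2) k i ne(1) unfolding crowded_def Let_def by blast
          then have "i = j"
            using j ne(2) by blast
          with uncrowded point_count_eq_1_unique[of "N i" ?A w, OF _ p] q
          show "i = j \<and> s = s' \<and> y = y'"
            by blast
        qed
        then obtain \<sigma> where \<sigma>: "\<sigma> \<in> ?L" "w \<in> E \<sigma>" "(\<lambda>i. H T i w) = fold move \<sigma> ?h"
          using elim(2) by (auto simp: E_def h0 d(2))
        have "?lhs \<le> ennreal (?val \<sigma>) * indicator (E \<sigma>) w"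
          using \<sigma>(2) fun_cong[OF \<sigma>(3), of c] by (simp add: indicator_def)
        also have "\<dots> \<le> (\<Sum>\<sigma>\<in>?L. ennreal (?val \<sigma>) * indicator (E \<sigma>) w)"
          by (rule member_le_sum[OF \<sigma>(1) _ fin]) simp
        finally show ?thesis
          by (rule order.trans) simp
      qed
    qed simp
  qed
  then have "(\<integral>\<^sup>+w. ennreal (real_of_int (H T c w - ?h c)) * indicator (capped H l u ?h T m) w \<partial>M)
      \<le> (\<integral>\<^sup>+w. (\<Sum>\<sigma>\<in>?L. ennreal (?val \<sigma>) * indicator (E \<sigma>) w) + ennreal m * indicator ?Z w \<partial>M)"
    by (rule nn_integral_mono_AE)
  also have "\<dots> = (\<Sum>\<sigma>\<in>?L. ennreal (?val \<sigma>) * emeasure M (E \<sigma>)) + ennreal m * emeasure M ?Z"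
  proof -
    have meas: "(\<lambda>w. ennreal (?val \<sigma>) * indicator (E \<sigma>) w) \<in> borel_measurable M" if "\<sigma> \<in> ?L" for \<sigma>
      using E(1)[OF that] by measurable
    have "(\<integral>\<^sup>+w. (\<Sum>\<sigma>\<in>?L. ennreal (?val \<sigma>) * indicator (E \<sigma>) w) \<partial>M)
        = (\<Sum>\<sigma>\<in>?L. \<integral>\<^sup>+w. ennreal (?val \<sigma>) * indicator (E \<sigma>) w \<partial>M)"
      by (rule nn_integral_sum) (rule meas)
    also have "\<dots> = (\<Sum>\<sigma>\<in>?L. ennreal (?val \<sigma>) * emeasure M (E \<sigma>))"
      using E(1) by (intro sum.cong refl nn_integral_cmult_indicator)
    finally have "(\<integral>\<^sup>+w. (\<Sum>\<sigma>\<in>?L. ennreal (?val \<sigma>) * indicator (E \<sigma>) w) \<partial>M)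
        = (\<Sum>\<sigma>\<in>?L. ennreal (?val \<sigma>) * emeasure M (E \<sigma>))" .
    moreover have "(\<integral>\<^sup>+w. ennreal m * indicator ?Z w \<partial>M) = ennreal m * emeasure M ?Z"
      using Z(1) by (rule nn_integral_cmult_indicator)
    moreover have "(\<lambda>w. ennreal m * indicator ?Z w) \<in> borel_measurable M"
      using Z(1) by measurable
    ultimately show ?thesis
      using meas by (subst nn_integral_add) (simp_all add: borel_measurable_sum)
  qed
  also have "\<dots> = ennreal ((\<Sum>\<sigma>\<in>?L. ?val \<sigma> * prob (E \<sigma>)) + m * prob ?Z)"
    using val by (simp add: emeasure_eq_measure ennreal_mult[symmetric] sum_nonneg)
  also have "\<dots> \<le> ennreal (exp ((T * (C * card ?I))\<^sup>2 / n) * max 0 (D - ?h c)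
        + m * (n * ((card ?I + card ?I * card ?I) * (T / n * C)\<^sup>2)))"
  proof (intro ennreal_leI add_mono mult_left_mono)
    show "prob ?Z \<le> n * ((card ?I + card ?I * card ?I) * (T / n * C)\<^sup>2)"
      using Z(2) by (simp add: d_def)
    let ?a = "d * (C * card ?I)"
    have "(\<Sum>\<sigma>\<in>?L. ?val \<sigma> * prob (E \<sigma>)) \<le> (\<Sum>\<sigma>\<in>?L. itinerary_weight \<rho> ?I d \<sigma> ?h * ?val \<sigma>)"
    proof (rule sum_mono)
      fix \<sigma> assume "\<sigma> \<in> ?L"
      then show "?val \<sigma> * prob (E \<sigma>) \<le> itinerary_weight \<rho> ?I d \<sigma> ?h * ?val \<sigma>"
        by (subst mult.commute) (rule mult_right_mono[OF E(2) val])
    qed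
    \<comment> \<open>The rise of column \<open>c\<close> is nonnegative along every itinerary;
      \<open>Q\<close> records this.\<close>
    also have "\<dots> \<le> (1 + ?a\<^sup>2) ^ n * (volume_step \<rho> d l u ^^ n) (\<lambda>h. real_of_int (h c - ?h c)) ?h"
    proof (rule itinerary_sum_le[where Q = "\<lambda>h. ?h c \<le> h c", OF rate d(1) refl])
      show "?a \<le> 1 / 2"
        using small by (simp add: d_def)
    qed (auto simp: lift_def)
    also have "(volume_step \<rho> d l u ^^ n) (\<lambda>h. real_of_int (h c - ?h c)) ?h
        = (volume_step \<rho> d l u ^^ n) (\<lambda>h. real_of_int (h c)) ?h - ?h c"
    proof -
      have "(volume_step \<rho> d l u ^^ n) (\<lambda>h. real_of_int (h c) + (- real_of_int (?h c)) * 1) ?h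
        = (volume_step \<rho> d l u ^^ n) (\<lambda>h. real_of_int (h c)) ?h
          + (- real_of_int (?h c)) * (volume_step \<rho> d l u ^^ n) (\<lambda>_. 1) ?h"
        unfolding volume_step_def euler_iterate_linear ..
      moreover have "(volume_step \<rho> d l u ^^ n) (\<lambda>_. 1) = (\<lambda>_. 1)"
        by (induction n) (simp_all add: volume_step_def euler_step_def)
      ultimately show ?thesis
        by simp
    qed
    \<comment> \<open>\<open>D\<close> may lie below the initial height; the maximum keeps the
      estimate valid when the leading factor is enlarged.\<close>
    also have "(1 + ?a\<^sup>2) ^ n * \<dots> \<le> exp ((T * (C * card ?I))\<^sup>2 / n) * max 0 (D - ?h c)"
    proof (rule order.trans[OF mult_left_mono mult_right_mono])
      show "(1 + ?a\<^sup>2) ^ n \<le> exp ((T * (C * card ?I))\<^sup>2 / n)"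
        using power_one_plus_square_le[OF n, of "T * (C * card ?I)"] by (simp add: d_def)
      have "(volume_step \<rho> d l u ^^ n) (\<lambda>h. real_of_int (h c)) ?h \<le> D"
        using chain by (simp add: d_def)
      then show "(volume_step \<rho> d l u ^^ n) (\<lambda>h. real_of_int (h c)) ?h - ?h c \<le> max 0 (D - ?h c)"
        by simp
    qed simp_all
    finally show "(\<Sum>\<sigma>\<in>?L. ?val \<sigma> * prob (E \<sigma>)) \<le> exp ((T * (C * card ?I))\<^sup>2 / n) * max 0 (D - ?h c)" .
  qed simp
  finally show ?thesis .
qed

text \<open>Here the slab width tends to 0: the exponential factor tends to 1, and the crowding
  term, of order \<open>m / n\<close>, vanishes for fixed \<open>m\<close>.\<close>

lemma capped_growth:
  fixes \<rho> :: "int \<Rightarrow> real" and C D T :: real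
  assumes proc: "monotone_process M r N l u \<omega> H" and T: "0 \<le> T" and c: "c \<in> {l..<u}"
    and rate: "\<And>i h. 0 \<le> volume_rate \<rho> i h \<and> volume_rate \<rho> i h \<le> C"
    and agree: "\<And>g i. (\<And>j. hgt 0 0 \<omega> j \<le> g j \<and> g j \<le> hgt 0 0 \<omega> j + int m) \<Longrightarrow> i \<in> {l..<u} \<Longrightarrow>
      volume_rate r i g = volume_rate \<rho> i g"
    and chain: "\<forall>\<^sub>F n in sequentially.
      (volume_step \<rho> (T / real n) l u ^^ n) (\<lambda>h. real_of_int (h c)) (hgt 0 0 \<omega>) \<le> D"
  shows "(\<integral>\<^sup>+w. ennreal (real_of_int (H T c w - hgt 0 0 \<omega> c)) * indicator (capped H l u (hgt 0 0 \<omega>) T m) w \<partial>M)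
    \<le> ennreal (D - hgt 0 0 \<omega> c)"
proof -
  let ?X = "\<integral>\<^sup>+w. ennreal (real_of_int (H T c w - hgt 0 0 \<omega> c)) * indicator (capped H l u (hgt 0 0 \<omega>) T m) w \<partial>M"
  let ?k = "real (card {l..<u})" and ?D = "max 0 (D - hgt 0 0 \<omega> c)"
  let ?e = "\<lambda>n. exp ((T * (C * ?k))\<^sup>2 / real n) * ?D + m * (real n * ((?k + ?k * ?k) * (T / real n * C)\<^sup>2))"
  have "(\<lambda>n. exp ((T * (C * ?k))\<^sup>2 / real n) * ?D + m * ((?k + ?k * ?k) * (T * C)\<^sup>2 / real n))
      \<longlonglongrightarrow> exp 0 * ?D + real m * 0"
    by (intro tendsto_intros lim_const_over_n)
  moreover have "\<forall>\<^sub>F n in sequentially.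
      exp ((T * (C * ?k))\<^sup>2 / real n) * ?D + m * ((?k + ?k * ?k) * (T * C)\<^sup>2 / real n) = ?e n"
    using eventually_gt_at_top[of 0] by eventually_elim (simp add: power2_eq_square)
  ultimately have "?e \<longlonglongrightarrow> exp 0 * ?D + real m * 0"
    by (rule Lim_transform_eventually)
  then have lim: "(\<lambda>n. ennreal (?e n)) \<longlonglongrightarrow> ennreal ?D"
    by (intro tendsto_ennrealI) simp
  have "(\<lambda>n. T * (C * ?k) / real n) \<longlonglongrightarrow> 0"
    by (rule lim_const_over_n)
  then have "\<forall>\<^sub>F n in sequentially. T * (C * ?k) / real n < 1 / 2"
    by (rule order_tendstoD) simp
  with chain eventually_gt_at_top[of 0] have "\<forall>\<^sub>F n in sequentially. ?X \<le> ennreal (?e n)"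
  proof eventually_elim
    case (elim n)
    show ?case
      using capped_growth_discrete[OF proc T c elim(2) rate agree _ elim(1)] elim(3) by simp
  qed
  with lim have "?X \<le> ennreal ?D"
    by (intro tendsto_lowerbound[OF lim]) auto
  then show ?thesis
    by (simp add: max_def ennreal_neg split: if_splits)
qed

end

text \<open>The interval \<open>{1 - m..m}\<close> is invariant under \<open>z \<mapsto> 1 - z\<close>.\<close>

definition clamp_rate :: "(int \<Rightarrow> real) \<Rightarrow> int \<Rightarrow> int \<Rightarrow> real" where
  "clamp_rate r m z = r (max (1 - m) (min z m))"

lemma bounded_rate_clamp:
  assumes r: "rate_function r" and m: "1 \<le> m"
  shows "bounded_rate (clamp_rate r m) (r m)"
proof
  have "mono r"
    using r by (simp add: rate_function_def strict_mono_mono)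
  show "0 < clamp_rate r m z" for z
    using r by (simp add: rate_function_def clamp_rate_def)
  show "mono (clamp_rate r m)"
    unfolding clamp_rate_def by (intro monoI monoD[OF \<open>mono r\<close>]) auto
  show "clamp_rate r m z * clamp_rate r m (1 - z) = 1" for z
  proof -
    have "max (1 - m) (min (1 - z) m) = 1 - max (1 - m) (min z m)"
      using m by (auto simp: max_def min_def)
    then show ?thesis
      using r by (simp add: rate_function_def clamp_rate_def)
  qed
  show "clamp_rate r m z \<le> r m" for z
    unfolding clamp_rate_def using m by (intro monoD[OF \<open>mono r\<close>]) auto
qed

text \<open>Cap and clamp are removed. For each \<open>m\<close> the clamp level is adapted to
  \<open>m\<close> and to the volume, but the bound contains neither, so monotone convergence in
  \<open>m\<close> applies.\<close>

lemma (in driven) process_growth: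
  fixes K :: nat and \<beta> \<theta> :: real
  assumes r: "rate_function r" and \<beta>: "0 < \<beta>" "\<And>z. 0 < z \<Longrightarrow> r z < exp (\<beta> * real_of_int z)"
    and \<theta>: "\<theta> = \<beta> + \<beta> * K + ln 6"
    and K: "\<And>j. \<bar>hgt 0 0 \<omega> j\<bar> \<le> int K * \<bar>j\<bar>"
    and proc: "monotone_process M r N l u \<omega> H" and T: "0 \<le> T" and c: "c \<in> {l..<u}"
  shows "(\<integral>\<^sup>+w. ennreal (real_of_int (H T c w - hgt 0 0 \<omega> c)) \<partial>M)
    \<le> ennreal (K * \<bar>c\<bar> + 4 * exp \<theta> * T - hgt 0 0 \<omega> c)"
proof -
  let ?h = "hgt 0 0 \<omega>" and ?D = "K * \<bar>c\<bar> + 4 * exp \<theta> * T"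
  have capped: "(\<integral>\<^sup>+w. ennreal (real_of_int (H T c w - ?h c)) * indicator (capped H l u ?h T m) w \<partial>M)
    \<le> ennreal (?D - ?h c)" for m
  proof -
    obtain b where b: "\<And>z. b \<le> z \<Longrightarrow> exp \<theta> < r z"
      using r unfolding rate_function_def filterlim_at_top_dense eventually_at_top_linorder by blast
    \<comment> \<open>\<open>b \<le> S\<close> makes \<theta> admissible for the clamped rates. The
      clamp fixes the asymmetric window \<open>{1 - S..S}\<close>; the strict bound on
      \<open>\<bar>\<omega> j\<bar> + m\<close> leaves the increments in
      \<open>{1 - S..S - 1}\<close>, where the rates at \<open>z\<close> and at \<open>- z\<close>
      are both unclamped.\<close>
    define S where "S = max 1 (max b (Max ((\<lambda>j. \<bar>\<omega> j\<bar>) ` {l..u}) + int m + 1))"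
    have S_ge: "\<bar>\<omega> j\<bar> + int m < S" if "j \<in> {l..u}" for j
    proof -
      have "\<bar>\<omega> j\<bar> \<le> Max ((\<lambda>j. \<bar>\<omega> j\<bar>) ` {l..u})"
        using that by (intro Max_ge) auto
      then show "\<bar>\<omega> j\<bar> + int m < S"
        by (simp add: S_def)
    qed
    have S: "1 \<le> S" "b \<le> S"
      by (simp_all add: S_def)
    define \<rho> where "\<rho> = clamp_rate r S"
    interpret \<rho>: bounded_rate \<rho> "r S"
      unfolding \<rho>_def by (rule bounded_rate_clamp[OF r S(1)])
    have growth: "\<rho> z \<le> exp (\<beta> * real_of_int z)" if "0 < z" for z
    proof -
      have "max (1 - S) (min z S) \<le> z"
        using that S by auto
      then have "\<rho> z \<le> r z"
        using r unfolding \<rho>_def clamp_rate_def rate_function_def by (simp add: strict_mono_less_eq)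
      then show ?thesis
        using \<beta>(2)[OF that] by simp
    qed
    have top: "exp \<theta> < \<rho> S"
      using b[OF S(2)] S by (simp add: \<rho>_def clamp_rate_def)
    show ?thesis
    proof (rule capped_growth[OF proc T c])
      show "0 \<le> volume_rate \<rho> i h \<and> volume_rate \<rho> i h \<le> 2 * r S" for i h
        using \<rho>.pos[of "increments h i"] \<rho>.pos[of "- increments h (i + 1)"]
          \<rho>.le_R[of "increments h i"] \<rho>.le_R[of "- increments h (i + 1)"]
        by (simp add: volume_rate_def)
      fix g i assume g: "\<And>j. ?h j \<le> g j \<and> g j \<le> ?h j + int m" and i: "i \<in> {l..<u}"
      have "\<rho> (increments g j) = r (increments g j) \<and> \<rho> (- increments g j) = r (- increments g j)"
        if "j \<in> {l..u}" for j
      proof -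
        have "increments ?h j = \<omega> j"
          by simp
        then have "\<omega> j = ?h (j - 1) - ?h j"
          unfolding increments_def by (rule sym)
        then have "\<bar>increments g j\<bar> \<le> \<bar>\<omega> j\<bar> + int m"
          using g[of j] g[of "j - 1"] unfolding increments_def by linarith
        then have "1 - S \<le> increments g j" "increments g j \<le> S - 1"
          using S_ge[OF that] by linarith+
        then show ?thesis
          by (simp add: \<rho>_def clamp_rate_def max_def min_def)
      qed
      then show "volume_rate r i g = volume_rate \<rho> i g"
        using i by (simp add: volume_rate_def)
    next
      have "(\<lambda>n. T * (2 * r S * card {l - 1..u}) / real n) \<longlonglongrightarrow> 0"
        by (rule lim_const_over_n)
      then have "\<forall>\<^sub>F n in sequentially. T * (2 * r S * card {l - 1..u}) / real n < 1"
        by (rule order_tendstoD) simp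
      with eventually_gt_at_top[of 0]
      show "\<forall>\<^sub>F n in sequentially.
          (volume_step \<rho> (T / real n) l u ^^ n) (\<lambda>h. real_of_int (h c)) ?h \<le> ?D"
      proof eventually_elim
        case (elim n)
        interpret chain: brick_chain \<rho> "r S" l u "T / real n"
          by unfold_locales (use elim T c in auto)
        show ?case
          using chain.volume_growth[OF \<beta>(1) growth \<theta> top c K, where n = n] elim(1) by (simp add: mult_ac)
      qed
    qed
  qed
  have meas [measurable]: "H T i \<in> M \<rightarrow>\<^sub>M count_space UNIV" for i
    using proc T by (simp add: monotone_process_def)
  have [measurable]: "capped H l u ?h T m \<in> sets M" for m
    by (rule capped_sets[OF proc T])
  let ?F = "\<lambda>m w. ennreal (real_of_int (H T c w - ?h c)) * indicator (capped H l u ?h T m) w"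
  have "(\<integral>\<^sup>+w. ennreal (real_of_int (H T c w - ?h c)) \<partial>M) = (\<integral>\<^sup>+w. (SUP m. ?F m w) \<partial>M)"
  proof (rule nn_integral_cong)
    fix w assume w: "w \<in> space M"
    \<comment> \<open>For a fixed \<open>w\<close> every large enough cap is inactive, because it
      concerns finitely many columns.\<close>
    define m where "m = nat (Max ((\<lambda>i. \<bar>H T i w - ?h i\<bar>) ` {l..<u}))"
    have "H T i w \<le> ?h i + int m" if "i \<in> {l..<u}" for i
    proof -
      have "\<bar>H T i w - ?h i\<bar> \<le> Max ((\<lambda>i. \<bar>H T i w - ?h i\<bar>) ` {l..<u})"
        using that by (intro Max_ge) auto
      then show ?thesis
        unfolding m_def by linarith
    qed
    then have "w \<in> capped H l u ?h T m"
      using w by (simp add: capped_def)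
    then have le: "ennreal (real_of_int (H T c w - ?h c)) \<le> ?F m w"
      by simp
    show "ennreal (real_of_int (H T c w - ?h c)) = (SUP m. ?F m w)"
    proof (rule antisym)
      show "ennreal (real_of_int (H T c w - ?h c)) \<le> (SUP m. ?F m w)"
        by (rule order.trans[OF le]) (rule SUP_upper, simp)
      show "(SUP m. ?F m w) \<le> ennreal (real_of_int (H T c w - ?h c))"
        by (rule SUP_least) (simp add: indicator_def)
    qed
  qed
  also have "\<dots> = (SUP m. \<integral>\<^sup>+w. ?F m w \<partial>M)"
  proof (rule nn_integral_monotone_convergence_SUP)
    show "incseq ?F"
    proof (intro incseq_SucI le_funI mult_left_mono)
      fix m w
      show "indicator (capped H l u ?h T m) w \<le> (indicator (capped H l u ?h T (Suc m)) w :: ennreal)"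
        by (force simp: indicator_def capped_def)
    qed simp
  qed measurable
  also have "\<dots> \<le> ennreal (?D - ?h c)"
    by (rule SUP_least) (rule capped)
  finally show ?thesis .
qed

section \<open>Linear growth of the initial heights\<close>

lemma bounded_averages:
  fixes s :: "nat \<Rightarrow> real"
  assumes s: "mono s" and "\<forall>\<^sub>F i in sequentially. s i \<le> a * real i"
  shows "\<exists>K::nat. \<forall>i>0. s i \<le> real K * real i"
proof -
  obtain i0 where i0: "\<And>i. i0 \<le> i \<Longrightarrow> s i \<le> a * real i"
    using assms(2) by (auto simp: eventually_sequentially)
  obtain K :: nat where K: "max a (\<bar>s i0\<bar>) \<le> real K"
    using real_arch_simple by blast
  have "s i \<le> real K * real i" if "0 < i" for i
  proof (cases "i0 \<le> i")
    case True
    then have "s i \<le> a * real i"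
      by (rule i0)
    also have "\<dots> \<le> real K * real i"
      using K by (intro mult_right_mono) auto
    finally show ?thesis .
  next
    case False
    \<comment> \<open>The finitely many small \<open>i\<close> are covered by monotonicity and
      \<open>1 \<le> i\<close>.\<close>
    then have "s i \<le> s i0"
      by (intro monoD[OF s]) simp
    also have "\<dots> \<le> real K * 1"
      using K by (simp add: abs_le_iff)
    also have "\<dots> \<le> real K * real i"
      using that by (intro mult_left_mono) auto
    finally show ?thesis .
  qed
  then show ?thesis
    by blast
qed

text \<open>Heights are signed partial sums of increments, so the averages of
  \<open>\<bar>\<omega> j\<bar>\<close> bound the slopes. A finite upper limit bounds them at large
  distances, and monotonicity of the sums extends this to all distances.\<close>

lemma Omega_tilde_linear_heights:
  assumes "\<omega> \<in> Omega_tilde"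
  shows "\<exists>K::nat. \<forall>j. \<bar>hgt 0 0 \<omega> j\<bar> \<le> int K * \<bar>j\<bar>"
proof -
  let ?L = "\<lambda>i::int. ereal (1 / \<bar>real_of_int i\<bar> * (\<Sum>j=i+1..0. \<bar>real_of_int (\<omega> j)\<bar>))"
  let ?U = "\<lambda>i::int. ereal (1 / real_of_int i * (\<Sum>j=1..i. \<bar>real_of_int (\<omega> j)\<bar>))"
  have fin: "Limsup at_bot ?L \<noteq> \<infinity>" "Limsup at_top ?U \<noteq> \<infinity>"
    using assms by (auto simp: Omega_tilde_def K_bound_def)
  obtain a :: nat where a: "Limsup at_bot ?L < ereal (real a)"
    using fin(1) less_PInf_Ex_of_nat by blast
  obtain b :: nat where b: "Limsup at_top ?U < ereal (real b)"
    using fin(2) less_PInf_Ex_of_nat by blast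
  define R where "R n = (\<Sum>j=1..int n. \<bar>real_of_int (\<omega> j)\<bar>)" for n
  define S where "S n = (\<Sum>j=- int n + 1..0. \<bar>real_of_int (\<omega> j)\<bar>)" for n
  have "\<exists>K::nat. \<forall>i>0. R i \<le> real K * real i"
  proof (rule bounded_averages)
    show "mono R"
      unfolding R_def by (intro monoI sum_mono2) auto
    obtain i0 where i0: "\<And>i. i0 \<le> i \<Longrightarrow> ?U i < ereal (real b)"
      using Limsup_lessD[OF b] unfolding eventually_at_top_linorder by blast
    show "\<forall>\<^sub>F n in sequentially. R n \<le> real b * real n"
      unfolding eventually_sequentially
    proof (intro exI allI impI)
      fix n assume n: "nat (max i0 1) \<le> n"
      then have "i0 \<le> int n" "0 < n"
        by linarith+
      from i0[OF this(1)] this(2)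
      show "R n \<le> real b * real n"
        by (simp add: R_def field_simps)
    qed
  qed
  then obtain K1 :: nat where K1: "\<And>i. 0 < i \<Longrightarrow> R i \<le> real K1 * real i"
    by blast
  have "\<exists>K::nat. \<forall>i>0. S i \<le> real K * real i"
  proof (rule bounded_averages)
    show "mono S"
      unfolding S_def by (intro monoI sum_mono2) auto
    obtain i0 where i0: "\<And>i. i \<le> i0 \<Longrightarrow> ?L i < ereal (real a)"
      using Limsup_lessD[OF a] unfolding eventually_at_bot_linorder by blast
    show "\<forall>\<^sub>F n in sequentially. S n \<le> real a * real n"
      unfolding eventually_sequentially
    proof (intro exI allI impI)
      fix n assume n: "nat (max (- i0) 1) \<le> n"
      then have "- int n \<le> i0" "0 < n"
        by linarith+
      from i0[OF this(1)] this(2)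
      show "S n \<le> real a * real n"
        by (simp add: S_def field_simps)
    qed
  qed
  then obtain K2 :: nat where K2: "\<And>i. 0 < i \<Longrightarrow> S i \<le> real K2 * real i"
    by blast
  have "\<bar>hgt 0 0 \<omega> j\<bar> \<le> int (max K1 K2) * \<bar>j\<bar>" for j
  proof -
    consider "j = 0" | n where "0 < n" "j = int n" | n where "0 < n" "j = - int n"
      by (metis int_cases2 of_nat_0 gr0I minus_zero)
    then have "real_of_int \<bar>hgt 0 0 \<omega> j\<bar> \<le> real (max K1 K2) * real_of_int \<bar>j\<bar>"
    proof cases
      case (2 n)
      have "real_of_int \<bar>hgt 0 0 \<omega> j\<bar> \<le> R n"
        using 2 by (simp add: hgt_def R_def sum_abs)
      also have "\<dots> \<le> real K1 * real n"
        by (rule K1[OF 2(1)])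
      also have "\<dots> \<le> real (max K1 K2) * real n"
        by (intro mult_right_mono) auto
      finally show ?thesis
        using 2 by simp
    next
      case (3 n)
      have "real_of_int \<bar>hgt 0 0 \<omega> j\<bar> \<le> S n"
        using 3 by (simp add: hgt_def S_def sum_abs)
      also have "\<dots> \<le> real K2 * real n"
        by (rule K2[OF 3(1)])
      also have "\<dots> \<le> real (max K1 K2) * real n"
        by (intro mult_right_mono) auto
      finally show ?thesis
        using 3 by simp
    qed simp
    then have "real_of_int \<bar>hgt 0 0 \<omega> j\<bar> \<le> real_of_int (int (max K1 K2) * \<bar>j\<bar>)"
      by (simp only: of_int_mult of_int_of_nat_eq)
    then show ?thesis
      by (simp only: of_int_le_iff)
  qed
  then show ?thesis
    by blast
qed

text \<open>The limit over both ends is a supremum along symmetric boxes, which makes countable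
  monotone convergence available. The offset \<open>m\<close> keeps every box nondegenerate.\<close>

lemma Lim_monotone_net:
  fixes f :: "int \<Rightarrow> int \<Rightarrow> ereal"
  assumes mono: "\<And>l u l' u'. l < u \<Longrightarrow> l' \<le> l \<Longrightarrow> u \<le> u' \<Longrightarrow> f l u \<le> f l' u'"
    and "0 < m"
  shows "Lim (at_bot \<times>\<^sub>F at_top) (\<lambda>(l, u). f l u) = (SUP n. f (- (int n + m)) (int n + m))"
proof (rule tendsto_Lim)
  show "at_bot \<times>\<^sub>F at_top \<noteq> (bot :: (int \<times> int) filter)"
    by (simp add: prod_filter_eq_bot)
  let ?S = "SUP n. f (- (int n + m)) (int n + m)"
  have box: "\<forall>\<^sub>F p in at_bot \<times>\<^sub>F at_top. fst p \<le> - (int n + m) \<and> int n + m \<le> snd p" for n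
    by (rule eventually_prodI) (simp_all add: eventually_le_at_bot eventually_ge_at_top)
  show "((\<lambda>(l, u). f l u) \<longlongrightarrow> ?S) (at_bot \<times>\<^sub>F at_top)"
  proof (rule order_tendstoI)
    fix x assume "x < ?S"
    then obtain n where n: "x < f (- (int n + m)) (int n + m)"
      by (auto simp: less_SUP_iff)
    show "\<forall>\<^sub>F p in at_bot \<times>\<^sub>F at_top. x < (case p of (l, u) \<Rightarrow> f l u)"
      using box[of n]
    proof eventually_elim
      case (elim p)
      have "x < f (- (int n + m)) (int n + m)"
        by (rule n)
      also have "\<dots> \<le> f (fst p) (snd p)"
        using elim \<open>0 < m\<close> by (intro mono) auto
      finally show ?case
        by (simp add: case_prod_beta)
    qed
  next
    fix x assume x: "?S < x"
    show "\<forall>\<^sub>F p in at_bot \<times>\<^sub>F at_top. (case p of (l, u) \<Rightarrow> f l u) < x"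
      using box[of 0]
    proof eventually_elim
      case (elim p)
      define n where "n = nat (max (- fst p) (snd p))"
      have "f (fst p) (snd p) \<le> f (- (int n + m)) (int n + m)"
        using elim \<open>0 < m\<close> by (intro mono) (auto simp: n_def)
      also have "\<dots> \<le> ?S"
        by (rule SUP_upper) simp
      finally show ?case
        using x by (simp add: case_prod_beta)
    qed
  qed
qed

lemma e2ennreal_SUP_incseq:
  fixes a :: "nat \<Rightarrow> ereal"
  assumes "mono a"
  shows "e2ennreal (SUP n. a n) = (SUP n. e2ennreal (a n))"
proof -
  have "sup_continuous (\<lambda>x. e2ennreal x)"
    by (rule sup_continuous_e2ennreal) (simp add: sup_continuous_def)
  from sup_continuousD[OF this assms] show ?thesis
    by simp
qed

lemma ereal_expectation_le:
  assumes "(\<integral>\<^sup>+ w. e2ennreal (X w) \<partial>M) \<le> ennreal x" and "0 \<le> x"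
  shows "ereal_expectation M X \<le> ereal x"
proof -
  have "enn2ereal (\<integral>\<^sup>+ w. e2ennreal (X w) \<partial>M) \<le> ereal x"
    using assms by (metis enn2ereal_ennreal less_eq_ennreal.rep_eq)
  moreover have "0 \<le> enn2ereal (\<integral>\<^sup>+ w. e2ennreal (- X w) \<partial>M)"
    by simp
  ultimately show ?thesis
    unfolding ereal_expectation_def by (meson ereal_diff_le_self order.trans)
qed

theorem theorem2p4:
  fixes r :: "int \<Rightarrow> real" and \<omega> :: "int \<Rightarrow> int"
  assumes "rate_function r" and "\<omega> \<in> Omega_tilde"
  shows "\<exists>A B :: real.
    \<forall>(M :: 'w measure) (N :: int \<Rightarrow> 'w \<Rightarrow> (real \<times> real) set)
       (H :: int \<Rightarrow> int \<Rightarrow> real \<Rightarrow> int \<Rightarrow> 'w \<Rightarrow> int).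
      driving_noise M N \<longrightarrow>
      (\<forall>l u. l < u \<longrightarrow> monotone_process M r N l u \<omega> (H l u)) \<longrightarrow>
      (\<forall>t\<ge>0. \<forall>i. ereal_expectation M (limiting_height H t i)
                   \<le> ereal (A * t + B * \<bar>real_of_int i\<bar>))"
proof -
  obtain \<beta> where \<beta>: "0 < \<beta>" "\<And>z. 0 < z \<Longrightarrow> r z < exp (\<beta> * real_of_int z)"
    using assms(1) unfolding rate_function_def by blast
  have "mono r"
    using assms(1) by (simp add: rate_function_def strict_mono_mono)
  obtain K :: nat where K: "\<And>j. \<bar>hgt 0 0 \<omega> j\<bar> \<le> int K * \<bar>j\<bar>"
    using Omega_tilde_linear_heights[OF assms(2)] by blast
  define \<theta> where "\<theta> = \<beta> + \<beta> * K + ln 6"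
  show ?thesis
  proof (intro exI allI impI)
    fix M :: "'w measure" and N :: "int \<Rightarrow> 'w \<Rightarrow> (real \<times> real) set"
      and H :: "int \<Rightarrow> int \<Rightarrow> real \<Rightarrow> int \<Rightarrow> 'w \<Rightarrow> int" and t :: real and i :: int
    assume noise: "driving_noise M N" and t: "0 \<le> t"
      and proc: "\<forall>l u. l < u \<longrightarrow> monotone_process M r N l u \<omega> (H l u)"
    interpret driven M N
      by unfold_locales (rule noise)
    \<comment> \<open>This offset puts column \<open>i\<close> inside every box, including the first
      one.\<close>
    define m where "m = \<bar>i\<bar> + 1"
    define G where "G n w = H (- (int n + m)) (int n + m) t i w" for n w
    let ?h = "hgt 0 0 \<omega> i"
    have m: "0 < m"
      by (simp add: m_def)
    \<comment> \<open>There are countably many pairs \<open>l\<close>, \<open>u\<close>, so one null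
      set serves all of them.\<close>
    have "AE w in M. \<forall>l u. l < u \<longrightarrow> monotone_path r (\<lambda>i. N i w) l u \<omega> (\<lambda>t i. H l u t i w)"
      using proc unfolding AE_all_countable monotone_process_def by auto
    then have paths: "AE w in M. limiting_height H t i w = (SUP n. ereal (real_of_int (G n w))) \<and> mono (\<lambda>n. G n w)"
    proof eventually_elim
      case (elim w)
      have le: "H l u t i w \<le> H l' u' t i w" if "l < u" "l' \<le> l" "u \<le> u'" for l u l' u'
      proof -
        have "l' < u'"
          using that by simp
        with that(1) elim have "\<forall>j. (\<lambda>t i. H l u t i w) t j \<le> (\<lambda>t i. H l' u' t i w) t j"
          by (intro monotone_path_attractive[OF _ _ \<open>mono r\<close> that(2,3) t]) blast+
        then show ?thesis
          by simp
      qed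
      have "limiting_height H t i w = (SUP n. ereal (real_of_int (G n w)))"
        unfolding limiting_height_def G_def
        by (rule Lim_monotone_net[OF _ m]) (simp add: le)
      moreover have "mono (\<lambda>n. G n w)"
        unfolding G_def using m by (intro monoI le) auto
      ultimately show ?case ..
    qed
    have "(\<integral>\<^sup>+w. e2ennreal (limiting_height H t i w) \<partial>M) = (\<integral>\<^sup>+w. (SUP n. ennreal (real_of_int (G n w))) \<partial>M)"
    proof (rule nn_integral_cong_AE)
      show "AE w in M. e2ennreal (limiting_height H t i w) = (SUP n. ennreal (real_of_int (G n w)))"
        using paths
      proof eventually_elim
        case (elim w)
        then have "mono (\<lambda>n. ereal (real_of_int (G n w)))"
          by (simp add: mono_def)
        from e2ennreal_SUP_incseq[OF this] show ?case
          using elim by simp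
      qed
    qed
    also have "\<dots> = (SUP n. \<integral>\<^sup>+w. ennreal (real_of_int (G n w)) \<partial>M)"
    proof (rule nn_integral_monotone_convergence_SUP_AE)
      show "AE w in M. ennreal (real_of_int (G n w)) \<le> ennreal (real_of_int (G (Suc n) w))" for n
        using paths by eventually_elim (auto intro!: ennreal_leI dest: monoD[where x = n and y = "Suc n"])
      have [measurable]: "G n \<in> M \<rightarrow>\<^sub>M count_space UNIV" for n
      proof -
        have "monotone_process M r N (- (int n + m)) (int n + m) \<omega> (H (- (int n + m)) (int n + m))"
          using proc m by simp
        then show ?thesis
          unfolding G_def using t by (simp add: monotone_process_def)
      qed
      show "(\<lambda>w. ennreal (real_of_int (G n w))) \<in> borel_measurable M" for n
        by measurable
    qed
    also have "\<dots> \<le> ennreal (4 * exp \<theta> * t + 3 * K * \<bar>real_of_int i\<bar>)"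
    proof (rule SUP_least)
      fix n
      have proc_n: "monotone_process M r N (- (int n + m)) (int n + m) \<omega> (H (- (int n + m)) (int n + m))"
        using proc m by simp
      have i: "i \<in> {- (int n + m)..<int n + m}"
        by (auto simp: m_def)
      have [measurable]: "G n \<in> M \<rightarrow>\<^sub>M count_space UNIV"
        unfolding G_def using proc_n t by (simp add: monotone_process_def)
      have h: "\<bar>real_of_int ?h\<bar> \<le> K * \<bar>real_of_int i\<bar>"
      proof -
        have "real_of_int \<bar>?h\<bar> \<le> real_of_int (int K * \<bar>i\<bar>)"
          using K[of i] by (simp only: of_int_le_iff)
        then show ?thesis
          by simp
      qed
      have "(\<integral>\<^sup>+w. ennreal (real_of_int (G n w)) \<partial>M)
          \<le> (\<integral>\<^sup>+w. ennreal (real_of_int (G n w - ?h)) + ennreal \<bar>real_of_int ?h\<bar> \<partial>M)"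
      proof (rule nn_integral_mono)
        fix w
        have "ennreal (real_of_int (G n w)) \<le> ennreal (max 0 (real_of_int (G n w - ?h)) + \<bar>real_of_int ?h\<bar>)"
          by (rule ennreal_leI) auto
        also have "\<dots> = ennreal (max 0 (real_of_int (G n w - ?h))) + ennreal \<bar>real_of_int ?h\<bar>"
          by (rule ennreal_plus) auto
        also have "ennreal (max 0 (real_of_int (G n w - ?h))) = ennreal (real_of_int (G n w - ?h))"
          by (simp add: max_def ennreal_neg)
        finally show "ennreal (real_of_int (G n w)) \<le> ennreal (real_of_int (G n w - ?h)) + ennreal \<bar>real_of_int ?h\<bar>" .
      qed
      also have "\<dots> = (\<integral>\<^sup>+w. ennreal (real_of_int (G n w - ?h)) \<partial>M) + ennreal \<bar>real_of_int ?h\<bar>"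
        by (subst nn_integral_add) (simp_all add: emeasure_space_1)
      also have "\<dots> \<le> ennreal (K * \<bar>i\<bar> + 4 * exp \<theta> * t - ?h) + ennreal \<bar>real_of_int ?h\<bar>"
        unfolding G_def
        by (intro add_mono order.refl process_growth[OF assms(1) \<beta> \<theta>_def K proc_n t i])
      \<comment> \<open>The initial height is at most \<open>K * \<bar>i\<bar>\<close> in absolute
        value: subtracting it yields the second \<open>K * \<bar>i\<bar>\<close>, adding it back the
        third.\<close>
      also have "\<dots> \<le> ennreal (2 * (K * \<bar>real_of_int i\<bar>) + 4 * exp \<theta> * t) + ennreal (K * \<bar>real_of_int i\<bar>)"
        using h by (intro add_mono ennreal_leI) auto
      also have "\<dots> = ennreal (4 * exp \<theta> * t + 3 * K * \<bar>real_of_int i\<bar>)"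
        using t by (subst ennreal_plus[symmetric]) (auto simp: algebra_simps)
      finally show "(\<integral>\<^sup>+w. ennreal (real_of_int (G n w)) \<partial>M) \<le> ennreal (4 * exp \<theta> * t + 3 * K * \<bar>real_of_int i\<bar>)" .
    qed
    finally show "ereal_expectation M (limiting_height H t i) \<le> ereal (4 * exp \<theta> * t + 3 * K * \<bar>real_of_int i\<bar>)"
      using t by (intro ereal_expectation_le) auto
  qed
qed

end
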